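(* Let $M$ be a closed Riemannian manifold of dimension $n$. Let $u$ be a positive solution of the heat equation $\left(\frac{\partial}{\partial t}-\Delta\right)u=0$ on $M$ with $\int_M u\,dv=1$. Let $\tau=\tau(t)>0$ with $\frac{d\tau}{dt}=1$, and define $f$ by $u=\frac{e^{-f}}{(4\pi\tau)^{n/2}}$. Then $$\frac{d}{dt}\mathcal{W}(f,\tau)=-\int_M 2\tau\left(\left|\nabla_i\nabla_j f-\frac{1}{2\tau}g_{ij}\right|^2+R_{ij}f_if_j\right)u\,dv .$$ In particular, if $M$ has nonnegative Ricci curvature, then $\mathcal{W}(f,\tau)$ is monotone decreasing (i.e. non-increasing) in $t$ along the heat equation.
   Context: $g_{ij}$ is the Riemannian metric, $R_{ij}$ its Ricci tensor, $dv$ its volume form, $\Delta$ the Laplace–Beltrami operator (nonpositive sign convention, $\Delta=\operatorname{div}\nabla$), $f_i=\nabla_i f$, and $R_{ij}f_if_j=\mathrm{Ric}(\nabla f,\nabla f)$. The entropy is $$\mathcal{W}(f,\tau)=\int_M\left(\tau|\nabla f|^2+f-n\right)\frac{e^{-f}}{(4\pi\tau)^{n/2}}\,dv,$$ considered for pairs $(f,\tau)$ with $\tau>0$ and $\int_M\frac{e^{-f}}{(4\pi\tau)^{n/2}}\,dv=1$. *)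

theory Defs
  imports "HOL-Analysis.Analysis"
begin

text \<open>Meant for open \<open>S\<close> only: derivatives are taken at \<open>x\<close>, not within \<open>S\<close>.\<close>

primrec Ck_on :: "nat \<Rightarrow> 'a::real_normed_vector set \<Rightarrow> ('a \<Rightarrow> 'b::real_normed_vector) \<Rightarrow> bool" where
  "Ck_on 0 S f \<longleftrightarrow> continuous_on S f"
| "Ck_on (Suc k) S f \<longleftrightarrow>
     (\<forall>x\<in>S. f differentiable (at x)) \<and> (\<forall>v. Ck_on k S (\<lambda>x. frechet_derivative f (at x) v))"

definition smooth_on :: "'a::real_normed_vector set \<Rightarrow> ('a \<Rightarrow> 'b::real_normed_vector) \<Rightarrow> bool" where
  "smooth_on S f \<longleftrightarrow> (\<forall>k. Ck_on k S f)"

text \<open>A chart is a pair of its domain and its coordinate map; the values of the coordinate map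
  outside the domain are irrelevant.  The dimension of the manifold is \<open>CARD('n)\<close>.\<close>

type_synonym ('a, 'n) chart = "'a set \<times> ('a \<Rightarrow> real ^ 'n)"

definition chart_image :: "('a, 'n) chart \<Rightarrow> (real ^ 'n) set" where
  "chart_image c = snd c ` fst c"

definition chart_inv :: "('a, 'n) chart \<Rightarrow> real ^ 'n \<Rightarrow> 'a" where
  "chart_inv c = inv_into (fst c) (snd c)"

definition transition :: "('a, 'n) chart \<Rightarrow> ('a, 'n) chart \<Rightarrow> real ^ 'n \<Rightarrow> real ^ 'n" where
  "transition c d = snd d \<circ> chart_inv c"

definition is_chart :: "'a topology \<Rightarrow> ('a, 'n::finite) chart \<Rightarrow> bool" where
  "is_chart M c \<longleftrightarrow>
     openin M (fst c) \<and> open (chart_image c) \<and>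
     homeomorphic_map (subtopology M (fst c)) (top_of_set (chart_image c)) (snd c)"

definition smooth_atlas :: "'a topology \<Rightarrow> ('a, 'n::finite) chart set \<Rightarrow> bool" where
  "smooth_atlas M A \<longleftrightarrow>
     (\<forall>c\<in>A. is_chart M c) \<and> (\<Union>c\<in>A. fst c) = topspace M \<and>
     (\<forall>c\<in>A. \<forall>d\<in>A. smooth_on (snd c ` (fst c \<inter> fst d)) (transition c d))"

text \<open>Second countability is not listed because it follows from compactness.
  Charts map onto open subsets of Euclidean space, so there is no boundary.\<close>

definition closed_manifold :: "'a topology \<Rightarrow> ('a, 'n::finite) chart set \<Rightarrow> bool" where
  "closed_manifold M A \<longleftrightarrow> Hausdorff_space M \<and> compact_space M \<and> smooth_atlas M A"

text \<open>A metric is given by its coefficient matrices \<open>g c y $ i $ j\<close> at the point with coordinates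
  \<open>y\<close> in the chart \<open>c\<close>, which transform as a covariant 2-tensor under a change of charts.\<close>

definition riemannian_metric ::
    "('a, 'n::finite) chart set \<Rightarrow> (('a, 'n) chart \<Rightarrow> real ^ 'n \<Rightarrow> real ^ 'n ^ 'n) \<Rightarrow> bool" where
  "riemannian_metric A g \<longleftrightarrow>
     (\<forall>c\<in>A. smooth_on (chart_image c) (g c) \<and>
        (\<forall>y\<in>chart_image c.
           transpose (g c y) = g c y \<and> (\<forall>v. v \<noteq> 0 \<longrightarrow> v \<bullet> (g c y *v v) > 0))) \<and>
     (\<forall>c\<in>A. \<forall>d\<in>A. \<forall>y\<in>snd c ` (fst c \<inter> fst d).
        (let J = matrix (frechet_derivative (transition c d) (at y))
         in g c y = transpose J ** g d (transition c d y) ** J))"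

definition closed_riemannian_manifold ::
    "'a topology \<Rightarrow> ('a, 'n::finite) chart set \<Rightarrow> (('a, 'n) chart \<Rightarrow> real ^ 'n \<Rightarrow> real ^ 'n ^ 'n) \<Rightarrow> bool"
  where
  "closed_riemannian_manifold M A g \<longleftrightarrow> closed_manifold M A \<and> riemannian_metric A g"

text \<open>The volume measure \<open>dv\<close> is the unique Borel measure on \<open>M\<close> that has the density
  \<open>sqrt (det g)\<close> with respect to Lebesgue measure in every chart.\<close>

definition riemannian_volume ::
    "'a topology \<Rightarrow> ('a, 'n::finite) chart set \<Rightarrow> (('a, 'n) chart \<Rightarrow> real ^ 'n \<Rightarrow> real ^ 'n ^ 'n) \<Rightarrow> 'a measure"
  where
  "riemannian_volume M A g = (THE \<mu>.
     space \<mu> = topspace M \<and> sets \<mu> = sigma_sets (topspace M) {U. openin M U} \<and>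
     (\<forall>c\<in>A. \<forall>B\<in>sets \<mu>. B \<subseteq> fst c \<longrightarrow>
        emeasure \<mu> B = (\<integral>\<^sup>+ y. ennreal (sqrt (det (g c y))) * indicator (snd c ` B) y \<partial>lborel)))"

text \<open>Below, \<open>G\<close> is a metric and \<open>F\<close> a function on an open subset of \<open>real ^ 'n\<close>.\<close>

definition partial :: "'n::finite \<Rightarrow> (real ^ 'n \<Rightarrow> real) \<Rightarrow> real ^ 'n \<Rightarrow> real" where
  "partial i F y = frechet_derivative F (at y) (axis i 1)"

definition loc_christoffel ::
    "(real ^ 'n \<Rightarrow> real ^ 'n ^ 'n) \<Rightarrow> 'n::finite \<Rightarrow> 'n \<Rightarrow> 'n \<Rightarrow> real ^ 'n \<Rightarrow> real" where
  \<comment> \<open>\<open>loc_christoffel G k i j\<close> has upper index \<open>k\<close> and lower indices \<open>i\<close>, \<open>j\<close>.\<close>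
  "loc_christoffel G k i j y =
     (1/2) * (\<Sum>l\<in>UNIV. matrix_inv (G y) $ k $ l *
        (partial i (\<lambda>z. G z $ j $ l) y + partial j (\<lambda>z. G z $ i $ l) y
         - partial l (\<lambda>z. G z $ i $ j) y))"

text \<open>The sign is the one for which round spheres have positive Ricci curvature.\<close>

definition loc_ricci ::
    "(real ^ 'n \<Rightarrow> real ^ 'n ^ 'n) \<Rightarrow> real ^ 'n \<Rightarrow> real ^ 'n ^ 'n::finite" where
  "loc_ricci G y = (\<chi> i j.
     (\<Sum>k\<in>UNIV. partial k (loc_christoffel G k i j) y - partial j (loc_christoffel G k i k) y
        + (\<Sum>l\<in>UNIV. loc_christoffel G k k l y * loc_christoffel G l i j y
                    - loc_christoffel G k j l y * loc_christoffel G l i k y)))"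

definition loc_gradient ::
    "(real ^ 'n \<Rightarrow> real ^ 'n ^ 'n) \<Rightarrow> (real ^ 'n \<Rightarrow> real) \<Rightarrow> real ^ 'n \<Rightarrow> real ^ 'n::finite" where
  "loc_gradient G F y = (\<chi> i. \<Sum>j\<in>UNIV. matrix_inv (G y) $ i $ j * partial j F y)"

definition loc_divergence ::
    "(real ^ 'n \<Rightarrow> real ^ 'n ^ 'n) \<Rightarrow> (real ^ 'n \<Rightarrow> real ^ 'n) \<Rightarrow> real ^ 'n::finite \<Rightarrow> real" where
  \<comment> \<open>The trace of the covariant derivative of the vector field \<open>X\<close>.\<close>
  "loc_divergence G X y =
     (\<Sum>i\<in>UNIV. partial i (\<lambda>z. X z $ i) y + (\<Sum>k\<in>UNIV. loc_christoffel G i i k y * X y $ k))"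

definition loc_laplacian ::
    "(real ^ 'n \<Rightarrow> real ^ 'n ^ 'n) \<Rightarrow> (real ^ 'n \<Rightarrow> real) \<Rightarrow> real ^ 'n::finite \<Rightarrow> real" where
  "loc_laplacian G F = loc_divergence G (loc_gradient G F)"

definition loc_hessian ::
    "(real ^ 'n \<Rightarrow> real ^ 'n ^ 'n) \<Rightarrow> (real ^ 'n \<Rightarrow> real) \<Rightarrow> real ^ 'n \<Rightarrow> real ^ 'n ^ 'n::finite" where
  "loc_hessian G F y = (\<chi> i j.
     partial i (partial j F) y - (\<Sum>k\<in>UNIV. loc_christoffel G k i j y * partial k F y))"

text \<open>The squared norms, with respect to a metric with matrix \<open>P\<close> at a point, of a vector and of a
  covariant 2-tensor.\<close>

definition vec_norm2 :: "real ^ 'n ^ 'n \<Rightarrow> real ^ 'n \<Rightarrow> real" where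
  "vec_norm2 P v = (\<Sum>i\<in>UNIV. \<Sum>j\<in>UNIV. P $ i $ j * v $ i * v $ j)"

definition tensor_norm2 :: "real ^ 'n ^ 'n \<Rightarrow> real ^ 'n ^ 'n \<Rightarrow> real" where
  "tensor_norm2 P T = (\<Sum>i\<in>UNIV. \<Sum>j\<in>UNIV. \<Sum>k\<in>UNIV. \<Sum>l\<in>UNIV.
     matrix_inv P $ i $ k * matrix_inv P $ j $ l * T $ i $ j * T $ k $ l)"

text \<open>The quantities are evaluated at \<open>p\<close> in some chart of the atlas around \<open>p\<close>; all operators \<open>D\<close>
  used below are tensorial, so their value does not depend on this choice.\<close>

definition in_chart ::
    "('a, 'n::finite) chart set \<Rightarrow> (('a, 'n) chart \<Rightarrow> real ^ 'n \<Rightarrow> real ^ 'n ^ 'n)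
     \<Rightarrow> ((real ^ 'n \<Rightarrow> real ^ 'n ^ 'n) \<Rightarrow> (real ^ 'n \<Rightarrow> real) \<Rightarrow> real ^ 'n \<Rightarrow> real)
     \<Rightarrow> ('a \<Rightarrow> real) \<Rightarrow> 'a \<Rightarrow> real" where
  "in_chart A g D h p =
     (let c = (SOME c. c \<in> A \<and> p \<in> fst c) in D (g c) (h \<circ> chart_inv c) (snd c p))"

definition laplacian ::
    "('a, 'n::finite) chart set \<Rightarrow> (('a, 'n) chart \<Rightarrow> real ^ 'n \<Rightarrow> real ^ 'n ^ 'n)
     \<Rightarrow> ('a \<Rightarrow> real) \<Rightarrow> 'a \<Rightarrow> real" where
  "laplacian A g = in_chart A g loc_laplacian"

definition grad_norm2 ::
    "('a, 'n::finite) chart set \<Rightarrow> (('a, 'n) chart \<Rightarrow> real ^ 'n \<Rightarrow> real ^ 'n ^ 'n)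
     \<Rightarrow> ('a \<Rightarrow> real) \<Rightarrow> 'a \<Rightarrow> real" where
  "grad_norm2 A g = in_chart A g (\<lambda>G F y. vec_norm2 (G y) (loc_gradient G F y))"

definition hess_shift_norm2 ::
    "('a, 'n::finite) chart set \<Rightarrow> (('a, 'n) chart \<Rightarrow> real ^ 'n \<Rightarrow> real ^ 'n ^ 'n)
     \<Rightarrow> real \<Rightarrow> ('a \<Rightarrow> real) \<Rightarrow> 'a \<Rightarrow> real" where
  "hess_shift_norm2 A g s =
     in_chart A g (\<lambda>G F y. tensor_norm2 (G y) (loc_hessian G F y - s *\<^sub>R G y))"

definition ricci_grad ::
    "('a, 'n::finite) chart set \<Rightarrow> (('a, 'n) chart \<Rightarrow> real ^ 'n \<Rightarrow> real ^ 'n ^ 'n)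
     \<Rightarrow> ('a \<Rightarrow> real) \<Rightarrow> 'a \<Rightarrow> real" where
  "ricci_grad A g =
     in_chart A g (\<lambda>G F y. loc_gradient G F y \<bullet> (loc_ricci G y *v loc_gradient G F y))"

definition nonneg_ricci ::
    "('a, 'n::finite) chart set \<Rightarrow> (('a, 'n) chart \<Rightarrow> real ^ 'n \<Rightarrow> real ^ 'n ^ 'n) \<Rightarrow> bool" where
  "nonneg_ricci A g \<longleftrightarrow>
     (\<forall>c\<in>A. \<forall>y\<in>chart_image c. \<forall>v. 0 \<le> v \<bullet> (loc_ricci (g c) y *v v))"

definition smooth_in_spacetime ::
    "('a, 'n::finite) chart set \<Rightarrow> real set \<Rightarrow> (real \<Rightarrow> 'a \<Rightarrow> real) \<Rightarrow> bool" where
  "smooth_in_spacetime A I u \<longleftrightarrow>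
     (\<forall>c\<in>A. smooth_on (I \<times> chart_image c) (\<lambda>(t, y). u t (chart_inv c y)))"

definition heat_solution ::
    "'a topology \<Rightarrow> ('a, 'n::finite) chart set \<Rightarrow> (('a, 'n) chart \<Rightarrow> real ^ 'n \<Rightarrow> real ^ 'n ^ 'n)
     \<Rightarrow> real set \<Rightarrow> (real \<Rightarrow> 'a \<Rightarrow> real) \<Rightarrow> bool" where
  "heat_solution M A g I u \<longleftrightarrow>
     smooth_in_spacetime A I u \<and>
     (\<forall>t\<in>I. \<forall>p\<in>topspace M. ((\<lambda>s. u s p) has_real_derivative laplacian A g (u t) p) (at t))"

definition entropy_W ::
    "'a topology \<Rightarrow> ('a, 'n::finite) chart set \<Rightarrow> (('a, 'n) chart \<Rightarrow> real ^ 'n \<Rightarrow> real ^ 'n ^ 'n)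
     \<Rightarrow> ('a \<Rightarrow> real) \<Rightarrow> real \<Rightarrow> real" where
  "entropy_W M A g f \<tau> =
     (\<integral>p. (\<tau> * grad_norm2 A g f p + f p - real CARD('n))
          * (exp (- f p) / (4 * pi * \<tau>) powr (real CARD('n) / 2)) \<partial>riemannian_volume M A g)"

end

theory Submission
  imports Defs
begin

text \<open>
Write \<open>\<langle>a, b\<rangle>\<close> for the inner product of the gradients of two functions, \<open>h = \<langle>f, f\<rangle>\<close>, and
\<open>L(a, b) = a \<Delta>b + \<langle>a, b\<rangle>\<close>, which is the divergence of \<open>a \<nabla>b\<close> and so has integral \<open>0\<close> over a
closed manifold.  From \<open>u = e\<^sup>-\<^sup>f / (4\<pi>\<tau>)\<^sup>n\<^sup>/\<^sup>2\<close> one gets \<open>\<langle>u, w\<rangle> = - u \<langle>f, w\<rangle>\<close> and \<open>\<Delta>u = u (h - \<Delta>f)\<close>, so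
the heat equation says that \<open>f\<close> evolves by \<open>E = \<Delta>f - h - n/(2\<tau>)\<close>.  The entropy is the integral of
\<open>(\<tau> h + f - n) u\<close>; its time derivative is the integral of
\<open>(h + 2\<tau> \<langle>f, E\<rangle> + E) u + (\<tau> h + f - n) \<Delta>u\<close>.  Let \<open>T\<close> be the integrand on the right-hand side of the
claim.  The Bochner formula \<open>\<Delta>h / 2 = |Hess f|\<^sup>2 + \<langle>f, \<Delta>f\<rangle> + Ric(\<nabla>f, \<nabla>f)\<close> removes the Hessian and
the Ricci tensor from \<open>T\<close>, and then the derivative of the entropy integrand plus \<open>T\<close> equals, at
every point, \<open>\<tau> L(h, u) + \<tau> L(u, h) + L(f, u) - L(u, f) - n L(1, u)\<close>.  Integration gives the
formula (\<open>entropy_derivative\<close>).  If the Ricci curvature is nonnegative then so is \<open>T\<close>, whence the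
monotonicity.

The Bochner formula (\<open>bochner\<close>) is a statement about one chart.  There the gradient field \<open>X\<close> of \<open>f\<close>
satisfies \<open>\<nabla>h / 2 = \<nabla>\<^sub>X X\<close>, because the Levi-Civita connection is metric and the Hessian symmetric;
and \<open>div (\<nabla>\<^sub>X X) = tr ((\<nabla>X)\<^sup>2) + X (div X) + Ric(X, X)\<close> is an algebraic identity for any vector field
and any symmetric connection (\<open>divergence_nabla_self\<close>).

The operators have to be compared in different charts.  For \<open>\<langle>a, b\<rangle>\<close> this is the chain rule.  The
Hessian can be written with these products alone,
\<open>2 Hess F (\<nabla>a, \<nabla>b) = \<langle>a, \<langle>F, b\<rangle>\<rangle> + \<langle>b, \<langle>F, a\<rangle>\<rangle> - \<langle>F, \<langle>a, b\<rangle>\<rangle>\<close>, and so inherits their invariance, as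
does its trace, the Laplacian.  The Ricci term is evaluated at each point in the same chart as the
Bochner formula that removes it.

The volume measure exists because the density \<open>sqrt (det g)\<close> absorbs the Jacobian of a change of
charts (\<open>vol_chart_consistent\<close>, \<open>ex1_volume\<close>).  For the divergence theorem, Jacobi's formula turns
\<open>L(a, b) sqrt (det g)\<close> into a sum of partial derivatives in a chart.  The integral of a partial
derivative of a compactly supported function is \<open>0\<close> by translation invariance, and \<open>a\<close> is cut into
pieces supported in coordinate balls.  As \<open>a\<close> is differentiated only once, continuously
differentiable cutoffs suffice.
\<close>

section \<open>Functions of class C^k and smooth functions\<close>

lemma has_derivative_frechet:
  "f differentiable (at x) \<Longrightarrow> (f has_derivative frechet_derivative f (at x)) (at x)"
  by (simp add: frechet_derivative_works)

lemma frechet_derivative_eqI: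
  "(f has_derivative D) (at x) \<Longrightarrow> frechet_derivative f (at x) = D"
  by (rule frechet_derivative_at[symmetric])

lemma frechet_derivative_cong_open:
  assumes "open S" "x \<in> S" "\<And>y. y \<in> S \<Longrightarrow> f y = g y"
  shows "frechet_derivative f (at x) = frechet_derivative g (at x)"
proof -
  have "(f has_derivative D) (at x) \<longleftrightarrow> (g has_derivative D) (at x)" for D
    using has_derivative_transform_within_open[of f D x UNIV S g]
      has_derivative_transform_within_open[of g D x UNIV S f] assms by auto
  then show ?thesis unfolding frechet_derivative_def by simp
qed

lemma differentiable_cong_open:
  assumes "open S" "x \<in> S" "\<And>y. y \<in> S \<Longrightarrow> f y = g y" "f differentiable (at x)"
  shows "g differentiable (at x)"
  using assms has_derivative_transform_within_open[of f _ x UNIV S g]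
  unfolding differentiable_def by blast

lemma Ck_on_cong:
  assumes "open S" "\<And>y. y \<in> S \<Longrightarrow> f y = g y" "Ck_on k S f"
  shows "Ck_on k S g"
  using assms(2,3)
proof (induction k arbitrary: f g)
  case 0
  then show ?case by (simp cong: continuous_on_cong)
next
  case (Suc k)
  have "g differentiable (at x)" if "x \<in> S" for x
    using differentiable_cong_open[OF assms(1) that, of f g] Suc.prems that by auto
  moreover have "Ck_on k S (\<lambda>x. frechet_derivative g (at x) v)" for v
    by (rule Suc.IH[of "\<lambda>x. frechet_derivative f (at x) v"])
       (use Suc.prems frechet_derivative_cong_open[OF assms(1), of _ f g] in auto)
  ultimately show ?case by simp
qed

lemma Ck_on_subset: "Ck_on k S f \<Longrightarrow> T \<subseteq> S \<Longrightarrow> Ck_on k T f"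
  by (induction k arbitrary: f) (auto intro: continuous_on_subset)

lemma Ck_on_Suc_imp: "Ck_on (Suc k) S f \<Longrightarrow> Ck_on k S f"
proof (induction k arbitrary: f)
  case 0
  then show ?case
    by (auto intro!: continuous_at_imp_continuous_on differentiable_imp_continuous_within)
next
  case (Suc k)
  then show ?case by (metis Ck_on.simps(2))
qed

lemma Ck_on_le: "Ck_on m S f \<Longrightarrow> k \<le> m \<Longrightarrow> Ck_on k S f"
proof (induction m)
  case (Suc m)
  then show ?case using Ck_on_Suc_imp by (metis le_Suc_eq)
qed simp

lemma Ck_on_imp_continuous_on: "Ck_on k S f \<Longrightarrow> continuous_on S f"
  using Ck_on_le[of k S f 0] by simp

lemma Ck_on_union:
  assumes "Ck_on k S f" "Ck_on k T f" "open S" "open T"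
  shows "Ck_on k (S \<union> T) f"
  using assms by (induction k arbitrary: f) (auto intro: continuous_on_open_Un)

lemma Ck_on_const: "Ck_on k S (\<lambda>x. c)"
proof (induction k arbitrary: c)
  case (Suc k)
  then show ?case by simp
qed simp

lemma Ck_on_bounded_linear:
  assumes "bounded_linear L"
  shows "Ck_on k S L"
proof (cases k)
  case 0
  then show ?thesis using assms by (simp add: linear_continuous_on)
next
  case (Suc m)
  have "frechet_derivative L (at x) v = L v" for x v
    using frechet_derivative_eqI[OF bounded_linear_imp_has_derivative[OF assms]] by simp
  then show ?thesis using Suc assms
    by (auto simp: Ck_on_const bounded_linear_imp_differentiable)
qed

lemma Ck_on_linear_compose:
  assumes "bounded_linear L" "open S" "Ck_on k S f"
  shows "Ck_on k S (\<lambda>x. L (f x))"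
  using assms(3)
proof (induction k arbitrary: f)
  case 0
  then show ?case
    by (simp add: assms(1) bounded_linear.continuous_on)
next
  case (Suc k)
  have d: "((\<lambda>x. L (f x)) has_derivative (\<lambda>v. L (frechet_derivative f (at x) v))) (at x)" if "x \<in> S" for x
    using bounded_linear.has_derivative[OF assms(1) has_derivative_frechet[of f x]] Suc.prems that by auto
  have "Ck_on k S (\<lambda>x. frechet_derivative (\<lambda>x. L (f x)) (at x) v)" for v
    by (rule Ck_on_cong[OF assms(2) _ Suc.IH[of "\<lambda>x. frechet_derivative f (at x) v"]])
       (use Suc.prems frechet_derivative_eqI[OF d] in auto)
  then show ?case using d by (auto simp: differentiable_def)
qed

lemma Ck_on_add:
  assumes "open S" "Ck_on k S f" "Ck_on k S g"
  shows "Ck_on k S (\<lambda>x. f x + g x)"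
  using assms(2,3)
proof (induction k arbitrary: f g)
  case 0
  then show ?case by (simp add: continuous_on_add)
next
  case (Suc k)
  have d: "((\<lambda>x. f x + g x) has_derivative
     (\<lambda>v. frechet_derivative f (at x) v + frechet_derivative g (at x) v)) (at x)" if "x \<in> S" for x
    using has_derivative_add[OF has_derivative_frechet[of f x] has_derivative_frechet[of g x]]
      Suc.prems that by auto
  have "Ck_on k S (\<lambda>x. frechet_derivative (\<lambda>x. f x + g x) (at x) v)" for v
    by (rule Ck_on_cong[OF assms(1) _ Suc.IH[of "\<lambda>x. frechet_derivative f (at x) v"
            "\<lambda>x. frechet_derivative g (at x) v"]])
       (use Suc.prems frechet_derivative_eqI[OF d] in auto)
  then show ?case using d by (auto simp: differentiable_def)
qed

lemma Ck_on_scaleR: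
  assumes "open S" "Ck_on k S f" "Ck_on k S g"
  shows "Ck_on k S (\<lambda>x. f x *\<^sub>R g x)"
  using assms(2,3)
proof (induction k arbitrary: f g)
  case 0
  then show ?case by (simp add: continuous_on_scaleR)
next
  case (Suc k)
  have d: "((\<lambda>x. f x *\<^sub>R g x) has_derivative
     (\<lambda>v. f x *\<^sub>R frechet_derivative g (at x) v + frechet_derivative f (at x) v *\<^sub>R g x)) (at x)" if "x \<in> S" for x
    using has_derivative_scaleR[OF has_derivative_frechet[of f x] has_derivative_frechet[of g x]]
      Suc.prems that by auto
  have "Ck_on k S (\<lambda>x. frechet_derivative (\<lambda>x. f x *\<^sub>R g x) (at x) v)" for v
    by (rule Ck_on_cong[OF assms(1) _ Ck_on_add[OF assms(1) Suc.IH[of f "\<lambda>x. frechet_derivative g (at x) v"]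
           Suc.IH[of "\<lambda>x. frechet_derivative f (at x) v" g]]])
       (use Suc.prems frechet_derivative_eqI[OF d] Ck_on_Suc_imp[of k S] in auto)
  then show ?case using d by (auto simp: differentiable_def)
qed

lemma Ck_on_mult:
  fixes f g :: "'a::real_normed_vector \<Rightarrow> real"
  assumes "open S" "Ck_on k S f" "Ck_on k S g"
  shows "Ck_on k S (\<lambda>x. f x * g x)"
  using Ck_on_scaleR[OF assms] by simp

lemma Ck_on_sum:
  assumes "open S" "\<And>i. i \<in> I \<Longrightarrow> Ck_on k S (f i)"
  shows "Ck_on k S (\<lambda>x. \<Sum>i\<in>I. f i x)"
  using assms(2) by (induction I rule: infinite_finite_induct) (auto simp: Ck_on_const Ck_on_add assms(1))

lemma Ck_on_prod:
  fixes f :: "'i \<Rightarrow> 'a::real_normed_vector \<Rightarrow> real"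
  assumes "open S" "\<And>i. i \<in> I \<Longrightarrow> Ck_on k S (f i)"
  shows "Ck_on k S (\<lambda>x. \<Prod>i\<in>I. f i x)"
  using assms(2) by (induction I rule: infinite_finite_induct) (auto simp: Ck_on_const Ck_on_mult assms(1))

text \<open>By the chain rule a directional derivative of the composition is a sum over a basis of products of
derivatives of \<open>\<phi>\<close> with derivatives of \<open>f\<close> composed with \<open>\<phi>\<close>; this closes the induction on \<open>k\<close>.\<close>
lemma Ck_on_compose:
  fixes \<phi> :: "'a::real_normed_vector \<Rightarrow> 'b::euclidean_space" and f :: "'b \<Rightarrow> 'c::real_normed_vector"
  assumes "open S" "open T" "\<phi> ` S \<subseteq> T" "Ck_on k T f" "Ck_on k S \<phi>"
  shows "Ck_on k S (\<lambda>x. f (\<phi> x))"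
  using assms(4,5)
proof (induction k arbitrary: f)
  case 0
  then show ?case using assms(3) by (auto intro: continuous_on_compose2)
next
  case (Suc k)
  have d: "((\<lambda>x. f (\<phi> x)) has_derivative
     (\<lambda>v. frechet_derivative f (at (\<phi> x)) (frechet_derivative \<phi> (at x) v))) (at x)" if "x \<in> S" for x
  proof -
    have "(f has_derivative frechet_derivative f (at (\<phi> x))) (at (\<phi> x))"
      using Suc.prems that assms(3) has_derivative_frechet by (metis Ck_on.simps(2) image_subset_iff)
    then show ?thesis
      using diff_chain_at[OF has_derivative_frechet[of \<phi> x]] Suc.prems that by (auto simp: comp_def)
  qed
  have e: "frechet_derivative (\<lambda>x. f (\<phi> x)) (at x) v =
      (\<Sum>b\<in>Basis. (frechet_derivative \<phi> (at x) v \<bullet> b) *\<^sub>R frechet_derivative f (at (\<phi> x)) b)" if "x \<in> S" for x v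
  proof -
    have "linear (frechet_derivative f (at (\<phi> x)))"
      using Suc.prems that assms(3) linear_frechet_derivative by (metis Ck_on.simps(2) image_subset_iff)
    then show ?thesis
      unfolding frechet_derivative_eqI[OF d[OF that]]
      by (subst euclidean_representation[of "frechet_derivative \<phi> (at x) v", symmetric])
         (simp only: linear_sum linear_scale)
  qed
  have "Ck_on k S (\<lambda>x. frechet_derivative (\<lambda>x. f (\<phi> x)) (at x) v)" for v
  proof (rule Ck_on_cong[OF assms(1) e[symmetric]], assumption)
    show "Ck_on k S (\<lambda>x. \<Sum>b\<in>Basis. (frechet_derivative \<phi> (at x) v \<bullet> b) *\<^sub>R frechet_derivative f (at (\<phi> x)) b)"
    proof (intro Ck_on_sum Ck_on_scaleR assms(1))
      fix b :: 'b
      show "Ck_on k S (\<lambda>x. frechet_derivative \<phi> (at x) v \<bullet> b)"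
        using Suc.prems by (intro Ck_on_linear_compose[OF bounded_linear_inner_left assms(1)]) auto
      show "Ck_on k S (\<lambda>x. frechet_derivative f (at (\<phi> x)) b)"
        by (rule Suc.IH) (use Suc.prems Ck_on_Suc_imp[OF Suc.prems(2)] in auto)
    qed
  qed
  then show ?case using d by (auto simp: differentiable_def)
qed

lemma Ck_on_inverse: "Ck_on k (- {0::real}) inverse"
proof (induction k)
  case 0
  then show ?case by (auto intro!: continuous_intros)
next
  case (Suc k)
  have d: "(inverse has_derivative (\<lambda>v. v *\<^sub>R (- (inverse x * inverse x)))) (at x)" if "x \<noteq> 0" for x::real
    using that by (auto intro!: derivative_eq_intros)
  have "Ck_on k (-{0}) (\<lambda>x. (v * (-1)) * (inverse x * inverse x))" for v :: real
    by (intro Ck_on_mult Ck_on_const Suc) auto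
  then have "Ck_on k (-{0}) (\<lambda>x. frechet_derivative inverse (at x) v)" for v :: real
    by (rule Ck_on_cong[rotated 2]) (auto simp: frechet_derivative_eqI[OF d])
  then show ?case using d by (auto simp: differentiable_def)
qed

lemma Ck_on_ln: "Ck_on k {0::real<..} ln"
proof (cases k)
  case 0
  then show ?thesis by (auto intro!: continuous_intros)
next
  case (Suc m)
  have d: "(ln has_derivative (\<lambda>v. v * inverse x)) (at x)" if "x > 0" for x::real
    using that by (auto intro!: derivative_eq_intros simp: field_simps)
  have "Ck_on m {0<..} (\<lambda>x. v * inverse x)" for v :: real
    by (intro Ck_on_mult Ck_on_const Ck_on_subset[OF Ck_on_inverse]) auto
  then have "Ck_on m {0<..} (\<lambda>x. frechet_derivative ln (at x) v)" for v :: real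
    by (rule Ck_on_cong[rotated 2]) (auto simp: frechet_derivative_eqI[OF d])
  then show ?thesis using d Suc by (auto simp: differentiable_def)
qed

lemma has_real_derivative_along_line:
  fixes f :: "'a::real_normed_vector \<Rightarrow> real"
  assumes "f differentiable (at (a + r *\<^sub>R v))"
  shows "((\<lambda>r. f (a + r *\<^sub>R v)) has_real_derivative frechet_derivative f (at (a + r *\<^sub>R v)) v) (at r)"
proof -
  have l: "linear (frechet_derivative f (at (a + r *\<^sub>R v)))"
    by (rule linear_frechet_derivative[OF assms])
  have "((\<lambda>r. a + r *\<^sub>R v) has_derivative (\<lambda>h. h *\<^sub>R v)) (at r)"
    by (auto intro!: derivative_eq_intros)
  from diff_chain_at[OF this has_derivative_frechet[OF assms]]
  have "((\<lambda>r. f (a + r *\<^sub>R v)) has_derivative (\<lambda>h. frechet_derivative f (at (a + r *\<^sub>R v)) (h *\<^sub>R v))) (at r)"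
    by (simp add: comp_def)
  then show ?thesis
    unfolding has_field_derivative_def
    by (rule has_derivative_eq_rhs) (simp add: fun_eq_iff linear_scale[OF l])
qed

text \<open>The symmetry of second derivatives rests on the second difference quotient, which is symmetric in \<open>v\<close>
and \<open>w\<close>.  Applying the mean value theorem twice shows that it is a value of the mixed derivative at a
point near \<open>x\<close>, and the mixed derivative is continuous.\<close>
lemma second_difference_near:
  fixes f :: "'a::real_normed_vector \<Rightarrow> real"
  assumes "open S" "Ck_on 2 S f" "x \<in> S" "e > 0"
  shows "\<exists>d>0. \<forall>s. 0 < s \<and> s < d \<longrightarrow>
    \<bar>(f (x + s *\<^sub>R v + s *\<^sub>R w) - f (x + s *\<^sub>R v) - f (x + s *\<^sub>R w) + f x) / (s * s)
       - frechet_derivative (\<lambda>y. frechet_derivative f (at y) v) (at x) w\<bar> < e"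
proof -
  define D where "D y = frechet_derivative f (at y) v" for y
  define DD where "DD y = frechet_derivative D (at y) w" for y
  have df: "f differentiable (at y)" if "y \<in> S" for y
    using assms(2) that by (simp add: numeral_2_eq_2)
  have dD: "D differentiable (at y)" if "y \<in> S" for y
    using assms(2) that by (simp add: numeral_2_eq_2 D_def[abs_def])
  have "continuous_on S DD"
    using assms(2) by (simp add: numeral_2_eq_2 D_def[abs_def] DD_def[abs_def])
  then have "isCont DD x" using assms(1,3) by (simp add: continuous_on_eq_continuous_at)
  then obtain d1 where d1: "d1 > 0" "\<And>y. dist y x < d1 \<Longrightarrow> dist (DD y) (DD x) < e"
    using assms(4) unfolding continuous_at_eps_delta by blast
  obtain d2 where d2: "d2 > 0" "ball x d2 \<subseteq> S" using assms(1,3) open_contains_ball by blast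
  \<comment> \<open>The summand \<open>1\<close> keeps the denominator positive when \<open>v = w = 0\<close>.\<close>
  define d where "d = min d1 d2 / (norm v + norm w + 1)"
  have np: "norm v + norm w + 1 > 0" by (smt (verit) norm_ge_zero)
  have dpos: "d > 0" using d1(1) d2(1) np by (simp add: d_def)
  have inb: "dist (x + a *\<^sub>R v + b *\<^sub>R w) x < d1 \<and> x + a *\<^sub>R v + b *\<^sub>R w \<in> S"
    if "0 \<le> a" "a \<le> s" "0 \<le> b" "b \<le> s" "s < d" for a b s
  proof -
    have "dist (x + a *\<^sub>R v + b *\<^sub>R w) x = norm (a *\<^sub>R v + b *\<^sub>R w)" by (simp add: dist_norm add.assoc)
    also have "\<dots> \<le> a * norm v + b * norm w"
      using norm_triangle_ineq[of "a *\<^sub>R v" "b *\<^sub>R w"] that by simp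
    also have "\<dots> \<le> s * norm v + s * norm w" using that by (intro add_mono mult_right_mono) auto
    also have "\<dots> \<le> s * (norm v + norm w + 1)" using that by (simp add: algebra_simps)
    also have "\<dots> < d * (norm v + norm w + 1)" using that np by (intro mult_strict_right_mono) auto
    also have "\<dots> = min d1 d2" using np by (simp add: d_def)
    finally show ?thesis using d2(2) by (auto simp: dist_commute subset_iff)
  qed
  have "\<bar>(f (x + s *\<^sub>R v + s *\<^sub>R w) - f (x + s *\<^sub>R v) - f (x + s *\<^sub>R w) + f x) / (s * s) - DD x\<bar> < e"
    if s: "0 < s" "s < d" for s
  proof -
    let ?\<phi> = "\<lambda>r. f ((x + s *\<^sub>R w) + r *\<^sub>R v) - f (x + r *\<^sub>R v)"
    have "(?\<phi> has_real_derivative D ((x + s *\<^sub>R w) + r *\<^sub>R v) - D (x + r *\<^sub>R v)) (at r)"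
      if "0 \<le> r" "r \<le> s" for r
      unfolding D_def
      by (intro DERIV_diff has_real_derivative_along_line df)
         (use inb[of r s s] inb[of r s 0] that s in \<open>auto simp: algebra_simps\<close>)
    then obtain \<xi> where \<xi>: "0 < \<xi>" "\<xi> < s"
      "?\<phi> s - ?\<phi> 0 = (s - 0) * (D ((x + s *\<^sub>R w) + \<xi> *\<^sub>R v) - D (x + \<xi> *\<^sub>R v))"
      using MVT2[of 0 s ?\<phi> "\<lambda>r. D ((x + s *\<^sub>R w) + r *\<^sub>R v) - D (x + r *\<^sub>R v)"] s by auto
    have "((\<lambda>r. D ((x + \<xi> *\<^sub>R v) + r *\<^sub>R w)) has_real_derivative DD ((x + \<xi> *\<^sub>R v) + r *\<^sub>R w)) (at r)"
      if "0 \<le> r" "r \<le> s" for r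
      unfolding DD_def
      by (intro has_real_derivative_along_line dD) (use inb[of \<xi> s r] that s \<xi> in auto)
    then obtain \<eta> where \<eta>: "0 < \<eta>" "\<eta> < s"
      "D ((x + \<xi> *\<^sub>R v) + s *\<^sub>R w) - D ((x + \<xi> *\<^sub>R v) + 0 *\<^sub>R w) = (s - 0) * DD ((x + \<xi> *\<^sub>R v) + \<eta> *\<^sub>R w)"
      using MVT2[of 0 s "\<lambda>r. D ((x + \<xi> *\<^sub>R v) + r *\<^sub>R w)" "\<lambda>r. DD ((x + \<xi> *\<^sub>R v) + r *\<^sub>R w)"] s by auto
    have "f (x + s *\<^sub>R v + s *\<^sub>R w) - f (x + s *\<^sub>R v) - f (x + s *\<^sub>R w) + f x = s * (s * DD ((x + \<xi> *\<^sub>R v) + \<eta> *\<^sub>R w))"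
      using \<xi>(3) \<eta>(3) by (simp add: algebra_simps)
    then have "(f (x + s *\<^sub>R v + s *\<^sub>R w) - f (x + s *\<^sub>R v) - f (x + s *\<^sub>R w) + f x) / (s * s)
       = DD ((x + \<xi> *\<^sub>R v) + \<eta> *\<^sub>R w)" using s by simp
    moreover have "\<bar>DD ((x + \<xi> *\<^sub>R v) + \<eta> *\<^sub>R w) - DD x\<bar> < e"
      using d1(2) inb[of \<xi> s \<eta>] \<xi> \<eta> s by (auto simp: dist_real_def)
    ultimately show ?thesis by simp
  qed
  then show ?thesis using dpos unfolding DD_def D_def by blast
qed

lemma frechet_derivative_symmetric:
  fixes f :: "'a::real_normed_vector \<Rightarrow> real"
  assumes "open S" "Ck_on 2 S f" "x \<in> S"
  shows "frechet_derivative (\<lambda>y. frechet_derivative f (at y) v) (at x) w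
       = frechet_derivative (\<lambda>y. frechet_derivative f (at y) w) (at x) v" (is "?A = ?B")
proof (rule ccontr)
  assume "?A \<noteq> ?B"
  define e where "e = \<bar>?A - ?B\<bar> / 2"
  have e: "e > 0" using \<open>?A \<noteq> ?B\<close> by (simp add: e_def)
  obtain d1 where d1: "d1 > 0" "\<And>s. 0 < s \<and> s < d1 \<Longrightarrow>
    \<bar>(f (x + s *\<^sub>R v + s *\<^sub>R w) - f (x + s *\<^sub>R v) - f (x + s *\<^sub>R w) + f x) / (s * s) - ?A\<bar> < e"
    using second_difference_near[OF assms e, of v w] by blast
  obtain d2 where d2: "d2 > 0" "\<And>s. 0 < s \<and> s < d2 \<Longrightarrow>
    \<bar>(f (x + s *\<^sub>R w + s *\<^sub>R v) - f (x + s *\<^sub>R w) - f (x + s *\<^sub>R v) + f x) / (s * s) - ?B\<bar> < e"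
    using second_difference_near[OF assms e, of w v] by blast
  define s where "s = min d1 d2 / 2"
  \<comment> \<open>The same number \<open>Q\<close> is close to both mixed derivatives.\<close>
  define Q where "Q = (f (x + s *\<^sub>R v + s *\<^sub>R w) - f (x + s *\<^sub>R v) - f (x + s *\<^sub>R w) + f x) / (s * s)"
  have s: "0 < s \<and> s < d1" "0 < s \<and> s < d2" using d1(1) d2(1) by (auto simp: s_def)
  have "\<bar>Q - ?A\<bar> < e" using d1(2)[OF s(1)] by (simp add: Q_def)
  moreover have "\<bar>Q - ?B\<bar> < e" using d2(2)[OF s(2)] by (simp add: Q_def algebra_simps)
  ultimately have "\<bar>?A - ?B\<bar> < e + e" by (smt (verit))
  then show False unfolding e_def by simp
qed

lemma smooth_on_imp_Ck: "smooth_on S f \<Longrightarrow> Ck_on k S f"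
  by (simp add: smooth_on_def)

lemma smooth_on_differentiable: "smooth_on S f \<Longrightarrow> x \<in> S \<Longrightarrow> f differentiable (at x)"
  using smooth_on_imp_Ck[of S f 1] by simp

lemma smooth_on_continuous: "smooth_on S f \<Longrightarrow> continuous_on S f"
  using smooth_on_imp_Ck[of S f 0] by simp

lemma smooth_on_frechet: "smooth_on S f \<Longrightarrow> smooth_on S (\<lambda>x. frechet_derivative f (at x) v)"
  unfolding smooth_on_def by (metis Ck_on.simps(2))

lemma smooth_on_partial: "smooth_on S F \<Longrightarrow> smooth_on S (partial i F)"
  unfolding partial_def by (rule smooth_on_frechet)

lemma smooth_on_cong: "open S \<Longrightarrow> (\<And>y. y \<in> S \<Longrightarrow> f y = g y) \<Longrightarrow> smooth_on S f \<Longrightarrow> smooth_on S g"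
  unfolding smooth_on_def using Ck_on_cong by metis

lemma smooth_on_subset: "smooth_on S f \<Longrightarrow> T \<subseteq> S \<Longrightarrow> smooth_on T f"
  unfolding smooth_on_def using Ck_on_subset by metis

lemma smooth_on_const: "smooth_on S (\<lambda>x. c)"
  by (simp add: smooth_on_def Ck_on_const)

lemma smooth_on_add: "open S \<Longrightarrow> smooth_on S f \<Longrightarrow> smooth_on S g \<Longrightarrow> smooth_on S (\<lambda>x. f x + g x)"
  by (simp add: smooth_on_def Ck_on_add)

lemma smooth_on_scaleR: "open S \<Longrightarrow> smooth_on S f \<Longrightarrow> smooth_on S g \<Longrightarrow> smooth_on S (\<lambda>x. f x *\<^sub>R g x)"
  by (simp add: smooth_on_def Ck_on_scaleR)

lemma smooth_on_mult:
  fixes f g :: "'a::real_normed_vector \<Rightarrow> real"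
  shows "open S \<Longrightarrow> smooth_on S f \<Longrightarrow> smooth_on S g \<Longrightarrow> smooth_on S (\<lambda>x. f x * g x)"
  by (simp add: smooth_on_def Ck_on_mult)

lemma smooth_on_minus: "open S \<Longrightarrow> smooth_on S f \<Longrightarrow> smooth_on S (\<lambda>x. - f x)"
  using smooth_on_scaleR[OF _ smooth_on_const[of S "-1"]] by simp

lemma smooth_on_diff: "open S \<Longrightarrow> smooth_on S f \<Longrightarrow> smooth_on S g \<Longrightarrow> smooth_on S (\<lambda>x. f x - g x)"
  using smooth_on_add[of S f "\<lambda>x. - g x"] smooth_on_minus[of S g] by simp

lemma smooth_on_sum: "open S \<Longrightarrow> (\<And>i. i \<in> I \<Longrightarrow> smooth_on S (f i)) \<Longrightarrow> smooth_on S (\<lambda>x. \<Sum>i\<in>I. f i x)"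
  by (simp add: smooth_on_def Ck_on_sum)

lemma smooth_on_prod:
  fixes f :: "'i \<Rightarrow> 'a::real_normed_vector \<Rightarrow> real"
  shows "open S \<Longrightarrow> (\<And>i. i \<in> I \<Longrightarrow> smooth_on S (f i)) \<Longrightarrow> smooth_on S (\<lambda>x. \<Prod>i\<in>I. f i x)"
  by (simp add: smooth_on_def Ck_on_prod)

lemma smooth_on_compose:
  fixes \<phi> :: "'a::real_normed_vector \<Rightarrow> 'b::euclidean_space"
  shows "open S \<Longrightarrow> open T \<Longrightarrow> \<phi> ` S \<subseteq> T \<Longrightarrow> smooth_on T f \<Longrightarrow> smooth_on S \<phi> \<Longrightarrow> smooth_on S (\<lambda>x. f (\<phi> x))"
  unfolding smooth_on_def using Ck_on_compose by metis

lemma smooth_on_linear: "bounded_linear L \<Longrightarrow> open S \<Longrightarrow> smooth_on S f \<Longrightarrow> smooth_on S (\<lambda>x. L (f x))"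
  by (simp add: smooth_on_def Ck_on_linear_compose)

lemma smooth_on_divide:
  fixes f g :: "'a::real_normed_vector \<Rightarrow> real"
  assumes "open S" "smooth_on S f" "smooth_on S g" "\<And>x. x \<in> S \<Longrightarrow> g x \<noteq> 0"
  shows "smooth_on S (\<lambda>x. f x / g x)"
proof -
  have "smooth_on S (\<lambda>x. inverse (g x))"
    by (rule smooth_on_compose[where T="-{0}"]) (use assms Ck_on_inverse in \<open>auto simp: smooth_on_def\<close>)
  then show ?thesis using smooth_on_mult[OF assms(1,2)] by (simp add: divide_inverse)
qed

lemma smooth_on_ln:
  fixes f :: "'a::real_normed_vector \<Rightarrow> real"
  assumes "open S" "smooth_on S f" "\<And>x. x \<in> S \<Longrightarrow> f x > 0"
  shows "smooth_on S (\<lambda>x. ln (f x))"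
  by (rule smooth_on_compose[where T="{0<..}"]) (use assms Ck_on_ln in \<open>auto simp: smooth_on_def\<close>)

lemma smooth_on_vec_nth:
  fixes f :: "'a::real_normed_vector \<Rightarrow> 'b::real_normed_vector ^ 'n::finite"
  shows "open S \<Longrightarrow> smooth_on S f \<Longrightarrow> smooth_on S (\<lambda>x. f x $ i)"
  by (rule smooth_on_linear[OF bounded_linear_vec_nth])

lemmas smooth_on_intros = smooth_on_const smooth_on_add smooth_on_diff smooth_on_minus smooth_on_mult
  smooth_on_scaleR smooth_on_sum smooth_on_prod smooth_on_partial

section \<open>Partial derivatives\<close>

lemma partial_eqI: "(F has_derivative D) (at y) \<Longrightarrow> partial i F y = D (axis i 1)"
  unfolding partial_def by (simp add: frechet_derivative_eqI)

lemma has_derivative_partial: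
  assumes "F differentiable (at y)"
  shows "(F has_derivative (\<lambda>v. \<Sum>i\<in>UNIV. v $ i * partial i F y)) (at y)"
proof -
  have l: "linear (frechet_derivative F (at y))" by (rule linear_frechet_derivative[OF assms])
  have "frechet_derivative F (at y) v = (\<Sum>i\<in>UNIV. v $ i * partial i F y)" for v
  proof -
    have "v = (\<Sum>i\<in>UNIV. v $ i *\<^sub>R axis i 1)"
      by (simp add: vec_eq_iff axis_def if_distrib cong: if_cong)
    then have "frechet_derivative F (at y) v = frechet_derivative F (at y) (\<Sum>i\<in>UNIV. v $ i *\<^sub>R axis i 1)"
      by simp
    also have "\<dots> = (\<Sum>i\<in>UNIV. v $ i * partial i F y)"
      by (simp add: linear_sum[OF l] linear_scale[OF l] partial_def)
    finally show ?thesis .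
  qed
  then show ?thesis using has_derivative_frechet[OF assms] by (metis (full_types, lifting) ext)
qed

lemma partial_cong_open:
  "open S \<Longrightarrow> y \<in> S \<Longrightarrow> (\<And>z. z \<in> S \<Longrightarrow> F z = G z) \<Longrightarrow> partial i F y = partial i G y"
  unfolding partial_def by (metis frechet_derivative_cong_open)

lemma partial_const: "partial i (\<lambda>z. c) y = 0"
  by (rule partial_eqI) simp

lemma partial_add:
  "F differentiable (at y) \<Longrightarrow> G differentiable (at y) \<Longrightarrow>
   partial i (\<lambda>z. F z + G z) y = partial i F y + partial i G y"
  by (subst partial_eqI[OF has_derivative_add[OF has_derivative_frechet has_derivative_frechet]])
     (auto simp: partial_def)

lemma partial_diff:
  "F differentiable (at y) \<Longrightarrow> G differentiable (at y) \<Longrightarrow>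
   partial i (\<lambda>z. F z - G z) y = partial i F y - partial i G y"
  by (subst partial_eqI[OF has_derivative_diff[OF has_derivative_frechet has_derivative_frechet]])
     (auto simp: partial_def)

lemma partial_mult:
  "F differentiable (at y) \<Longrightarrow> G differentiable (at y) \<Longrightarrow>
   partial i (\<lambda>z. F z * G z) y = partial i F y * G y + F y * partial i G y"
  by (subst partial_eqI[OF has_derivative_mult[OF has_derivative_frechet has_derivative_frechet]])
     (auto simp: partial_def)

lemma partial_sum:
  "(\<And>j. j \<in> J \<Longrightarrow> F j differentiable (at y)) \<Longrightarrow>
   partial i (\<lambda>z. \<Sum>j\<in>J. F j z) y = (\<Sum>j\<in>J. partial i (F j) y)"
  by (subst partial_eqI[OF has_derivative_sum[OF has_derivative_frechet]])
     (auto simp: partial_def)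

lemma partial_symmetric:
  "open S \<Longrightarrow> smooth_on S F \<Longrightarrow> y \<in> S \<Longrightarrow> partial i (partial j F) y = partial j (partial i F) y"
  unfolding partial_def[abs_def] by (rule frechet_derivative_symmetric[of S]) (auto simp: smooth_on_def)

section \<open>Inverse matrices and determinants\<close>

lemma matrix_inv_mult:
  fixes A :: "real^'n^'n"
  assumes "det A \<noteq> 0"
  shows "A ** matrix_inv A = mat 1" "matrix_inv A ** A = mat 1"
proof -
  have "\<exists>B. A ** B = mat 1 \<and> B ** A = mat 1"
    using assms by (simp add: invertible_det_nz[symmetric] invertible_def)
  from someI_ex[OF this] show "A ** matrix_inv A = mat 1" "matrix_inv A ** A = mat 1"
    unfolding matrix_inv_def by auto
qed

lemma matrix_inv_unique_right:
  fixes A :: "real^'n^'n"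
  assumes "A ** B = mat 1"
  shows "matrix_inv A = B"
proof -
  have "det A \<noteq> 0"
    using assms by (metis det_I det_mul mult_eq_0_iff zero_neq_one)
  then show ?thesis using assms matrix_inv_mult by (metis matrix_mul_assoc matrix_mul_lid matrix_mul_rid)
qed

lemma matrix_inv_transpose:
  fixes A :: "real^'n^'n"
  assumes "det A \<noteq> 0"
  shows "matrix_inv (transpose A) = transpose (matrix_inv A)"
  by (rule matrix_inv_unique_right) (metis assms matrix_inv_mult(2) matrix_transpose_mul transpose_mat)

text \<open>Cramer's rule: the entries of the inverse are rational in the entries of the matrix, hence
smooth for a smooth matrix-valued function.\<close>
lemma matrix_inv_entry:
  fixes A :: "real^'n^'n"
  assumes "det A \<noteq> 0"
  shows "matrix_inv A $ k $ l = det (\<chi> i j. if j = k then axis l 1 $ i else A $ i $ j) / det A"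
proof -
  have "A *v (matrix_inv A *v axis l 1) = axis l 1"
    using matrix_inv_mult(1)[OF assms] by (simp add: matrix_vector_mul_assoc)
  then have "matrix_inv A *v axis l 1 =
      (\<chi> k. det (\<chi> i j. if j = k then axis l 1 $ i else A $ i $ j) / det A)"
    using cramer[OF assms, of "matrix_inv A *v axis l 1" "axis l 1"] by simp
  then have "(matrix_inv A *v axis l 1) $ k = det (\<chi> i j. if j = k then axis l 1 $ i else A $ i $ j) / det A"
    by simp
  then show ?thesis by (simp add: matrix_vector_mult_basis column_def)
qed

lemma smooth_on_det:
  assumes "open S" "\<And>i j. smooth_on S (\<lambda>y. A y $ i $ j)"
  shows "smooth_on S (\<lambda>y. det (A y :: real^'n^'n))"
  unfolding det_def by (intro smooth_on_intros assms)

text \<open>The segment from the identity to \<open>A\<close> consists of positive definite, hence invertible, matrices, so the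
determinant does not change its sign along it.\<close>
lemma det_pos_of_pos_def:
  fixes A :: "real^'n^'n"
  assumes "\<And>v. v \<noteq> 0 \<Longrightarrow> v \<bullet> (A *v v) > 0"
  shows "det A > 0"
proof -
  define B where "B t = (\<chi> i j. t * A $ i $ j + (1 - t) * (mat 1 :: real^'n^'n) $ i $ j)" for t :: real
  have Bv: "B t *v v = t *\<^sub>R (A *v v) + (1 - t) *\<^sub>R v" for t v
  proof -
    have "B t = t *\<^sub>R A + (1 - t) *\<^sub>R mat 1" by (simp add: B_def vec_eq_iff)
    then show ?thesis
      by (simp add: matrix_vector_mult_add_rdistrib scaleR_matrix_vector_assoc[symmetric])
  qed
  have nz: "det (B t) \<noteq> 0" if "0 \<le> t" "t \<le> 1" for t
  proof
    assume "det (B t) = 0"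
    then have "\<not> invertible (B t)" by (simp add: invertible_det_nz)
    then obtain v where v: "B t *v v = 0" "v \<noteq> 0"
      using matrix_left_invertible_ker invertible_left_inverse by blast
    have "v \<bullet> (B t *v v) = t * (v \<bullet> (A *v v)) + (1 - t) * (v \<bullet> v)"
      by (simp add: Bv inner_add_right)
    moreover have "t * (v \<bullet> (A *v v)) + (1 - t) * (v \<bullet> v) > 0"
    proof (cases "t = 0")
      case False
      then have "t * (v \<bullet> (A *v v)) > 0" using assms[OF v(2)] that by simp
      moreover have "(1 - t) * (v \<bullet> v) \<ge> 0" using that by simp
      ultimately show ?thesis by linarith
    qed (use v in simp)
    ultimately show False using v by simp
  qed
  have cont: "continuous_on {0..1} (\<lambda>t. det (B t))"
    unfolding det_def B_def by (intro continuous_intros)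
  have B0: "B 0 = mat 1" and B1: "B 1 = A" by (simp_all add: B_def vec_eq_iff)
  show ?thesis
  proof (rule ccontr)
    assume "\<not> det A > 0"
    then obtain t where "0 \<le> t" "t \<le> 1" "det (B t) = 0"
      using IVT2'[of "\<lambda>t. det (B t)" 1 0 0] cont B0 B1 by auto
    then show False using nz by blast
  qed
qed

lemma matrix_mult_add_distrib_right:
  fixes A B :: "real^'n^'m" and C :: "real^'k^'n"
  shows "(A + B) ** C = A ** C + B ** C"
  by (simp add: matrix_matrix_mult_def vec_eq_iff sum.distrib distrib_right)

section \<open>The Levi-Civita connection in a chart\<close>

definition partial_vec :: "'n::finite \<Rightarrow> (real^'n \<Rightarrow> real^'m) \<Rightarrow> real^'n \<Rightarrow> real^'m" where
  "partial_vec i X y = (\<chi> k. partial i (\<lambda>z. X z $ k) y)"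

definition partial_mat :: "'n::finite \<Rightarrow> (real^'n \<Rightarrow> real^'m^'l) \<Rightarrow> real^'n \<Rightarrow> real^'m^'l" where
  "partial_mat i A y = (\<chi> k l. partial i (\<lambda>z. A z $ k $ l) y)"

lemma partial_mat_matrix_mult:
  assumes "\<And>k l. (\<lambda>z. A z $ k $ l) differentiable (at y)" "\<And>k l. (\<lambda>z. B z $ k $ l) differentiable (at y)"
  shows "partial_mat i (\<lambda>z. A z ** B z) y = partial_mat i A y ** B y + A y ** partial_mat i B y"
  unfolding partial_mat_def vec_eq_iff
  by (simp add: matrix_matrix_mult_def partial_sum partial_mult assms sum.distrib)

lemma partial_vec_matrix_vector_mult:
  assumes "\<And>k l. (\<lambda>z. A z $ k $ l) differentiable (at y)" "\<And>k. (\<lambda>z. X z $ k) differentiable (at y)"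
  shows "partial_vec i (\<lambda>z. A z *v X z) y = partial_mat i A y *v X y + A y *v partial_vec i X y"
  unfolding partial_mat_def partial_vec_def vec_eq_iff
  by (simp add: matrix_vector_mult_def partial_sum partial_mult assms sum.distrib)

lemma partial_inner:
  assumes "\<And>k. (\<lambda>z. X z $ k) differentiable (at y)" "\<And>k. (\<lambda>z. Y z $ k) differentiable (at y)"
  shows "partial i (\<lambda>z. X z \<bullet> Y z) y = partial_vec i X y \<bullet> Y y + X y \<bullet> partial_vec i Y y"
  unfolding partial_vec_def
  by (simp add: inner_vec_def partial_sum partial_mult assms sum.distrib)

definition differential :: "(real^'n \<Rightarrow> real) \<Rightarrow> real^'n \<Rightarrow> real^'n::finite" where
  "differential F y = (\<chi> i. partial i F y)"

text \<open>The inner product of the gradients of \<open>a\<close> and \<open>b\<close>.\<close>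
definition loc_grad_ip :: "(real^'n \<Rightarrow> real^'n^'n) \<Rightarrow> (real^'n \<Rightarrow> real) \<Rightarrow> (real^'n \<Rightarrow> real) \<Rightarrow> real^'n::finite \<Rightarrow> real" where
  "loc_grad_ip G a b y = loc_gradient G a y \<bullet> differential b y"

text \<open>With the Christoffel symbols as matrices, metric compatibility and the covariant derivative become
matrix identities, which keeps the index sums out of the proofs.\<close>
definition chris_mat :: "(real^'n \<Rightarrow> real^'n^'n) \<Rightarrow> 'n \<Rightarrow> real^'n::finite \<Rightarrow> real^'n^'n" where
  "chris_mat G i y = (\<chi> k l. loc_christoffel G k i l y)"

text \<open>The covariant derivative of the vector field \<open>X\<close> in the \<open>i\<close>-th coordinate direction.\<close>
definition nabla :: "(real^'n \<Rightarrow> real^'n^'n) \<Rightarrow> (real^'n \<Rightarrow> real^'n) \<Rightarrow> 'n \<Rightarrow> real^'n::finite \<Rightarrow> real^'n" where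
  "nabla G X i y = partial_vec i X y + chris_mat G i y *v X y"

lemma loc_gradient_matrix: "loc_gradient G F y = matrix_inv (G y) *v differential F y"
  by (simp add: loc_gradient_def vec_eq_iff matrix_vector_mult_def differential_def)

lemma loc_divergence_nabla: "loc_divergence G X y = (\<Sum>i\<in>UNIV. nabla G X i y $ i)"
  by (simp add: loc_divergence_def nabla_def chris_mat_def matrix_vector_mult_def partial_vec_def)

lemma loc_hessian_row:
  "loc_hessian G F y $ i = partial_vec i (differential F) y - transpose (chris_mat G i y) *v differential F y"
  by (simp add: loc_hessian_def vec_eq_iff matrix_vector_mult_def differential_def partial_vec_def chris_mat_def transpose_def)

locale local_metric =
  fixes S :: "(real^'n::finite) set" and G :: "real^'n \<Rightarrow> real^'n^'n"
  assumes open_S: "open S" and smooth_G: "smooth_on S G"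
    and symG: "y \<in> S \<Longrightarrow> transpose (G y) = G y"
    and posG: "y \<in> S \<Longrightarrow> v \<noteq> 0 \<Longrightarrow> v \<bullet> (G y *v v) > 0"
begin

lemma det_pos: "y \<in> S \<Longrightarrow> det (G y) > 0"
  by (intro det_pos_of_pos_def posG)

lemma inv_mult: "y \<in> S \<Longrightarrow> G y ** matrix_inv (G y) = mat 1" "y \<in> S \<Longrightarrow> matrix_inv (G y) ** G y = mat 1"
  using det_pos[of y] matrix_inv_mult[of "G y"] by auto

lemma sym_inv: "y \<in> S \<Longrightarrow> transpose (matrix_inv (G y)) = matrix_inv (G y)"
  using matrix_inv_transpose[of "G y"] symG[of y] det_pos[of y] by simp

lemma smooth_entry: "smooth_on S (\<lambda>y. G y $ i $ j)"
  by (intro smooth_on_vec_nth open_S smooth_G)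

lemma smooth_inv: "smooth_on S (\<lambda>y. matrix_inv (G y) $ k $ l)"
proof (rule smooth_on_cong[OF open_S])
  show "det (\<chi> i j. if j = k then axis l 1 $ i else G y $ i $ j) / det (G y) = matrix_inv (G y) $ k $ l"
    if "y \<in> S" for y
    using matrix_inv_entry[of "G y" k l] det_pos[OF that] by simp
  have "smooth_on S (\<lambda>y. (\<chi> i j. if j = k then axis l 1 $ i else G y $ i $ j) $ i $ j)" for i j
    by (cases "j = k") (simp_all add: smooth_on_const smooth_entry)
  then show "smooth_on S (\<lambda>y. det (\<chi> i j. if j = k then axis l 1 $ i else G y $ i $ j) / det (G y))"
    by (intro smooth_on_divide smooth_on_det open_S smooth_entry) (use det_pos in force)+
qed

lemma smooth_christoffel: "smooth_on S (loc_christoffel G k i j)"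
  unfolding loc_christoffel_def[abs_def]
  by (intro smooth_on_intros smooth_inv smooth_entry open_S)

lemmas diff_entry = smooth_on_differentiable[OF smooth_entry]
  and diff_inv = smooth_on_differentiable[OF smooth_inv]
  and diff_chris = smooth_on_differentiable[OF smooth_christoffel]

lemma sym_entry: "y \<in> S \<Longrightarrow> G y $ i $ j = G y $ j $ i"
  using arg_cong[OF symG[of y], of "\<lambda>A. A $ j $ i"] by (simp add: transpose_def)

lemma partial_sym_entry: "y \<in> S \<Longrightarrow> partial m (\<lambda>z. G z $ i $ j) y = partial m (\<lambda>z. G z $ j $ i) y"
  by (rule partial_cong_open[OF open_S]) (auto simp: sym_entry)

lemma sym_christoffel: "y \<in> S \<Longrightarrow> loc_christoffel G k i j y = loc_christoffel G k j i y"
  unfolding loc_christoffel_def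
  by (intro arg_cong[where f="\<lambda>x. (1/2) * x"] sum.cong refl)
     (simp add: partial_sym_entry[of _ _ i j])

text \<open>The Christoffel symbols of the first kind; lowering an index cancels the inverse metric.\<close>
lemma lower_christoffel:
  assumes "y \<in> S"
  shows "(G y ** chris_mat G i y) $ j $ l =
    (1/2) * (partial i (\<lambda>z. G z $ l $ j) y + partial l (\<lambda>z. G z $ i $ j) y - partial j (\<lambda>z. G z $ i $ l) y)"
proof -
  define q where "q m = partial i (\<lambda>z. G z $ l $ m) y + partial l (\<lambda>z. G z $ i $ m) y - partial m (\<lambda>z. G z $ i $ l) y" for m
  have "(G y ** chris_mat G i y) $ j $ l = (\<Sum>k\<in>UNIV. G y $ j $ k * ((1/2) * (\<Sum>m\<in>UNIV. matrix_inv (G y) $ k $ m * q m)))"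
    by (simp add: matrix_matrix_mult_def chris_mat_def loc_christoffel_def q_def)
  also have "\<dots> = (1/2) * (G y *v (matrix_inv (G y) *v (\<chi> m. q m))) $ j"
    by (simp add: matrix_vector_mult_def sum_distrib_left mult_ac)
  also have "\<dots> = (1/2) * q j"
    by (simp add: matrix_vector_mul_assoc inv_mult[OF assms])
  finally show ?thesis by (simp add: q_def)
qed

text \<open>Metric compatibility: the two lowered Christoffel symbols add up to the derivative of the metric, all
other terms cancelling by symmetry.\<close>
lemma partial_mat_metric:
  assumes "y \<in> S"
  shows "partial_mat i G y = transpose (chris_mat G i y) ** G y + G y ** chris_mat G i y"
proof -
  have "transpose (chris_mat G i y) ** G y = transpose (G y ** chris_mat G i y)"
    using symG[OF assms] by (simp add: matrix_transpose_mul)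
  then have *: "(transpose (chris_mat G i y) ** G y) $ j $ l = (G y ** chris_mat G i y) $ l $ j" for j l
    by (simp add: transpose_def)
  have "partial_mat i G y $ j $ l = (G y ** chris_mat G i y) $ l $ j + (G y ** chris_mat G i y) $ j $ l" for j l
    using partial_sym_entry[OF assms, of i l j] partial_sym_entry[OF assms, of l i j]
      partial_sym_entry[OF assms, of j i l]
    by (simp add: lower_christoffel[OF assms] partial_mat_def field_simps)
  then show ?thesis by (simp add: vec_eq_iff *)
qed

text \<open>Differentiation of \<open>G\<^sup>-\<^sup>1 G = 1\<close> reduces the derivative of the inverse metric to that of the metric.\<close>
lemma partial_mat_inv:
  assumes "y \<in> S"
  shows "partial_mat i (\<lambda>z. matrix_inv (G z)) y =
    - (matrix_inv (G y) ** transpose (chris_mat G i y)) - chris_mat G i y ** matrix_inv (G y)"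
proof -
  let ?P = "partial_mat i (\<lambda>z. matrix_inv (G z)) y" and ?g = "matrix_inv (G y)" and ?C = "chris_mat G i y"
  have "0 = partial_mat i (\<lambda>z. mat 1 :: real^'n^'n) y" by (simp add: partial_mat_def vec_eq_iff partial_const)
  also have "\<dots> = partial_mat i (\<lambda>z. matrix_inv (G z) ** G z) y"
    unfolding partial_mat_def vec_eq_iff
    by (auto intro!: partial_cong_open[OF open_S assms] simp: inv_mult)
  also have "\<dots> = ?P ** G y + ?g ** partial_mat i G y"
    by (intro partial_mat_matrix_mult diff_inv diff_entry assms)
  finally have "?P ** G y = - (?g ** partial_mat i G y)" by (simp add: eq_neg_iff_add_eq_0)
  then have "(?P ** G y) ** ?g = - (?g ** partial_mat i G y) ** ?g" by simp
  moreover have "(?P ** G y) ** ?g = ?P"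
    using inv_mult[OF assms] by (simp add: matrix_mul_assoc[symmetric])
  moreover have "(?g ** partial_mat i G y) ** ?g = ?g ** transpose ?C + ?C ** ?g"
    unfolding partial_mat_metric[OF assms]
    by (simp add: matrix_add_ldistrib matrix_mult_add_distrib_right)
       (simp add: matrix_mul_assoc inv_mult[OF assms], simp add: matrix_mul_assoc[symmetric] inv_mult[OF assms])
  moreover have "(- A) ** B = - (A ** B)" for A B :: "real^'n^'n"
    by (simp add: matrix_matrix_mult_def vec_eq_iff sum_negf)
  ultimately show ?thesis by simp
qed

context
  fixes F :: "real^'n \<Rightarrow> real" assumes F: "smooth_on S F"
begin

lemma smooth_differential: "smooth_on S (\<lambda>y. differential F y $ k)"
  by (simp add: differential_def smooth_on_partial[OF F])

lemma smooth_gradient: "smooth_on S (\<lambda>y. loc_gradient G F y $ k)"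
  unfolding loc_gradient_def by (simp, intro smooth_on_intros smooth_inv F open_S)

lemma smooth_laplacian: "smooth_on S (loc_laplacian G F)"
  unfolding loc_laplacian_def loc_divergence_def[abs_def]
  by (intro smooth_on_intros smooth_christoffel open_S smooth_gradient)

lemma sym_hessian: "y \<in> S \<Longrightarrow> loc_hessian G F y $ i $ j = loc_hessian G F y $ j $ i"
  unfolding loc_hessian_def by (simp add: partial_symmetric[OF open_S F] sym_christoffel[of y _ i j])

text \<open>The covariant derivative of the gradient is the Hessian with one index raised: the connection terms
that come from the inverse metric are those in the definition of the Hessian.\<close>
lemma nabla_gradient:
  assumes "y \<in> S"
  shows "nabla G (loc_gradient G F) i y = matrix_inv (G y) *v (loc_hessian G F y $ i)"
proof -
  let ?g = "matrix_inv (G y)" and ?C = "chris_mat G i y"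
  have "partial_vec i (loc_gradient G F) y = partial_mat i (\<lambda>z. matrix_inv (G z)) y *v differential F y + ?g *v partial_vec i (differential F) y"
    unfolding loc_gradient_matrix[abs_def]
    by (intro partial_vec_matrix_vector_mult diff_inv assms smooth_on_differentiable[OF smooth_differential])
  also have "\<dots> = - (?g *v (transpose ?C *v differential F y)) - ?C *v (?g *v differential F y) + ?g *v partial_vec i (differential F) y"
  proof -
    have "(- A) *v x = - (A *v x)" for A :: "real^'n^'n" and x
      by (simp add: matrix_vector_mult_def vec_eq_iff sum_negf)
    then show ?thesis unfolding partial_mat_inv[OF assms]
      by (simp add: matrix_vector_mult_diff_rdistrib matrix_vector_mul_assoc del: transpose_matrix_vector)
  qed
  finally show ?thesis
    unfolding nabla_def loc_hessian_row by (simp add: loc_gradient_matrix matrix_vector_mult_diff_distrib)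
qed

lemma laplacian_trace:
  assumes "y \<in> S"
  shows "loc_laplacian G F y = (\<Sum>i\<in>UNIV. \<Sum>j\<in>UNIV. matrix_inv (G y) $ i $ j * loc_hessian G F y $ i $ j)"
  unfolding loc_laplacian_def loc_divergence_nabla nabla_gradient[OF assms]
  by (simp add: matrix_vector_mult_def)

end

lemma inner_inv_sym: "y \<in> S \<Longrightarrow> (matrix_inv (G y) *v v) \<bullet> w = v \<bullet> (matrix_inv (G y) *v w)"
  using sym_inv[of y] by (metis dot_lmul_matrix inner_commute transpose_matrix_vector)

lemma loc_grad_ip_sym: "y \<in> S \<Longrightarrow> loc_grad_ip G a b y = loc_grad_ip G b a y"
  unfolding loc_grad_ip_def loc_gradient_matrix by (metis inner_inv_sym inner_commute)

lemma smooth_ip: "smooth_on S a \<Longrightarrow> smooth_on S b \<Longrightarrow> smooth_on S (loc_grad_ip G a b)"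
  unfolding loc_grad_ip_def[abs_def] inner_vec_def
  by (simp, intro smooth_on_intros smooth_gradient smooth_differential open_S)

text \<open>The product rule for a metric connection.  Both the gradient of \<open>|\<nabla>F|\<^sup>2\<close> and the polarization formula
for the Hessian are read off from it.\<close>
lemma partial_ip:
  assumes y: "y \<in> S" and a: "smooth_on S a" and b: "smooth_on S b"
  shows "partial i (loc_grad_ip G a b) y = loc_hessian G a y $ i \<bullet> loc_gradient G b y + loc_hessian G b y $ i \<bullet> loc_gradient G a y"
proof -
  let ?g = "matrix_inv (G y)" and ?C = "chris_mat G i y"
  have "partial i (loc_grad_ip G a b) y = partial_vec i (loc_gradient G a) y \<bullet> differential b y + loc_gradient G a y \<bullet> partial_vec i (differential b) y"
    unfolding loc_grad_ip_def[abs_def]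
    by (intro partial_inner smooth_on_differentiable[OF smooth_gradient] smooth_on_differentiable[OF smooth_differential] a b y)
  moreover have "partial_vec i (loc_gradient G a) y = ?g *v (loc_hessian G a y $ i) - ?C *v loc_gradient G a y"
    using nabla_gradient[OF a y, of i] by (simp add: nabla_def algebra_simps)
  moreover have "partial_vec i (differential b) y = loc_hessian G b y $ i + transpose ?C *v differential b y"
    by (simp add: loc_hessian_row)
  moreover have "(?C *v v) \<bullet> w = v \<bullet> (transpose ?C *v w)" for v w
    unfolding transpose_matrix_vector by (metis dot_lmul_matrix inner_commute)
  moreover have "(?g *v (loc_hessian G a y $ i)) \<bullet> differential b y = loc_hessian G a y $ i \<bullet> loc_gradient G b y"
    by (simp add: inner_inv_sym[OF y] loc_gradient_matrix)
  ultimately show ?thesis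
    by (simp add: inner_diff_left inner_diff_right inner_add_right inner_commute)
qed

lemma differential_ip:
  assumes y: "y \<in> S" and a: "smooth_on S a" and b: "smooth_on S b"
  shows "differential (loc_grad_ip G a b) y = loc_hessian G a y *v loc_gradient G b y + loc_hessian G b y *v loc_gradient G a y"
  unfolding vec_eq_iff by (simp add: differential_def partial_ip[OF assms] matrix_vector_mul_component)

lemma inner_hessian_sym:
  assumes y: "y \<in> S" and F: "smooth_on S F"
  shows "(loc_hessian G F y *v v) \<bullet> w = v \<bullet> (loc_hessian G F y *v w)"
proof -
  have "transpose (loc_hessian G F y) = loc_hessian G F y"
    using sym_hessian[OF F y] by (simp add: transpose_def vec_eq_iff)
  then show ?thesis by (metis dot_lmul_matrix inner_commute transpose_matrix_vector)
qed

lemma swap_hessian: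
  "y \<in> S \<Longrightarrow> smooth_on S F \<Longrightarrow> v \<bullet> (loc_hessian G F y *v w) = w \<bullet> (loc_hessian G F y *v v)"
  by (metis inner_hessian_sym inner_commute)

text \<open>The right-hand side involves inner products of gradients only, and these are invariant under a change
of coordinates by the chain rule.  So this formula transports the Hessian between charts.\<close>
lemma hessian_polarization:
  assumes y: "y \<in> S" and F: "smooth_on S F" and a: "smooth_on S a" and b: "smooth_on S b"
  shows "2 * (loc_gradient G a y \<bullet> (loc_hessian G F y *v loc_gradient G b y)) =
    loc_grad_ip G a (loc_grad_ip G F b) y + loc_grad_ip G b (loc_grad_ip G F a) y - loc_grad_ip G F (loc_grad_ip G a b) y"
  unfolding loc_grad_ip_def[of G _ "loc_grad_ip G _ _"] differential_ip[OF y F b] differential_ip[OF y F a] differential_ip[OF y a b]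
  using swap_hessian[OF y F, of "loc_gradient G b y" "loc_gradient G a y"]
    swap_hessian[OF y a, of "loc_gradient G b y" "loc_gradient G F y"]
    swap_hessian[OF y b, of "loc_gradient G a y" "loc_gradient G F y"]
  by (simp add: inner_add_right)

text \<open>The gradient of \<open>|\<nabla>F|\<^sup>2 / 2\<close> is the covariant derivative of \<open>\<nabla>F\<close> along itself; this uses
the symmetry of the Hessian.\<close>
lemma gradient_ip_self:
  assumes y: "y \<in> S" and F: "smooth_on S F"
  shows "loc_gradient G (loc_grad_ip G F F) y = 2 *\<^sub>R (\<Sum>j\<in>UNIV. loc_gradient G F y $ j *\<^sub>R nabla G (loc_gradient G F) j y)"
proof -
  let ?g = "matrix_inv (G y)" and ?X = "loc_gradient G F y" and ?H = "loc_hessian G F y"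
  have "?H *v ?X = (\<Sum>j\<in>UNIV. ?X $ j *\<^sub>R (?H $ j))"
    by (simp add: vec_eq_iff matrix_vector_mult_def sym_hessian[OF F y] mult.commute)
  then have "?g *v (?H *v ?X) = (\<Sum>j\<in>UNIV. ?X $ j *\<^sub>R (?g *v (?H $ j)))"
    by (simp add: linear_sum[OF matrix_vector_mul_linear] linear_scale[OF matrix_vector_mul_linear])
  then show ?thesis
    unfolding loc_gradient_matrix[of G "loc_grad_ip G F F"] differential_ip[OF y F F] nabla_gradient[OF F y]
    by (simp only: matrix_vector_right_distrib scaleR_2)
qed

end

section \<open>The Bochner formula in a chart\<close>

lemma sum_rotate: "(\<Sum>i\<in>A. \<Sum>j\<in>B. \<Sum>k\<in>C. F i j k) = (\<Sum>j\<in>B. \<Sum>k\<in>C. \<Sum>i\<in>A. F i j k)"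
  by (rule trans[OF sum.swap]) (intro sum.cong refl sum.swap)

lemma sum_swap_pairs:
  "(\<Sum>i\<in>A. \<Sum>j\<in>B. \<Sum>k\<in>C. \<Sum>l\<in>D. F i j k l) = (\<Sum>k\<in>C. \<Sum>l\<in>D. \<Sum>i\<in>A. \<Sum>j\<in>B. F i j k l)"
  by (rule trans[OF sum.cong[OF refl sum_rotate] sum_rotate])

text \<open>The identity \<open>div (\<nabla>\<^sub>X X) = tr ((\<nabla>X)\<^sup>2) + X (div X) + Ric(X, X)\<close> at a point, in terms of the values
\<open>x\<close> of the field, its first and second derivatives \<open>p\<close> and \<open>q\<close>, the connection coefficients \<open>c\<close> and
their derivatives \<open>d\<close>.  Expansion of both sides produces eight sums, which match up to renaming of
the indices and the symmetries; \<open>S7\<close> and \<open>S8\<close> occur on the right-hand side only and cancel there.\<close>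
lemma divergence_nabla_algebra:
  fixes x :: "'n::finite \<Rightarrow> real" and p :: "'n \<Rightarrow> 'n \<Rightarrow> real" and q c :: "'n \<Rightarrow> 'n \<Rightarrow> 'n \<Rightarrow> real"
    and d :: "'n \<Rightarrow> 'n \<Rightarrow> 'n \<Rightarrow> 'n \<Rightarrow> real"
  assumes q: "\<And>i j k. q i j k = q j i k" and c: "\<And>k i j. c k i j = c k j i" and d: "\<And>m k i j. d m k i j = d m k j i"
  defines "B \<equiv> \<lambda>i k. p i k + (\<Sum>l\<in>UNIV. c k i l * x l)"
  shows "(\<Sum>i\<in>UNIV. (\<Sum>j\<in>UNIV. p i j * B j i + x j * (q i j i + (\<Sum>l\<in>UNIV. d i i j l * x l + c i j l * p i l)))
            + (\<Sum>k\<in>UNIV. c i i k * (\<Sum>j\<in>UNIV. x j * B j k)))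
     = (\<Sum>i\<in>UNIV. \<Sum>j\<in>UNIV. B i j * B j i)
       + (\<Sum>j\<in>UNIV. x j * (\<Sum>i\<in>UNIV. q j i i + (\<Sum>k\<in>UNIV. d j i i k * x k + c i i k * p j k)))
       + (\<Sum>i\<in>UNIV. x i * (\<Sum>j\<in>UNIV. (\<Sum>k\<in>UNIV. d k k i j - d j k i k
            + (\<Sum>l\<in>UNIV. c k k l * c l i j - c k j l * c l i k)) * x j))"
proof -
  define T1 where "T1 = (\<Sum>i\<in>UNIV. \<Sum>j\<in>UNIV. p i j * B j i)"
  define T2 where "T2 = (\<Sum>i\<in>UNIV. \<Sum>j\<in>UNIV. x j * q i j i)"
  define T3 where "T3 = (\<Sum>i\<in>UNIV. \<Sum>j\<in>UNIV. \<Sum>l\<in>UNIV. x j * (d i i j l * x l))"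
  define T4 where "T4 = (\<Sum>i\<in>UNIV. \<Sum>j\<in>UNIV. \<Sum>l\<in>UNIV. x j * (c i j l * p i l))"
  define T5 where "T5 = (\<Sum>i\<in>UNIV. \<Sum>k\<in>UNIV. \<Sum>j\<in>UNIV. c i i k * (x j * p j k))"
  define T6 where "T6 = (\<Sum>i\<in>UNIV. \<Sum>k\<in>UNIV. \<Sum>j\<in>UNIV. \<Sum>l\<in>UNIV. c i i k * (x j * (c k j l * x l)))"
  define S7 where "S7 = (\<Sum>i\<in>UNIV. \<Sum>j\<in>UNIV. \<Sum>l\<in>UNIV. \<Sum>m\<in>UNIV. c j i l * x l * (c i j m * x m))"
  define S8 where "S8 = (\<Sum>j\<in>UNIV. \<Sum>i\<in>UNIV. \<Sum>k\<in>UNIV. x j * (d j i i k * x k))"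
  have L: "(\<Sum>i\<in>UNIV. (\<Sum>j\<in>UNIV. p i j * B j i + x j * (q i j i + (\<Sum>l\<in>UNIV. d i i j l * x l + c i j l * p i l)))
            + (\<Sum>k\<in>UNIV. c i i k * (\<Sum>j\<in>UNIV. x j * B j k))) = T1 + T2 + T3 + T4 + T5 + T6"
  proof -
    have a: "(\<Sum>i\<in>UNIV. \<Sum>j\<in>UNIV. p i j * B j i + x j * (q i j i + (\<Sum>l\<in>UNIV. d i i j l * x l + c i j l * p i l)))
      = T1 + T2 + T3 + T4"
      unfolding T1_def T2_def T3_def T4_def
      by (simp add: sum.distrib distrib_left sum_distrib_left)
    have b: "(\<Sum>i\<in>UNIV. \<Sum>k\<in>UNIV. c i i k * (\<Sum>j\<in>UNIV. x j * B j k)) = T5 + T6"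
      unfolding T5_def T6_def B_def
      by (simp add: sum.distrib distrib_left sum_distrib_left)
    show ?thesis unfolding sum.distrib[of _ "\<lambda>i. \<Sum>k\<in>UNIV. c i i k * (\<Sum>j\<in>UNIV. x j * B j k)"] a b by simp
  qed
  have R1: "(\<Sum>i\<in>UNIV. \<Sum>j\<in>UNIV. B i j * B j i) = T1 + T4 + S7"
  proof -
    have "(\<Sum>i\<in>UNIV. \<Sum>j\<in>UNIV. B i j * B j i) = T1 + (\<Sum>i\<in>UNIV. \<Sum>j\<in>UNIV. (\<Sum>l\<in>UNIV. c j i l * x l) * B j i)"
      unfolding T1_def sum.distrib[symmetric] by (subst B_def) (simp add: distrib_right)
    also have "(\<Sum>i\<in>UNIV. \<Sum>j\<in>UNIV. (\<Sum>l\<in>UNIV. c j i l * x l) * B j i) =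
       (\<Sum>i\<in>UNIV. \<Sum>j\<in>UNIV. \<Sum>l\<in>UNIV. c j i l * x l * p j i) + S7"
      unfolding S7_def B_def
      by (simp add: distrib_left sum.distrib sum_distrib_left sum_distrib_right mult.assoc)
         (rule sum.cong[OF refl], rule sum.cong[OF refl], rule sum.swap)
    also have "(\<Sum>i\<in>UNIV. \<Sum>j\<in>UNIV. \<Sum>l\<in>UNIV. c j i l * x l * p j i) = T4"
      unfolding T4_def by (subst sum_rotate) (use c in \<open>simp add: mult_ac\<close>)
    finally show ?thesis by simp
  qed
  have R2: "(\<Sum>j\<in>UNIV. x j * (\<Sum>i\<in>UNIV. q j i i + (\<Sum>k\<in>UNIV. d j i i k * x k + c i i k * p j k))) = T2 + S8 + T5"
  proof -
    have "(\<Sum>j\<in>UNIV. x j * (\<Sum>i\<in>UNIV. q j i i + (\<Sum>k\<in>UNIV. d j i i k * x k + c i i k * p j k)))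
       = (\<Sum>j\<in>UNIV. \<Sum>i\<in>UNIV. x j * q j i i) + S8 + (\<Sum>j\<in>UNIV. \<Sum>i\<in>UNIV. \<Sum>k\<in>UNIV. x j * (c i i k * p j k))"
      unfolding S8_def by (simp add: sum.distrib distrib_left sum_distrib_left)
    also have "(\<Sum>j\<in>UNIV. \<Sum>i\<in>UNIV. x j * q j i i) = T2"
      unfolding T2_def by (subst sum.swap) (simp add: q)
    also have "(\<Sum>j\<in>UNIV. \<Sum>i\<in>UNIV. \<Sum>k\<in>UNIV. x j * (c i i k * p j k)) = T5"
      unfolding T5_def by (subst sum_rotate) (simp add: mult_ac)
    finally show ?thesis by simp
  qed
  have R3: "(\<Sum>i\<in>UNIV. x i * (\<Sum>j\<in>UNIV. (\<Sum>k\<in>UNIV. d k k i j - d j k i k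
            + (\<Sum>l\<in>UNIV. c k k l * c l i j - c k j l * c l i k)) * x j)) = T3 - S8 + T6 - S7"
  proof -
    have "(\<Sum>i\<in>UNIV. x i * (\<Sum>j\<in>UNIV. (\<Sum>k\<in>UNIV. d k k i j - d j k i k
            + (\<Sum>l\<in>UNIV. c k k l * c l i j - c k j l * c l i k)) * x j))
      = (\<Sum>i\<in>UNIV. \<Sum>j\<in>UNIV. \<Sum>k\<in>UNIV. x i * d k k i j * x j) - (\<Sum>i\<in>UNIV. \<Sum>j\<in>UNIV. \<Sum>k\<in>UNIV. x i * d j k i k * x j)
       + (\<Sum>i\<in>UNIV. \<Sum>j\<in>UNIV. \<Sum>k\<in>UNIV. \<Sum>l\<in>UNIV. x i * c k k l * c l i j * x j)
       - (\<Sum>i\<in>UNIV. \<Sum>j\<in>UNIV. \<Sum>k\<in>UNIV. \<Sum>l\<in>UNIV. x i * c k j l * c l i k * x j)"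
      by (simp add: sum.distrib sum_subtractf distrib_left distrib_right right_diff_distrib left_diff_distrib sum_distrib_left sum_distrib_right mult.assoc)
    also have "(\<Sum>i\<in>UNIV. \<Sum>j\<in>UNIV. \<Sum>k\<in>UNIV. x i * d k k i j * x j) = T3"
      unfolding T3_def by (subst (2) sum_rotate) (simp add: mult_ac)
    also have "(\<Sum>i\<in>UNIV. \<Sum>j\<in>UNIV. \<Sum>k\<in>UNIV. x i * d j k i k * x j) = S8"
      unfolding S8_def by (subst sum_rotate, subst d) (simp add: mult_ac)
    also have "(\<Sum>i\<in>UNIV. \<Sum>j\<in>UNIV. \<Sum>k\<in>UNIV. \<Sum>l\<in>UNIV. x i * c k k l * c l i j * x j) = T6"
      unfolding T6_def by (subst sum_swap_pairs) (simp add: mult_ac)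
    also have "(\<Sum>i\<in>UNIV. \<Sum>j\<in>UNIV. \<Sum>k\<in>UNIV. \<Sum>l\<in>UNIV. x i * c k j l * c l i k * x j) = S7"
      unfolding S7_def by (subst (2) sum_swap_pairs, intro sum.cong refl) (metis c mult.assoc mult.commute)
    finally show ?thesis .
  qed
  show ?thesis unfolding L R1 R2 R3 by simp
qed

context local_metric
begin

lemma divergence_nabla_self:
  assumes y: "y \<in> S" and X: "\<And>k. smooth_on S (\<lambda>z. X z $ k)"
  shows "loc_divergence G (\<lambda>z. \<Sum>j\<in>UNIV. X z $ j *\<^sub>R nabla G X j z) y =
     (\<Sum>i\<in>UNIV. \<Sum>j\<in>UNIV. nabla G X i y $ j * nabla G X j y $ i)
     + (\<Sum>j\<in>UNIV. X y $ j * partial j (loc_divergence G X) y)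
     + X y \<bullet> (loc_ricci G y *v X y)"
proof -
  define x where "x i = X y $ i" for i
  define p where "p i k = partial i (\<lambda>z. X z $ k) y" for i k
  define q where "q i j k = partial i (partial j (\<lambda>z. X z $ k)) y" for i j k
  define c where "c k i j = loc_christoffel G k i j y" for k i j
  define d where "d m k i j = partial m (loc_christoffel G k i j) y" for m k i j
  define B where "B i k = p i k + (\<Sum>l\<in>UNIV. c k i l * x l)" for i k
  have B: "nabla G X i y $ k = B i k" for i k
    by (simp add: nabla_def partial_vec_def chris_mat_def matrix_vector_mult_def B_def p_def c_def x_def)
  have nab: "(\<lambda>z. nabla G X j z $ k) = (\<lambda>z. partial j (\<lambda>z. X z $ k) z + (\<Sum>l\<in>UNIV. loc_christoffel G k j l z * X z $ l))" for j k
    by (simp add: nabla_def partial_vec_def chris_mat_def matrix_vector_mult_def)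
  have dX: "(\<lambda>z. X z $ k) differentiable (at y)" for k using X y smooth_on_differentiable by blast
  have dpX: "(partial j (\<lambda>z. X z $ k)) differentiable (at y)" for j k
    using smooth_on_differentiable[OF smooth_on_partial[OF X] y] .
  have sn: "smooth_on S (\<lambda>z. nabla G X j z $ k)" for j k
    unfolding nab by (intro smooth_on_intros X smooth_christoffel open_S)
  have dcX: "(\<lambda>z. loc_christoffel G k j l z * X z $ l) differentiable (at y)" for k j l
    by (intro differentiable_mult diff_chris[OF y] dX)
  have dsX: "(\<lambda>z. \<Sum>l\<in>UNIV. loc_christoffel G k j l z * X z $ l) differentiable (at y)" for k j
    by (intro differentiable_sum dcX ballI finite)
  have pn: "partial i (\<lambda>z. nabla G X j z $ k) y = q i j k + (\<Sum>l\<in>UNIV. d i k j l * x l + c k j l * p i l)" for i j k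
    unfolding nab
    unfolding partial_add[OF dpX dsX] partial_sum[OF dcX] partial_mult[OF diff_chris[OF y] dX]
    by (simp add: q_def d_def c_def p_def x_def)
  have pY: "partial i (\<lambda>z. (\<Sum>j\<in>UNIV. X z $ j *\<^sub>R nabla G X j z) $ k) y =
      (\<Sum>j\<in>UNIV. p i j * B j k + x j * (q i j k + (\<Sum>l\<in>UNIV. d i k j l * x l + c k j l * p i l)))" for i k
  proof -
    have dn: "(\<lambda>z. X z $ j * nabla G X j z $ k) differentiable (at y)" for j
      by (intro differentiable_mult dX smooth_on_differentiable[OF sn y])
    have "partial i (\<lambda>z. \<Sum>j\<in>UNIV. X z $ j * nabla G X j z $ k) y =
      (\<Sum>j\<in>UNIV. p i j * B j k + x j * (q i j k + (\<Sum>l\<in>UNIV. d i k j l * x l + c k j l * p i l)))"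
      unfolding partial_sum[OF dn] partial_mult[OF dX smooth_on_differentiable[OF sn y]] pn B
      by (simp add: x_def p_def)
    then show ?thesis by simp
  qed
  have L: "loc_divergence G (\<lambda>z. \<Sum>j\<in>UNIV. X z $ j *\<^sub>R nabla G X j z) y =
    (\<Sum>i\<in>UNIV. (\<Sum>j\<in>UNIV. p i j * B j i + x j * (q i j i + (\<Sum>l\<in>UNIV. d i i j l * x l + c i j l * p i l)))
            + (\<Sum>k\<in>UNIV. c i i k * (\<Sum>j\<in>UNIV. x j * B j k)))"
    unfolding loc_divergence_def pY by (simp add: B x_def c_def)
  have D: "partial j (loc_divergence G X) y = (\<Sum>i\<in>UNIV. q j i i + (\<Sum>k\<in>UNIV. d j i i k * x k + c i i k * p j k))" for j
  proof -
    have "partial j (loc_divergence G X) y = (\<Sum>i\<in>UNIV. partial j (\<lambda>z. partial i (\<lambda>z. X z $ i) z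
         + (\<Sum>k\<in>UNIV. loc_christoffel G i i k z * X z $ k)) y)"
      unfolding loc_divergence_def[abs_def] by (intro partial_sum differentiable_add dpX dsX)
    then show ?thesis
      unfolding partial_add[OF dpX dsX] partial_sum[OF dcX] partial_mult[OF diff_chris[OF y] dX]
      by (simp add: q_def d_def c_def p_def x_def)
  qed
  have Ric: "X y \<bullet> (loc_ricci G y *v X y) = (\<Sum>i\<in>UNIV. x i * (\<Sum>j\<in>UNIV. (\<Sum>k\<in>UNIV. d k k i j - d j k i k
            + (\<Sum>l\<in>UNIV. c k k l * c l i j - c k j l * c l i k)) * x j))"
    by (simp add: inner_vec_def matrix_vector_mult_def loc_ricci_def x_def d_def c_def)
  have qs: "q i j k = q j i k" for i j k
    unfolding q_def by (rule partial_symmetric[OF open_S X y])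
  have cs: "c k i j = c k j i" for k i j unfolding c_def by (rule sym_christoffel[OF y])
  have ds: "d m k i j = d m k j i" for m k i j
    unfolding d_def by (rule partial_cong_open[OF open_S y sym_christoffel])
  have "(\<Sum>j\<in>UNIV. X y $ j * partial j (loc_divergence G X) y) = (\<Sum>j\<in>UNIV. x j * (\<Sum>i\<in>UNIV. q j i i + (\<Sum>k\<in>UNIV. d j i i k * x k + c i i k * p j k)))"
    unfolding D x_def ..
  then show ?thesis
    unfolding L Ric B using divergence_nabla_algebra[of q c d p x, OF qs cs ds, folded B_def] by simp
qed

lemma loc_divergence_cong:
  assumes "y \<in> S" "\<And>z. z \<in> S \<Longrightarrow> X z = Y z"
  shows "loc_divergence G X y = loc_divergence G Y y"
  unfolding loc_divergence_def using assms
  by (intro sum.cong arg_cong2[where f="(+)"] partial_cong_open[OF open_S]) auto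

text \<open>The squared norm of a symmetric tensor is the trace of the square of the endomorphism obtained by
raising an index, which for the Hessian is the covariant derivative of the gradient.\<close>
lemma tensor_norm2_hessian:
  assumes y: "y \<in> S" and F: "smooth_on S F"
  shows "tensor_norm2 (G y) (loc_hessian G F y) =
    (\<Sum>i\<in>UNIV. \<Sum>j\<in>UNIV. nabla G (loc_gradient G F) i y $ j * nabla G (loc_gradient G F) j y $ i)"
proof -
  let ?g = "matrix_inv (G y)" and ?H = "loc_hessian G F y"
  have gs: "?g $ i $ k = ?g $ k $ i" for i k
    using arg_cong[OF sym_inv[OF y], of "\<lambda>A. A $ k $ i"] by (simp add: transpose_def)
  have "tensor_norm2 (G y) ?H = (\<Sum>i\<in>UNIV. \<Sum>k\<in>UNIV. \<Sum>j\<in>UNIV. \<Sum>l\<in>UNIV. ?g $ i $ k * ?g $ j $ l * ?H $ i $ j * ?H $ k $ l)"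
    unfolding tensor_norm2_def by (intro sum.cong refl sum.swap)
  also have "\<dots> = (\<Sum>k\<in>UNIV. \<Sum>i\<in>UNIV. \<Sum>j\<in>UNIV. \<Sum>l\<in>UNIV. ?g $ i $ k * ?g $ j $ l * ?H $ i $ j * ?H $ k $ l)"
    by (rule sum.swap)
  also have "\<dots> = (\<Sum>k\<in>UNIV. \<Sum>j\<in>UNIV. \<Sum>i\<in>UNIV. \<Sum>l\<in>UNIV. ?g $ i $ k * ?g $ j $ l * ?H $ i $ j * ?H $ k $ l)"
    by (intro sum.cong refl sum.swap)
  also have "\<dots> = (\<Sum>k\<in>UNIV. \<Sum>j\<in>UNIV. (\<Sum>l\<in>UNIV. ?g $ j $ l * ?H $ k $ l) * (\<Sum>i\<in>UNIV. ?g $ k $ i * ?H $ j $ i))"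
  proof (intro sum.cong refl)
    fix k j
    show "(\<Sum>i\<in>UNIV. \<Sum>l\<in>UNIV. ?g $ i $ k * ?g $ j $ l * ?H $ i $ j * ?H $ k $ l) =
      (\<Sum>l\<in>UNIV. ?g $ j $ l * ?H $ k $ l) * (\<Sum>i\<in>UNIV. ?g $ k $ i * ?H $ j $ i)"
      unfolding sum_product by (subst sum.swap, intro sum.cong refl)
        (use gs[of k] sym_hessian[OF F y, of j] in \<open>simp add: mult_ac\<close>)
  qed
  finally show ?thesis
    unfolding nabla_gradient[OF F y] by (simp add: matrix_vector_mult_def)
qed

text \<open>By \<open>gradient_ip_self\<close> the left-hand side is the divergence of \<open>\<nabla>\<^sub>X X\<close> for the gradient field \<open>X\<close>,
so that \<open>divergence_nabla_self\<close> applies.\<close>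
theorem bochner:
  assumes y: "y \<in> S" and F: "smooth_on S F"
  shows "loc_laplacian G (loc_grad_ip G F F) y / 2 =
    tensor_norm2 (G y) (loc_hessian G F y) + loc_grad_ip G F (loc_laplacian G F) y
    + loc_gradient G F y \<bullet> (loc_ricci G y *v loc_gradient G F y)"
proof -
  let ?X = "loc_gradient G F"
  let ?Y = "\<lambda>z. \<Sum>j\<in>UNIV. ?X z $ j *\<^sub>R nabla G ?X j z"
  have sX: "smooth_on S (\<lambda>z. ?X z $ k)" for k by (rule smooth_gradient[OF F])
  have sn: "smooth_on S (\<lambda>z. nabla G ?X j z $ k)" for j k
    unfolding nabla_def partial_vec_def chris_mat_def matrix_vector_mult_def
    by (simp, intro smooth_on_intros sX smooth_christoffel open_S)
  have dY: "(\<lambda>z. ?Y z $ i) differentiable (at y)" for i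
    by (rule smooth_on_differentiable[OF _ y], simp, intro smooth_on_intros sX sn open_S)
  have "loc_laplacian G (loc_grad_ip G F F) y = loc_divergence G (\<lambda>z. 2 *\<^sub>R ?Y z) y"
    unfolding loc_laplacian_def by (rule loc_divergence_cong[OF y gradient_ip_self[OF _ F]])
  also have "\<dots> = 2 * loc_divergence G ?Y y"
  proof -
    have "partial i (\<lambda>z. (2 *\<^sub>R ?Y z) $ i) y = 2 * partial i (\<lambda>z. ?Y z $ i) y" for i
      using partial_mult[of "\<lambda>z. 2" y "\<lambda>z. ?Y z $ i" i] dY[of i] by (simp add: partial_const)
    then show ?thesis
      unfolding loc_divergence_def by (simp add: sum_distrib_left distrib_left mult_ac)
  qed
  finally show ?thesis
    unfolding divergence_nabla_self[OF y sX] tensor_norm2_hessian[OF y F] loc_laplacian_def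
    by (simp add: loc_grad_ip_def inner_vec_def differential_def)
qed

end

section \<open>The Riemannian density and divergences\<close>

lemma partial_prod:
  assumes "\<And>j. j \<in> J \<Longrightarrow> F j differentiable (at y)"
  shows "partial i (\<lambda>z. \<Prod>j\<in>J. F j z) y = (\<Sum>j\<in>J. partial i (F j) y * (\<Prod>l\<in>J-{j}. F l y))"
proof -
  have "((\<lambda>z. \<Prod>j\<in>J. F j z) has_derivative
      (\<lambda>h. \<Sum>j\<in>J. frechet_derivative (F j) (at y) h * (\<Prod>l\<in>J-{j}. F l y))) (at y)"
    by (rule has_derivative_prod) (use assms has_derivative_frechet in blast)
  then show ?thesis by (simp add: partial_eqI) (simp add: partial_def)
qed

text \<open>Jacobi's formula.  The product rule gives a sum of determinants in which one row is differentiated;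
that row is a combination of the rows of the matrix, so Cramer's rule evaluates each of them.\<close>
lemma partial_det:
  fixes A :: "real^'n \<Rightarrow> real^'m^'m"
  assumes d: "\<And>k l. (\<lambda>z. A z $ k $ l) differentiable (at y)" and nz: "det (A y) \<noteq> 0"
  shows "partial i (\<lambda>z. det (A z)) y = det (A y) * trace (partial_mat i A y ** matrix_inv (A y))"
proof -
  let ?U = "UNIV :: 'm set" and ?D = "partial_mat i A y"
  let ?P = "{p. p permutes ?U}"
  have dp: "(\<lambda>z. \<Prod>j\<in>?U. A z $ j $ p j) differentiable (at y)" for p
    using has_derivative_prod[of ?U "\<lambda>j z. A z $ j $ p j", OF has_derivative_frechet[OF d]]
    by (auto simp: differentiable_def)
  have "partial i (\<lambda>z. det (A z)) y = (\<Sum>p\<in>?P. partial i (\<lambda>z. of_int (sign p) * (\<Prod>j\<in>?U. A z $ j $ p j)) y)"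
    unfolding det_def by (intro partial_sum differentiable_mult differentiable_const dp)
  also have "\<dots> = (\<Sum>p\<in>?P. of_int (sign p) * (\<Sum>j\<in>?U. ?D $ j $ p j * (\<Prod>l\<in>?U-{j}. A y $ l $ p l)))"
  proof (intro sum.cong refl)
    fix p assume "p \<in> ?P"
    show "partial i (\<lambda>z. of_int (sign p) * (\<Prod>j\<in>?U. A z $ j $ p j)) y =
      of_int (sign p) * (\<Sum>j\<in>?U. ?D $ j $ p j * (\<Prod>l\<in>?U-{j}. A y $ l $ p l))"
      unfolding partial_mult[OF differentiable_const dp] partial_prod[OF d] partial_const
      by (simp add: partial_mat_def)
  qed
  also have "\<dots> = (\<Sum>j\<in>?U. \<Sum>p\<in>?P. of_int (sign p) * (?D $ j $ p j * (\<Prod>l\<in>?U-{j}. A y $ l $ p l)))"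
    unfolding sum_distrib_left by (rule sum.swap)
  also have "\<dots> = (\<Sum>j\<in>?U. det (\<chi> r. if r = j then ?D $ j else row r (A y)))"
  proof (intro sum.cong refl)
    fix j
    have "(\<Prod>l\<in>?U. (\<chi> r. if r = j then ?D $ j else row r (A y)) $ l $ p l) =
       ?D $ j $ p j * (\<Prod>l\<in>?U-{j}. A y $ l $ p l)" for p
      by (subst prod.remove[of _ j]) (auto intro!: prod.cong simp: row_def)
    then show "(\<Sum>p\<in>?P. of_int (sign p) * (?D $ j $ p j * (\<Prod>l\<in>?U-{j}. A y $ l $ p l))) =
       det (\<chi> r. if r = j then ?D $ j else row r (A y))"
      unfolding det_def by simp
  qed
  also have "\<dots> = (\<Sum>j\<in>?U. (?D ** matrix_inv (A y)) $ j $ j * det (A y))"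
  proof (intro sum.cong refl)
    fix j
    define x where "x = (?D ** matrix_inv (A y)) $ j"
    have eq: "(\<Sum>r\<in>?U. x $ r *s row r (A y)) = ((?D ** matrix_inv (A y)) ** A y) $ j"
      by (simp add: vec_eq_iff matrix_matrix_mult_def x_def row_def vector_scalar_mult_def)
    then have eq: "(\<Sum>r\<in>?U. x $ r *s row r (A y)) = ?D $ j"
      by (simp add: matrix_mul_assoc[symmetric] matrix_inv_mult[OF nz])
    show "det (\<chi> r. if r = j then ?D $ j else row r (A y)) = (?D ** matrix_inv (A y)) $ j $ j * det (A y)"
      using cramer_lemma_transpose[of j x "A y"] unfolding eq by (simp add: x_def)
  qed
  finally show ?thesis by (simp add: trace_def sum_distrib_left mult.commute)
qed

lemma Ck_on_sqrt: "Ck_on k {0::real<..} sqrt"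
proof (induction k)
  case 0
  then show ?case by (auto intro!: continuous_intros)
next
  case (Suc k)
  have d: "(sqrt has_derivative (\<lambda>v. (v / 2) * inverse (sqrt x))) (at x)" if "x > 0" for x::real
    using that by (auto intro!: derivative_eq_intros simp: field_simps)
  have "Ck_on k {0<..} (\<lambda>x. (v / 2) * inverse (sqrt x))" for v :: real
    by (intro Ck_on_mult Ck_on_const Ck_on_compose[OF _ _ _ Ck_on_inverse Suc]) auto
  then have "Ck_on k {0<..} (\<lambda>x. frechet_derivative sqrt (at x) v)" for v :: real
    by (rule Ck_on_cong[rotated 2]) (auto simp: frechet_derivative_eqI[OF d])
  then show ?case using d by (auto simp: differentiable_def)
qed

lemma loc_divergence_scale:
  assumes "a differentiable (at y)" "\<And>k. (\<lambda>z. X z $ k) differentiable (at y)"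
  shows "loc_divergence G (\<lambda>z. a z *\<^sub>R X z) y = a y * loc_divergence G X y + X y \<bullet> differential a y"
  unfolding loc_divergence_def
  by (simp add: partial_mult assms inner_vec_def differential_def sum.distrib sum_distrib_left algebra_simps)

context local_metric
begin

definition \<rho> :: "real^'n \<Rightarrow> real" where "\<rho> y = sqrt (det (G y))"

lemma rho_pos: "y \<in> S \<Longrightarrow> \<rho> y > 0"
  by (simp add: \<rho>_def det_pos)

lemma smooth_det_G: "smooth_on S (\<lambda>y. det (G y))"
  by (intro smooth_on_det open_S smooth_entry)

lemma smooth_rho: "smooth_on S \<rho>"
  unfolding \<rho>_def[abs_def]
  by (rule smooth_on_compose[where T="{0<..}"])
     (use Ck_on_sqrt det_pos in \<open>auto simp: smooth_on_def intro: open_S smooth_on_imp_Ck[OF smooth_det_G]\<close>)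

text \<open>Metric compatibility expresses the derivative of the metric through the connection; in Jacobi's
formula its two terms contribute the same trace, and the square root halves the result.\<close>
lemma partial_rho:
  assumes y: "y \<in> S"
  shows "partial i \<rho> y = \<rho> y * (\<Sum>k\<in>UNIV. loc_christoffel G k i k y)"
proof -
  let ?C = "chris_mat G i y" and ?g = "matrix_inv (G y)"
  have "((\<lambda>z. sqrt (det (G z))) has_derivative (\<lambda>v. frechet_derivative (\<lambda>z. det (G z)) (at y) v * (inverse (sqrt (det (G y))) / 2))) (at y)"
  proof (rule has_derivative_eq_rhs[OF diff_chain_at[of "\<lambda>z. det (G z)" _ y sqrt "\<lambda>v. v * (inverse (sqrt (det (G y))) / 2)", unfolded comp_def]])
    show "((\<lambda>z. det (G z)) has_derivative frechet_derivative (\<lambda>z. det (G z)) (at y)) (at y)"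
      by (rule has_derivative_frechet[OF smooth_on_differentiable[OF smooth_det_G y]])
    show "(sqrt has_derivative (\<lambda>v. v * (inverse (sqrt (det (G y))) / 2))) (at (det (G y)))"
      using DERIV_real_sqrt[OF det_pos[OF y]] unfolding has_field_derivative_def
      by (rule has_derivative_eq_rhs) (simp add: fun_eq_iff)
  qed simp
  from partial_eqI[OF this, of i] have "partial i \<rho> y = partial i (\<lambda>z. det (G z)) y * (inverse (\<rho> y) / 2)"
    by (simp add: \<rho>_def[abs_def] partial_def)
  also have "partial i (\<lambda>z. det (G z)) y = det (G y) * trace (partial_mat i G y ** ?g)"
    using det_pos[OF y] by (intro partial_det diff_entry y) auto
  also have "trace (partial_mat i G y ** ?g) = 2 * trace ?C"
  proof -
    have "partial_mat i G y ** ?g = transpose ?C + G y ** ?C ** ?g"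
      unfolding partial_mat_metric[OF y] matrix_mult_add_distrib_right
      by (simp add: matrix_mul_assoc[symmetric] inv_mult[OF y])
    moreover have "trace (transpose ?C) = trace ?C" by (simp add: trace_def transpose_def)
    moreover have "trace (G y ** ?C ** ?g) = trace ?C"
      by (subst trace_mul_sym) (simp add: matrix_mul_assoc inv_mult[OF y])
    ultimately show ?thesis by (simp add: trace_add)
  qed
  also have "det (G y) = \<rho> y * \<rho> y" using det_pos[OF y] by (simp add: \<rho>_def)
  finally show ?thesis using rho_pos[OF y]
    by (simp add: trace_def chris_mat_def)
qed

text \<open>Multiplied with the density, the divergence is a sum of ordinary partial derivatives, because the
derivative of the density supplies the connection term.\<close>
lemma divergence_form:
  assumes y: "y \<in> S" and \<phi>: "\<phi> differentiable (at y)" and \<psi>: "smooth_on S \<psi>"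
  shows "(\<Sum>i\<in>UNIV. partial i (\<lambda>z. \<phi> z * \<rho> z * loc_gradient G \<psi> z $ i) y)
       = \<rho> y * (\<phi> y * loc_laplacian G \<psi> y + loc_grad_ip G \<phi> \<psi> y)"
proof -
  let ?X = "loc_gradient G \<psi>"
  have dX: "(\<lambda>z. ?X z $ i) differentiable (at y)" for i
    by (rule smooth_on_differentiable[OF smooth_gradient[OF \<psi>] y])
  have dr: "\<rho> differentiable (at y)" by (rule smooth_on_differentiable[OF smooth_rho y])
  have dpr: "(\<lambda>z. \<phi> z * \<rho> z) differentiable (at y)" by (intro differentiable_mult \<phi> dr)
  have 1: "partial i (\<lambda>z. \<phi> z * \<rho> z * ?X z $ i) y = \<rho> y * (partial i \<phi> y * ?X y $ i
     + \<phi> y * ((\<Sum>k\<in>UNIV. loc_christoffel G k i k y) * ?X y $ i + partial i (\<lambda>z. ?X z $ i) y))" for i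
    unfolding partial_mult[OF dpr dX] partial_mult[OF \<phi> dr] partial_rho[OF y] by (simp add: algebra_simps)
  have "(\<Sum>i\<in>UNIV. (\<Sum>k\<in>UNIV. loc_christoffel G k i k y) * ?X y $ i) = (\<Sum>k\<in>UNIV. \<Sum>i\<in>UNIV. loc_christoffel G k k i y * ?X y $ i)"
    unfolding sum_distrib_right by (subst sum.swap) (simp add: sym_christoffel[OF y])
  then have "(\<Sum>i\<in>UNIV. (\<Sum>k\<in>UNIV. loc_christoffel G k i k y) * ?X y $ i + partial i (\<lambda>z. ?X z $ i) y) = loc_laplacian G \<psi> y"
    by (simp add: loc_laplacian_def loc_divergence_def sum.distrib)
  moreover have "(\<Sum>i\<in>UNIV. partial i \<phi> y * ?X y $ i) = loc_grad_ip G \<phi> \<psi> y"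
    unfolding loc_grad_ip_sym[OF y, of \<phi>] by (simp add: loc_grad_ip_def inner_vec_def differential_def mult.commute)
  ultimately show ?thesis
    unfolding 1 sum_distrib_left[symmetric] sum.distrib by simp
qed

lemma vec_norm2_gradient:
  assumes y: "y \<in> S" shows "vec_norm2 (G y) (loc_gradient G F y) = loc_grad_ip G F F y"
proof -
  have "vec_norm2 (G y) v = v \<bullet> (G y *v v)" for v
    by (simp add: vec_norm2_def inner_vec_def matrix_vector_mult_def sum_distrib_left mult_ac)
  then show ?thesis
    by (simp add: loc_grad_ip_def loc_gradient_matrix matrix_vector_mul_assoc inv_mult[OF y])
qed

text \<open>Expansion of a square: the contraction with the metric is the trace, which is the Laplacian for the
Hessian and the dimension for the metric itself.\<close>
lemma tensor_norm2_shift: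
  assumes y: "y \<in> S" and F: "smooth_on S F"
  shows "tensor_norm2 (G y) (loc_hessian G F y - s *\<^sub>R G y) =
    tensor_norm2 (G y) (loc_hessian G F y) - 2 * s * loc_laplacian G F y + s\<^sup>2 * real CARD('n)"
proof -
  let ?g = "matrix_inv (G y)" and ?H = "loc_hessian G F y" and ?G = "G y"
  have gs: "?g $ i $ k = ?g $ k $ i" for i k
    using arg_cong[OF sym_inv[OF y], of "\<lambda>A. A $ k $ i"] by (simp add: transpose_def)
  have gG: "(\<Sum>k\<in>UNIV. ?g $ i $ k * ?G $ k $ l) = (if i = l then 1 else 0)" for i l
    using arg_cong[OF inv_mult(2)[OF y], of "\<lambda>A. A $ i $ l"] by (simp add: matrix_matrix_mult_def mat_def)
  have c: "(\<Sum>k\<in>UNIV. \<Sum>l\<in>UNIV. ?g $ i $ k * ?g $ j $ l * ?G $ k $ l) = ?g $ i $ j" for i j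
  proof -
    have "(\<Sum>k\<in>UNIV. \<Sum>l\<in>UNIV. ?g $ i $ k * ?g $ j $ l * ?G $ k $ l) = (\<Sum>l\<in>UNIV. \<Sum>k\<in>UNIV. ?g $ j $ l * (?g $ i $ k * ?G $ k $ l))"
      by (subst sum.swap) (simp add: mult_ac)
    also have "\<dots> = ?g $ j $ i"
      by (simp add: sum_distrib_left[symmetric] gG if_distrib cong: if_cong)
    finally show ?thesis using gs by simp
  qed
  define b where "b T U = (\<Sum>i\<in>UNIV. \<Sum>j\<in>UNIV. \<Sum>k\<in>UNIV. \<Sum>l\<in>UNIV. ?g $ i $ k * ?g $ j $ l * T $ i $ j * U $ k $ l)" for T U :: "real^'n^'n"
  have bG: "b T ?G = (\<Sum>i\<in>UNIV. \<Sum>j\<in>UNIV. ?g $ i $ j * T $ i $ j)" for T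
  proof -
    have "b T ?G = (\<Sum>i\<in>UNIV. \<Sum>j\<in>UNIV. T $ i $ j * (\<Sum>k\<in>UNIV. \<Sum>l\<in>UNIV. ?g $ i $ k * ?g $ j $ l * ?G $ k $ l))"
      unfolding b_def by (simp add: sum_distrib_left mult_ac)
    then show ?thesis unfolding c by (simp add: mult.commute)
  qed
  have bs: "b ?G T = b T ?G" for T
    unfolding b_def
  proof (subst sum_swap_pairs, intro sum.cong refl)
    fix k l i j
    show "?g $ i $ k * ?g $ j $ l * ?G $ i $ j * T $ k $ l = ?g $ k $ i * ?g $ l $ j * T $ k $ l * ?G $ i $ j"
      using gs[of i k] gs[of j l] by simp
  qed
  have "tensor_norm2 ?G (?H - s *\<^sub>R ?G) = b ?H ?H - s * b ?H ?G - s * b ?G ?H + s * s * b ?G ?G"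
    unfolding tensor_norm2_def b_def
    by (simp add: sum_distrib_left sum_subtractf[symmetric] sum.distrib[symmetric] algebra_simps)
  also have "b ?G ?G = real CARD('n)"
    unfolding bG using gG by (simp add: sym_entry[OF y])
  finally show ?thesis
    unfolding bs bG laplacian_trace[OF F y] by (simp add: b_def tensor_norm2_def power2_eq_square)
qed

lemma laplacian_cong:
  assumes "y \<in> S" "\<And>z. z \<in> S \<Longrightarrow> a z = b z"
  shows "loc_laplacian G a y = loc_laplacian G b y"
proof -
  have "loc_gradient G a z = loc_gradient G b z" if "z \<in> S" for z
    unfolding loc_gradient_def vec_eq_iff
    using partial_cong_open[OF open_S that, of a b] assms(2) by simp
  then show ?thesis unfolding loc_laplacian_def by (intro loc_divergence_cong assms(1))
qed

lemma loc_grad_ip_cong: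
  assumes "y \<in> S" "\<And>z. z \<in> S \<Longrightarrow> a z = a' z" "\<And>z. z \<in> S \<Longrightarrow> b z = b' z"
  shows "loc_grad_ip G a b y = loc_grad_ip G a' b' y"
  unfolding loc_grad_ip_def loc_gradient_matrix differential_def
  using partial_cong_open[OF open_S assms(1), of a a'] partial_cong_open[OF open_S assms(1), of b b'] assms(2,3)
  by simp

end

section \<open>Differentiation under the integral sign and integration by parts\<close>

text \<open>By the mean value inequality the difference quotients are dominated by \<open>w\<close>, so dominated
convergence applies along every sequence tending to \<open>t\<close>.\<close>
lemma has_real_derivative_integral:
  fixes \<Phi> \<Phi>' :: "real \<Rightarrow> 'b \<Rightarrow> real"
  assumes J: "open J" "convex J" "t \<in> J"
    and int: "\<And>s. s \<in> J \<Longrightarrow> integrable N (\<Phi> s)"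
    and der: "\<And>s p. s \<in> J \<Longrightarrow> p \<in> space N \<Longrightarrow> ((\<lambda>s. \<Phi> s p) has_real_derivative \<Phi>' s p) (at s)"
    and bound: "\<And>s p. s \<in> J \<Longrightarrow> p \<in> space N \<Longrightarrow> \<bar>\<Phi>' s p\<bar> \<le> w p"
    and w: "integrable N w" and meas: "\<Phi>' t \<in> borel_measurable N"
  shows "((\<lambda>s. \<integral>p. \<Phi> s p \<partial>N) has_real_derivative (\<integral>p. \<Phi>' t p \<partial>N)) (at t)"
proof -
  have "((\<lambda>s. ((\<integral>p. \<Phi> s p \<partial>N) - (\<integral>p. \<Phi> t p \<partial>N)) / (s - t)) \<longlongrightarrow> (\<integral>p. \<Phi>' t p \<partial>N)) (at t within J)"
    unfolding tendsto_at_iff_sequentially comp_def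
  proof (intro allI impI)
    fix X :: "nat \<Rightarrow> real" assume X: "\<forall>i. X i \<in> J - {t}" "X \<longlonglongrightarrow> t"
    have "(\<lambda>i. \<integral>p. (\<Phi> (X i) p - \<Phi> t p) / (X i - t) \<partial>N) \<longlonglongrightarrow> (\<integral>p. \<Phi>' t p \<partial>N)"
    proof (rule integral_dominated_convergence[where w = w])
      show "\<Phi>' t \<in> borel_measurable N" by (rule meas)
      show "(\<lambda>p. (\<Phi> (X i) p - \<Phi> t p) / (X i - t)) \<in> borel_measurable N" for i
        using borel_measurable_integrable[OF int] X J(3) by (intro borel_measurable_divide borel_measurable_diff) auto
      show "integrable N w" by (rule w)
      show "AE p in N. (\<lambda>i. (\<Phi> (X i) p - \<Phi> t p) / (X i - t)) \<longlonglongrightarrow> \<Phi>' t p"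
      proof (rule AE_I2)
        fix p assume p: "p \<in> space N"
        have "((\<lambda>s. (\<Phi> s p - \<Phi> t p) / (s - t)) \<longlongrightarrow> \<Phi>' t p) (at t within J)"
          using der[OF J(3) p] has_field_derivative_iff[of "\<lambda>s. \<Phi> s p" "\<Phi>' t p" t UNIV]
          by (auto intro: tendsto_within_subset)
        then show "(\<lambda>i. (\<Phi> (X i) p - \<Phi> t p) / (X i - t)) \<longlonglongrightarrow> \<Phi>' t p"
          using X unfolding tendsto_at_iff_sequentially comp_def by blast
      qed
      show "AE p in N. norm ((\<Phi> (X i) p - \<Phi> t p) / (X i - t)) \<le> w p" for i
      proof (rule AE_I2)
        fix p assume p: "p \<in> space N"
        have "norm (\<Phi> (X i) p - \<Phi> t p) \<le> w p * norm (X i - t)"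
          using X J(3)
          by (intro field_differentiable_bound[OF J(2), of "\<lambda>s. \<Phi> s p" "\<lambda>s. \<Phi>' s p"])
             (auto intro: DERIV_subset der[OF _ p] has_field_derivative_at_within bound[OF _ p])
        then show "norm ((\<Phi> (X i) p - \<Phi> t p) / (X i - t)) \<le> w p"
          using X(1)[rule_format, of i] by (simp add: divide_le_eq)
      qed
    qed
    moreover have "(\<integral>p. (\<Phi> (X i) p - \<Phi> t p) / (X i - t) \<partial>N) = ((\<integral>p. \<Phi> (X i) p \<partial>N) - (\<integral>p. \<Phi> t p \<partial>N)) / (X i - t)" for i
      unfolding integral_divide_zero by (subst Bochner_Integration.integral_diff) (use X J(3) int in auto)
    ultimately show "(\<lambda>i. ((\<integral>p. \<Phi> (X i) p \<partial>N) - (\<integral>p. \<Phi> t p \<partial>N)) / (X i - t)) \<longlonglongrightarrow> (\<integral>p. \<Phi>' t p \<partial>N)"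
      by (simp only:)
  qed
  then show ?thesis
    unfolding has_field_derivative_iff using at_within_open[OF J(3,1)] by simp
qed

lemma continuous_compact_support_integrable:
  fixes h :: "'a::euclidean_space \<Rightarrow> real"
  assumes "continuous_on UNIV h" "compact K" "\<And>x. x \<notin> K \<Longrightarrow> h x = 0"
  shows "integrable lborel h"
proof -
  have "integrable lborel (\<lambda>x. indicator K x *\<^sub>R h x)"
    by (rule borel_integrable_compact[OF assms(2)]) (use assms(1) continuous_on_subset in blast)
  moreover have "(\<lambda>x. indicator K x *\<^sub>R h x) = h"
    using assms(3) by (auto simp: indicator_def fun_eq_iff)
  ultimately show ?thesis by simp
qed

text \<open>The integral of \<open>h (x + s e)\<close> over \<open>x\<close> does not depend on \<open>s\<close>, and its derivative at \<open>s = 0\<close> is the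
integral of the partial derivative.\<close>
lemma integral_partial_eq_0:
  fixes h :: "real^'n::finite \<Rightarrow> real"
  assumes h: "Ck_on 1 UNIV h" and K: "compact K" "\<And>x. x \<notin> K \<Longrightarrow> h x = 0"
  shows "(\<integral>x. partial i h x \<partial>lborel) = 0" "integrable lborel (partial i h)"
proof -
  let ?e = "axis i 1 :: real^'n"
  have dh: "h differentiable (at x)" for x using h by simp
  have ch: "continuous_on UNIV h" using Ck_on_imp_continuous_on[OF h] .
  have cp: "continuous_on UNIV (partial i h)"
    using h by (simp add: partial_def[abs_def])
  have op: "open (- K)" using K(1) compact_imp_closed by blast
  have p0: "partial i h x = 0" if "x \<notin> K" for x
    using partial_cong_open[OF op, of x h "\<lambda>_. 0"] that K(2) by (simp add: partial_const)
  show int: "integrable lborel (partial i h)"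
    by (rule continuous_compact_support_integrable[OF cp K(1) p0])
  have "bounded (partial i h ` K)"
    by (intro compact_imp_bounded compact_continuous_image continuous_on_subset[OF cp] K(1)) simp
  then obtain B0 where "\<And>x. x \<in> K \<Longrightarrow> \<bar>partial i h x\<bar> \<le> B0"
    unfolding bounded_iff by auto
  then obtain B where B: "\<And>x. x \<in> K \<Longrightarrow> \<bar>partial i h x\<bar> \<le> B" "B \<ge> 0"
    using that[of "max B0 0"] by (simp add: le_max_iff_disj)
  obtain R where R: "\<forall>x\<in>K. norm x \<le> R"
    using compact_imp_bounded[OF K(1)] unfolding bounded_iff by blast
  let ?\<Phi> = "\<lambda>s x. h (x + s *\<^sub>R ?e)"
  have "((\<lambda>s. \<integral>x. ?\<Phi> s x \<partial>lborel) has_real_derivative (\<integral>x. partial i h (x + 0 *\<^sub>R ?e) \<partial>lborel)) (at 0)"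
  \<comment> \<open>For \<open>\<bar>s\<bar> < 1\<close> the translated support stays in the ball of radius \<open>R + 1\<close>.\<close>
  proof (rule has_real_derivative_integral[where J="{-1<..<1}" and \<Phi>' = "\<lambda>s x. partial i h (x + s *\<^sub>R ?e)"
       and w = "\<lambda>x. B * indicator (cball 0 (R+1)) x"])
    show "((\<lambda>s. ?\<Phi> s x) has_real_derivative partial i h (x + s *\<^sub>R ?e)) (at s)" for s x
      using has_real_derivative_along_line[OF dh] by (simp add: partial_def)
    show "integrable lborel (?\<Phi> s)" for s
    proof (rule continuous_compact_support_integrable)
      show "continuous_on UNIV (?\<Phi> s)"
        by (intro continuous_on_compose2[OF ch] continuous_intros) auto
      show "compact ((\<lambda>x. x - s *\<^sub>R ?e) ` K)"
        by (intro compact_continuous_image K continuous_intros)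
      show "h (x + s *\<^sub>R ?e) = 0" if "x \<notin> (\<lambda>x. x - s *\<^sub>R ?e) ` K" for x
        using that by (intro K(2)) (metis add_diff_cancel image_eqI)
    qed
    show "\<bar>partial i h (x + s *\<^sub>R ?e)\<bar> \<le> B * indicator (cball 0 (R+1)) x" if "s \<in> {-1<..<1}" for s x
    proof (cases "x + s *\<^sub>R ?e \<in> K")
      case True
      then have "norm (x + s *\<^sub>R ?e) \<le> R" using R by auto
      moreover have "norm x \<le> norm (x + s *\<^sub>R ?e) + norm (s *\<^sub>R ?e)"
        using norm_triangle_ineq4[of "x + s *\<^sub>R ?e" "s *\<^sub>R ?e"] by simp
      moreover have "norm (s *\<^sub>R ?e) \<le> 1" using that by (auto simp: norm_axis_1)
      ultimately have "x \<in> cball 0 (R+1)" by simp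
      then show ?thesis using B(1)[OF True] by simp
    qed (use p0 B(2) in \<open>simp add: indicator_def\<close>)
    show "integrable lborel (\<lambda>x. B * indicator (cball 0 (R+1)) x :: real)"
      by (intro integrable_mult_right integrable_real_indicator)
         (use emeasure_lborel_cball_finite[of 0 "R + 1"] in \<open>auto simp: infinity_ennreal_def\<close>)
    show "(\<lambda>x. partial i h (x + 0 *\<^sub>R ?e)) \<in> borel_measurable lborel"
      using borel_measurable_continuous_onI[OF cp] by simp
  qed auto
  moreover have "(\<integral>x. ?\<Phi> s x \<partial>lborel) = (\<integral>x. h x \<partial>lborel)" for s
  proof -
    have "(\<integral>x. h x \<partial>lborel) = (\<integral>x. h x \<partial>distr lborel borel ((+) (s *\<^sub>R ?e)))"
      by (simp add: lborel_distr_plus)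
    also have "\<dots> = (\<integral>x. h (s *\<^sub>R ?e + x) \<partial>lborel)"
      by (rule integral_distr) (auto intro: borel_measurable_continuous_onI ch)
    finally show ?thesis by (simp add: add.commute)
  qed
  ultimately show "(\<integral>x. partial i h x \<partial>lborel) = 0"
    using DERIV_unique[OF _ DERIV_const] by simp
qed

context local_metric
begin

lemma Ck_on_loc_grad_ip:
  assumes "Ck_on 1 S \<phi>" "smooth_on S \<psi>" shows "continuous_on S (loc_grad_ip G \<phi> \<psi>)"
proof -
  have "continuous_on S (\<lambda>y. \<Sum>i\<in>UNIV. loc_gradient G \<psi> y $ i * partial i \<phi> y)"
    by (intro continuous_intros smooth_on_continuous[OF smooth_gradient] assms)
       (use assms(1) in \<open>simp add: partial_def[abs_def]\<close>)
  then show ?thesis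
    by (rule continuous_on_eq) (subst loc_grad_ip_sym, auto simp: loc_grad_ip_def inner_vec_def differential_def)
qed

text \<open>The product with the compactly supported \<open>\<phi>\<close> extends by \<open>0\<close> to a continuously differentiable function
on the whole space, whose partial derivatives have integral \<open>0\<close>.\<close>
lemma divergence_theorem_local:
  assumes K: "compact K" "K \<subseteq> S" and \<phi>: "Ck_on 1 S \<phi>" "\<And>y. y \<in> S \<Longrightarrow> y \<notin> K \<Longrightarrow> \<phi> y = 0"
    and \<psi>: "smooth_on S \<psi>"
  shows "(\<integral>y. indicator S y * (\<rho> y * (\<phi> y * loc_laplacian G \<psi> y + loc_grad_ip G \<phi> \<psi> y)) \<partial>lborel) = 0"
proof -
  define h where "h i y = (if y \<in> S then \<phi> y * \<rho> y * loc_gradient G \<psi> y $ i else 0)" for i y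
  have h0: "h i y = 0" if "y \<notin> K" for i y using that \<phi>(2) by (simp add: h_def)
  have op: "open (- K)" using K(1) compact_imp_closed by blast
  have Ckh: "Ck_on 1 UNIV (h i)" for i
  proof -
    have "Ck_on 1 S (\<lambda>y. \<phi> y * \<rho> y * loc_gradient G \<psi> y $ i)"
      by (intro Ck_on_mult open_S \<phi>(1) smooth_on_imp_Ck[OF smooth_rho] smooth_on_imp_Ck[OF smooth_gradient[OF \<psi>]])
    then have "Ck_on 1 S (h i)" by (rule Ck_on_cong[OF open_S, rotated]) (simp add: h_def)
    moreover have "Ck_on 1 (- K) (h i)"
      by (rule Ck_on_cong[OF op _ Ck_on_const[of _ _ 0]]) (simp add: h0)
    ultimately have "Ck_on 1 (S \<union> - K) (h i)" by (intro Ck_on_union open_S op)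
    moreover have "S \<union> - K = UNIV" using K(2) by auto
    ultimately show ?thesis by simp
  qed
  have "indicator S y * (\<rho> y * (\<phi> y * loc_laplacian G \<psi> y + loc_grad_ip G \<phi> \<psi> y)) = (\<Sum>i\<in>UNIV. partial i (h i) y)" for y
  proof (cases "y \<in> S")
    case True
    have "partial i (h i) y = partial i (\<lambda>z. \<phi> z * \<rho> z * loc_gradient G \<psi> z $ i) y" for i
      by (rule partial_cong_open[OF open_S True]) (simp add: h_def)
    then show ?thesis using divergence_form[OF True _ \<psi>, of \<phi>] \<phi>(1) True by simp
  next
    case False
    have "partial i (h i) y = 0" for i
      using partial_cong_open[OF op, of y "h i" "\<lambda>_. 0"] False K(2) h0 by (auto simp: partial_const)
    then show ?thesis using False by simp
  qed
  then show ?thesis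
    using integral_partial_eq_0[OF Ckh K(1) h0] by (simp add: Bochner_Integration.integral_sum)
qed

end

section \<open>Change of coordinates\<close>

lemma matrix_vector_transpose_inner:
  fixes A :: "real^'n^'m"
  shows "(A *v v) \<bullet> w = v \<bullet> (transpose A *v w)"
  unfolding transpose_matrix_vector by (metis dot_lmul_matrix inner_commute)

lemma matrix_eqI_inner:
  fixes A B :: "real^'n^'n"
  assumes "\<And>v w. v \<bullet> (A *v w) = v \<bullet> (B *v w)"
  shows "A = B"
proof -
  have "A *v w = B *v w" for w
    by (rule vector_eq_ldot[THEN iffD1]) (use assms in blast)
  then show ?thesis by (simp add: matrix_eq)
qed

definition jac :: "(real^'n::finite \<Rightarrow> real^'n) \<Rightarrow> real^'n \<Rightarrow> real^'n^'n" where
  "jac \<phi> y = matrix (frechet_derivative \<phi> (at y))"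

text \<open>Two metrics in coordinates such that \<open>\<phi>\<close> is a local isometry.  Invertibility of the Jacobian follows
from the positivity of both determinants.\<close>
locale chart_change = dom: local_metric S G + cod: local_metric T H
  for S T :: "(real^'n::finite) set" and G H :: "real^'n \<Rightarrow> real^'n^'n" +
  fixes \<phi> :: "real^'n \<Rightarrow> real^'n"
  assumes smooth_\<phi>: "smooth_on S \<phi>" and maps: "y \<in> S \<Longrightarrow> \<phi> y \<in> T"
    and pullback: "y \<in> S \<Longrightarrow> G y = transpose (jac \<phi> y) ** H (\<phi> y) ** jac \<phi> y"
begin

lemma det_metric: "y \<in> S \<Longrightarrow> det (G y) = (det (jac \<phi> y))\<^sup>2 * det (H (\<phi> y))"
  by (simp add: pullback det_mul det_transpose power2_eq_square)

lemma det_jac: "y \<in> S \<Longrightarrow> det (jac \<phi> y) \<noteq> 0"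
  using det_metric[of y] dom.det_pos[of y] by auto

lemma inv_pullback:
  assumes y: "y \<in> S"
  shows "jac \<phi> y ** matrix_inv (G y) ** transpose (jac \<phi> y) = matrix_inv (H (\<phi> y))"
proof -
  let ?J = "jac \<phi> y" and ?K = "matrix_inv (jac \<phi> y)"
  have J: "?J ** ?K = mat 1" "?K ** ?J = mat 1" using matrix_inv_mult[OF det_jac[OF y]] .
  have Jt: "transpose ?K ** transpose ?J = mat 1" "transpose ?J ** transpose ?K = mat 1"
    using J by (metis matrix_transpose_mul transpose_mat)+
  have "transpose ?K ** G y = H (\<phi> y) ** ?J"
    unfolding pullback[OF y] by (simp add: matrix_mul_assoc Jt)
  then have "transpose ?K ** (G y ** matrix_inv (G y)) = H (\<phi> y) ** ?J ** matrix_inv (G y)"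
    by (simp add: matrix_mul_assoc)
  then have "transpose ?K = H (\<phi> y) ** ?J ** matrix_inv (G y)"
    by (simp add: dom.inv_mult[OF y])
  then have "H (\<phi> y) ** (?J ** matrix_inv (G y) ** transpose ?J) = mat 1"
    by (simp add: matrix_mul_assoc) (metis Jt(1))
  then show ?thesis by (rule matrix_inv_unique_right[symmetric])
qed

lemma differential_compose:
  assumes y: "y \<in> S" and F: "F differentiable (at (\<phi> y))"
  shows "differential (\<lambda>z. F (\<phi> z)) y = transpose (jac \<phi> y) *v differential F (\<phi> y)"
proof -
  have d\<phi>: "\<phi> differentiable (at y)" using smooth_on_differentiable[OF smooth_\<phi> y] .
  have "((\<lambda>z. F (\<phi> z)) has_derivative (\<lambda>v. \<Sum>k\<in>UNIV. frechet_derivative \<phi> (at y) v $ k * partial k F (\<phi> y))) (at y)"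
    using diff_chain_at[OF has_derivative_frechet[OF d\<phi>] has_derivative_partial[OF F]] by (simp add: comp_def)
  from partial_eqI[OF this] show ?thesis
    by (simp add: vec_eq_iff differential_def transpose_def matrix_vector_mult_def jac_def matrix_def)
qed

lemma gradient_push:
  assumes y: "y \<in> S" and F: "F differentiable (at (\<phi> y))"
  shows "jac \<phi> y *v loc_gradient G (\<lambda>z. F (\<phi> z)) y = loc_gradient H F (\<phi> y)"
  unfolding loc_gradient_matrix differential_compose[OF assms] inv_pullback[OF y, symmetric]
  by (simp add: matrix_vector_mul_assoc matrix_mul_assoc del: transpose_matrix_vector)

lemma ip_invariant:
  assumes y: "y \<in> S" and a: "a differentiable (at (\<phi> y))" and b: "b differentiable (at (\<phi> y))"
  shows "loc_grad_ip G (\<lambda>z. a (\<phi> z)) (\<lambda>z. b (\<phi> z)) y = loc_grad_ip H a b (\<phi> y)"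
  unfolding loc_grad_ip_def differential_compose[OF y b] gradient_push[OF y a, symmetric] matrix_vector_transpose_inner ..

lemma smooth_pullback: "smooth_on T F \<Longrightarrow> smooth_on S (\<lambda>z. F (\<phi> z))"
  by (rule smooth_on_compose[OF dom.open_S cod.open_S _ _ smooth_\<phi>]) (use maps in auto)

lemma ip_invariant_smooth:
  assumes "y \<in> S" "smooth_on T a" "smooth_on T b"
  shows "loc_grad_ip G (\<lambda>z. a (\<phi> z)) (\<lambda>z. b (\<phi> z)) y = loc_grad_ip H a b (\<phi> y)"
  using ip_invariant assms smooth_on_differentiable maps by blast

text \<open>Arbitrary vectors \<open>v\<close> and \<open>w\<close> are gradients, at the point in question, of the pullbacks of two linear
functions; for these, all terms of \<open>hessian_polarization\<close> are invariant.\<close>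
lemma hessian_pullback:
  assumes y: "y \<in> S" and F: "smooth_on T F"
  shows "loc_hessian G (\<lambda>z. F (\<phi> z)) y = transpose (jac \<phi> y) ** loc_hessian H F (\<phi> y) ** jac \<phi> y"
proof (rule matrix_eqI_inner)
  fix v w
  let ?J = "jac \<phi> y"
  \<comment> \<open>The linear function whose gradient with respect to \<open>H\<close> at \<open>\<phi> y\<close> is the image of \<open>v\<close>.\<close>
  let ?lin = "\<lambda>v. \<lambda>z. (H (\<phi> y) *v (?J *v v)) \<bullet> z"
  have T: "\<phi> y \<in> T" using maps[OF y] .
  have slin: "smooth_on T (?lin v)" for v
    by (simp add: smooth_on_def Ck_on_bounded_linear bounded_linear_inner_right)
  have dlin: "differential (?lin v) z = H (\<phi> y) *v (?J *v v)" for v z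
    by (simp add: differential_def vec_eq_iff partial_eqI[OF bounded_linear_imp_has_derivative[OF bounded_linear_inner_right]] inner_axis)
  have gT: "loc_gradient H (?lin v) (\<phi> y) = ?J *v v" for v
    unfolding loc_gradient_matrix dlin by (simp add: matrix_vector_mul_assoc matrix_mul_assoc cod.inv_mult[OF T])
  have gS: "loc_gradient G (\<lambda>z. ?lin v (\<phi> z)) y = v" for v
  proof -
    have "?J *v loc_gradient G (\<lambda>z. ?lin v (\<phi> z)) y = ?J *v v"
      using gradient_push[OF y smooth_on_differentiable[OF slin T]] gT by simp
    then have "(matrix_inv ?J ** ?J) *v loc_gradient G (\<lambda>z. ?lin v (\<phi> z)) y = (matrix_inv ?J ** ?J) *v v"
      by (simp only: matrix_vector_mul_assoc[symmetric])
    then show ?thesis by (simp add: matrix_inv_mult[OF det_jac[OF y]])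
  qed
  have nested: "loc_grad_ip G (\<lambda>z. a (\<phi> z)) (loc_grad_ip G (\<lambda>z. b (\<phi> z)) (\<lambda>z. c (\<phi> z))) y = loc_grad_ip H a (loc_grad_ip H b c) (\<phi> y)"
    if "smooth_on T a" "smooth_on T b" "smooth_on T c" for a b c
  proof -
    have "loc_grad_ip G (\<lambda>z. a (\<phi> z)) (loc_grad_ip G (\<lambda>z. b (\<phi> z)) (\<lambda>z. c (\<phi> z))) y
        = loc_grad_ip G (\<lambda>z. a (\<phi> z)) (\<lambda>z. loc_grad_ip H b c (\<phi> z)) y"
      using ip_invariant_smooth that by (intro dom.loc_grad_ip_cong[OF y]) auto
    then show ?thesis using ip_invariant_smooth[OF y] cod.smooth_ip that by simp
  qed
  have "2 * (v \<bullet> (loc_hessian G (\<lambda>z. F (\<phi> z)) y *v w)) = 2 * ((?J *v v) \<bullet> (loc_hessian H F (\<phi> y) *v (?J *v w)))"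
    using dom.hessian_polarization[OF y smooth_pullback[OF F] smooth_pullback[OF slin[of v]] smooth_pullback[OF slin[of w]], unfolded gS]
      cod.hessian_polarization[OF T F slin[of v] slin[of w], unfolded gT]
      nested[OF slin[of v] F slin[of w]] nested[OF slin[of w] F slin[of v]] nested[OF F slin[of v] slin[of w]]
    by simp
  then show "v \<bullet> (loc_hessian G (\<lambda>z. F (\<phi> z)) y *v w) = v \<bullet> ((transpose ?J ** loc_hessian H F (\<phi> y) ** ?J) *v w)"
    unfolding matrix_vector_transpose_inner by (simp add: matrix_vector_mul_assoc matrix_mul_assoc del: transpose_matrix_vector)
qed

end

lemma (in local_metric) laplacian_eq_trace:
  assumes "y \<in> S" "smooth_on S F"
  shows "loc_laplacian G F y = trace (matrix_inv (G y) ** loc_hessian G F y)"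
  unfolding laplacian_trace[OF assms(2,1)] trace_def matrix_matrix_mult_def
  using sym_hessian[OF assms(2,1)] by simp

context chart_change
begin

lemma laplacian_invariant:
  assumes y: "y \<in> S" and F: "smooth_on T F"
  shows "loc_laplacian G (\<lambda>z. F (\<phi> z)) y = loc_laplacian H F (\<phi> y)"
proof -
  have "loc_laplacian G (\<lambda>z. F (\<phi> z)) y
      = trace ((matrix_inv (G y) ** transpose (jac \<phi> y)) ** (loc_hessian H F (\<phi> y) ** jac \<phi> y))"
    unfolding dom.laplacian_eq_trace[OF y smooth_pullback[OF F]] hessian_pullback[OF y F]
    by (simp add: matrix_mul_assoc)
  also have "\<dots> = trace (loc_hessian H F (\<phi> y) ** (jac \<phi> y ** matrix_inv (G y) ** transpose (jac \<phi> y)))"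
    by (subst trace_mul_sym) (simp add: matrix_mul_assoc)
  also have "\<dots> = loc_laplacian H F (\<phi> y)"
    unfolding inv_pullback[OF y] cod.laplacian_eq_trace[OF maps[OF y] F] by (rule trace_mul_sym)
  finally show ?thesis .
qed

lemma rho_pullback: "y \<in> S \<Longrightarrow> dom.\<rho> y = cod.\<rho> (\<phi> y) * \<bar>det (jac \<phi> y)\<bar>"
  by (simp add: dom.\<rho>_def cod.\<rho>_def det_metric real_sqrt_mult)

end

section \<open>Substitution in integrals for arbitrary finite index types\<close>

text \<open>For an integrand that is bounded on a set of finite measure both sides are finite, and the
substitution formula for absolutely integrable functions applies.\<close>
lemma nn_integral_image_bounded:
  fixes \<phi> :: "real^'n::{finite,wellorder} \<Rightarrow> real^'n::_"
  assumes B: "B \<in> sets borel" "emeasure lborel B < \<infinity>"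
    and der: "\<And>y. y \<in> B \<Longrightarrow> (\<phi> has_derivative \<phi>' y) (at y)" and inj: "inj_on \<phi> B"
    and q: "\<And>x. x \<in> \<phi> ` B \<Longrightarrow> q x \<ge> 0"
    and meas: "(\<lambda>y. \<bar>det (matrix (\<phi>' y))\<bar> * q (\<phi> y) * indicator B y) \<in> borel_measurable borel"
    and bound: "\<And>y. y \<in> B \<Longrightarrow> \<bar>det (matrix (\<phi>' y))\<bar> * q (\<phi> y) \<le> k"
  shows "integrable lebesgue (\<lambda>x. q x * indicator (\<phi> ` B) x)" (is ?I)
    and "(\<integral>\<^sup>+x. ennreal (q x * indicator (\<phi> ` B) x) \<partial>lebesgue)
      = (\<integral>\<^sup>+y. ennreal (\<bar>det (matrix (\<phi>' y))\<bar> * q (\<phi> y) * indicator B y) \<partial>lborel)" (is ?E)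
proof -
  let ?p = "\<lambda>y. \<bar>det (matrix (\<phi>' y))\<bar> * q (\<phi> y)"
  let ?P = "\<lambda>y. ?p y * indicator B y"
  have p0: "?P y \<ge> 0" for y using q by (cases "y \<in> B") auto
  have Pint: "integrable lborel ?P"
  proof (rule Bochner_Integration.integrable_bound[where f="\<lambda>y. k * indicator B y"])
    show "integrable lborel (\<lambda>y. k * indicator B y :: real)"
      using B by (intro integrable_mult_right integrable_real_indicator) auto
    show "?P \<in> borel_measurable lborel" using meas by simp
    show "AE y in lborel. norm (?P y) \<le> norm (k * indicator B y :: real)"
    proof (rule AE_I2)
      fix y show "norm (?P y) \<le> norm (k * indicator B y :: real)"
        using bound[of y] p0[of y] q by (cases "y \<in> B") auto
    qed
  qed
  then have Pint': "integrable lebesgue ?P" by (simp add: integrable_completion)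
  have abs_p: "?p absolutely_integrable_on B"
    using Pint' unfolding set_integrable_def by (simp add: mult.commute)
  have BL: "B \<in> sets lebesgue" using B(1) by (simp add: sets_completionI_sets)
  have D: "(\<lambda>y. \<bar>det (matrix (\<phi>' y))\<bar> *\<^sub>R (vec (q (\<phi> y)) :: real^1)) = (\<lambda>y. vec (?p y))"
    by (simp add: fun_eq_iff vec_eq_iff)
  have "q absolutely_integrable_on (\<phi> ` B) \<and> integral (\<phi> ` B) q = integral B ?p"
    using has_absolute_integral_change_of_variables[OF BL has_derivative_at_withinI[OF der] inj, of "\<lambda>x. vec (q x) :: real^1" "vec (integral B ?p)"]
      abs_p unfolding D
    by (auto simp: absolutely_integrable_on_1_iff integral_on_1_eq)
  then have Q: "q absolutely_integrable_on (\<phi> ` B)" "integral (\<phi> ` B) q = integral B ?p" by auto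
  show ?I using Q(1) unfolding set_integrable_def by (simp add: mult.commute)
  have "(\<integral>\<^sup>+x. ennreal (q x * indicator (\<phi> ` B) x) \<partial>lebesgue) = ennreal (\<integral>x. q x * indicator (\<phi> ` B) x \<partial>lebesgue)"
    by (rule nn_integral_eq_integral[OF \<open>?I\<close>]) (use q in \<open>auto simp: indicator_def\<close>)
  also have "(\<integral>x. q x * indicator (\<phi> ` B) x \<partial>lebesgue) = integral (\<phi> ` B) q"
    using set_lebesgue_integral_eq_integral(2)[OF Q(1)] by (simp add: set_lebesgue_integral_def mult.commute)
  also have "\<dots> = (\<integral>y. ?P y \<partial>lebesgue)"
    using set_lebesgue_integral_eq_integral(2)[OF abs_p] Q(2) by (simp add: set_lebesgue_integral_def mult.commute)
  also have "\<dots> = (\<integral>y. ?P y \<partial>lborel)"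
    using meas by (intro integral_completion) simp
  also have "ennreal (\<integral>y. ?P y \<partial>lborel) = (\<integral>\<^sup>+y. ennreal (?P y) \<partial>lborel)"
    by (rule nn_integral_eq_integral[OF Pint, symmetric]) (use p0 in auto)
  finally show ?E .
qed

text \<open>The general case follows by monotone convergence along an exhaustion of \<open>B\<close> by sets of finite measure
on which the integrand is bounded.\<close>
lemma nn_integral_image_wellorder:
  fixes \<phi> :: "real^'n::{finite,wellorder} \<Rightarrow> real^'n::_"
  assumes B: "B \<in> sets borel"
    and der: "\<And>y. y \<in> B \<Longrightarrow> (\<phi> has_derivative \<phi>' y) (at y)" and inj: "inj_on \<phi> B"
    and q: "\<And>x. x \<in> \<phi> ` B \<Longrightarrow> q x \<ge> 0"
    and meas: "(\<lambda>y. \<bar>det (matrix (\<phi>' y))\<bar> * q (\<phi> y) * indicator B y) \<in> borel_measurable borel"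
    and meas': "(\<lambda>x. q x * indicator (\<phi> ` B) x) \<in> borel_measurable borel"
  shows "(\<integral>\<^sup>+x. ennreal (q x * indicator (\<phi> ` B) x) \<partial>lborel)
      = (\<integral>\<^sup>+y. ennreal (\<bar>det (matrix (\<phi>' y))\<bar> * q (\<phi> y) * indicator B y) \<partial>lborel)"
proof -
  let ?p = "\<lambda>y. \<bar>det (matrix (\<phi>' y))\<bar> * q (\<phi> y)"
  let ?P = "\<lambda>y. ?p y * indicator B y"
  define Bk where "Bk k = B \<inter> cball 0 (real k) \<inter> {y. ?P y \<le> real k}" for k
  have Bk_sub: "Bk k \<subseteq> B" for k by (auto simp: Bk_def)
  have Bk_borel: "Bk k \<in> sets borel" for k
  proof -
    have "{y \<in> space borel. ?P y \<le> real k} \<in> sets borel" using meas by measurable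
    then show ?thesis unfolding Bk_def using B by auto
  qed
  have Bk_fin: "emeasure lborel (Bk k) < \<infinity>" for k
  proof -
    have "emeasure lborel (Bk k) \<le> emeasure lborel (cball (0 :: (real, 'n) vec) (real k))"
      by (rule emeasure_mono) (auto simp: Bk_def)
    then show ?thesis using emeasure_lborel_cball_finite[of _ "real k"] by (rule le_less_trans)
  qed
  have mono: "Bk i \<subseteq> Bk j" if "i \<le> j" for i j
    using that by (auto simp: Bk_def)
  have un: "\<exists>k. y \<in> Bk k" if "y \<in> B" for y
  proof -
    obtain k where "max (norm y) (?P y) \<le> real k" using real_arch_simple by blast
    then show ?thesis using that by (auto simp: Bk_def)
  qed
  have ind: "?p y * indicator (Bk k) y = ?P y * indicator (Bk k) y" for k y
    using Bk_sub[of k] by (auto simp: indicator_def)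
  have meask: "(\<lambda>y. ?p y * indicator (Bk k) y) \<in> borel_measurable borel" for k
    unfolding ind using meas Bk_borel by measurable
  have bd: "?p y \<le> real k" if "y \<in> Bk k" for y k
    using that by (auto simp: Bk_def)
  note step = nn_integral_image_bounded[OF Bk_borel Bk_fin der inj_on_subset[OF inj Bk_sub] q meask bd]
  have I: "integrable lebesgue (\<lambda>x. q x * indicator (\<phi> ` Bk k) x)" for k
    by (rule step(1)) (use Bk_sub in auto)
  have E: "(\<integral>\<^sup>+x. ennreal (q x * indicator (\<phi> ` Bk k) x) \<partial>lebesgue)
      = (\<integral>\<^sup>+y. ennreal (?p y * indicator (Bk k) y) \<partial>lborel)" for k
    by (rule step(2)) (use Bk_sub in auto)
  have "(\<integral>\<^sup>+x. ennreal (q x * indicator (\<phi> ` B) x) \<partial>lborel) = (\<integral>\<^sup>+x. ennreal (q x * indicator (\<phi> ` B) x) \<partial>lebesgue)"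
    by (rule nn_integral_completion[symmetric])
  also have "\<dots> = (\<integral>\<^sup>+x. (SUP k. ennreal (q x * indicator (\<phi> ` Bk k) x)) \<partial>lebesgue)"
  proof (intro nn_integral_cong)
    fix x
    show "ennreal (q x * indicator (\<phi> ` B) x) = (SUP k. ennreal (q x * indicator (\<phi> ` Bk k) x))"
    proof (cases "x \<in> \<phi> ` B")
      case True
      then obtain k where k: "x \<in> \<phi> ` Bk k" using un by blast
      show ?thesis
      proof (rule antisym)
        show "ennreal (q x * indicator (\<phi> ` B) x) \<le> (SUP k. ennreal (q x * indicator (\<phi> ` Bk k) x))"
          by (rule SUP_upper2[of k]) (use k True in auto)
        show "(SUP k. ennreal (q x * indicator (\<phi> ` Bk k) x)) \<le> ennreal (q x * indicator (\<phi> ` B) x)"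
          by (rule SUP_least, rule ennreal_leI) (use True q[OF True] in \<open>auto simp: indicator_def\<close>)
      qed
    next
      case False
      then have "x \<notin> \<phi> ` Bk k" for k using Bk_sub by blast
      then show ?thesis using False by simp
    qed
  qed
  also have "\<dots> = (SUP k. \<integral>\<^sup>+x. ennreal (q x * indicator (\<phi> ` Bk k) x) \<partial>lebesgue)"
  proof (rule nn_integral_monotone_convergence_SUP)
    show "incseq (\<lambda>k x. ennreal (q x * indicator (\<phi> ` Bk k) x))"
    proof (intro incseq_SucI le_funI ennreal_leI)
      fix k x
      show "q x * indicator (\<phi> ` Bk k) x \<le> q x * indicator (\<phi> ` Bk (Suc k)) x"
        using mono[of k "Suc k"] q[of x] Bk_sub[of "Suc k"] by (auto simp: indicator_def)
    qed
    show "(\<lambda>x. ennreal (q x * indicator (\<phi> ` Bk k) x)) \<in> borel_measurable lebesgue" for k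
      using borel_measurable_integrable[OF I[of k]] by simp
  qed
  also have "\<dots> = (SUP k. \<integral>\<^sup>+y. ennreal (?p y * indicator (Bk k) y) \<partial>lborel)"
    unfolding E ..
  also have "\<dots> = (\<integral>\<^sup>+y. (SUP k. ennreal (?p y * indicator (Bk k) y)) \<partial>lborel)"
  proof (rule nn_integral_monotone_convergence_SUP[symmetric])
    show "incseq (\<lambda>k y. ennreal (?p y * indicator (Bk k) y))"
    proof (intro incseq_SucI le_funI ennreal_leI)
      fix k y
      show "?p y * indicator (Bk k) y \<le> ?p y * indicator (Bk (Suc k)) y"
        using mono[of k "Suc k"] q[of "\<phi> y"] Bk_sub[of "Suc k"] by (auto simp: indicator_def)
    qed
    show "(\<lambda>y. ennreal (?p y * indicator (Bk k) y)) \<in> borel_measurable lborel" for k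
      using meask[of k] by simp
  qed
  also have "\<dots> = (\<integral>\<^sup>+y. ennreal (?P y) \<partial>lborel)"
  proof (intro nn_integral_cong)
    fix y
    show "(SUP k. ennreal (?p y * indicator (Bk k) y)) = ennreal (?P y)"
    proof (cases "y \<in> B")
      case True
      then obtain k where k: "y \<in> Bk k" using un by blast
      show ?thesis
      proof (rule antisym)
        show "ennreal (?P y) \<le> (SUP k. ennreal (?p y * indicator (Bk k) y))"
          by (rule SUP_upper2[of k]) (use k True in auto)
        show "(SUP k. ennreal (?p y * indicator (Bk k) y)) \<le> ennreal (?P y)"
          by (rule SUP_least, rule ennreal_leI) (use True q in \<open>auto simp: indicator_def\<close>)
      qed
    next
      case False
      then have "y \<notin> Bk k" for k using Bk_sub by blast
      then show ?thesis using False by simp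
    qed
  qed
  finally show ?thesis .
qed

text \<open>The substitution formula is stated for vectors whose index type is well-ordered.  An arbitrary finite
index type is replaced by a copy of itself that is ordered through an injection into the natural
numbers.  Relabelling the coordinates preserves Lebesgue measure and determinants, so the formula
carries over.\<close>
typedef 'n::finite ordered_index = "UNIV :: 'n set" morphisms of_ordered to_ordered ..

lemma bij_of_ordered: "bij of_ordered"
  by (metis bijI' of_ordered_inject to_ordered_inverse UNIV_I)

instance ordered_index :: (finite) finite
proof
  show "finite (UNIV :: 'a ordered_index set)"
    using bij_betw_finite[OF bij_of_ordered] by simp
qed

definition index_rank :: "'n::finite ordered_index \<Rightarrow> nat" where
  "index_rank = (SOME f. inj f)"

lemma inj_index_rank: "inj (index_rank :: 'n::finite ordered_index \<Rightarrow> nat)"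
proof -
  obtain f :: "'n ordered_index \<Rightarrow> nat" where "inj f"
    using finite_imp_inj_to_nat_seg[of "UNIV :: 'n ordered_index set"] by auto
  then show ?thesis unfolding index_rank_def by (rule someI[of inj])
qed

instantiation ordered_index :: (finite) wellorder
begin
definition "x \<le> y \<longleftrightarrow> index_rank x \<le> index_rank y"
definition "x < y \<longleftrightarrow> index_rank x < index_rank y"
instance
proof
  fix P :: "'a ordered_index \<Rightarrow> bool" and a :: "'a ordered_index"
  assume *: "\<And>x. (\<And>y. y < x \<Longrightarrow> P y) \<Longrightarrow> P x"
  show "P a"
    by (induction a rule: measure_induct_rule[of index_rank]) (rule *, simp add: less_ordered_index_def)
qed (auto simp: less_eq_ordered_index_def less_ordered_index_def inj_eq[OF inj_index_rank])
end

definition vec_to :: "real^'n::finite \<Rightarrow> real^'n ordered_index" where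
  "vec_to x = (\<chi> i. x $ of_ordered i)"
definition vec_of :: "real^'n ordered_index \<Rightarrow> real^'n::finite" where
  "vec_of x = (\<chi> i. x $ to_ordered i)"

lemma vec_of_to [simp]: "vec_of (vec_to x) = x" "vec_to (vec_of z) = z"
  by (simp_all add: vec_of_def vec_to_def vec_eq_iff to_ordered_inverse of_ordered_inverse)

lemma linear_vec_to: "linear vec_to" and linear_vec_of: "linear vec_of"
  by (auto intro!: linearI simp: vec_to_def vec_of_def vec_eq_iff)

lemma bounded_linear_vec_to: "bounded_linear vec_to" and bounded_linear_vec_of: "bounded_linear vec_of"
  using linear_vec_to linear_vec_of by (auto simp: linear_conv_bounded_linear)

lemma vec_of_measurable: "vec_of \<in> borel_measurable borel" and vec_to_measurable: "vec_to \<in> borel_measurable borel"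
  using bounded_linear_vec_to bounded_linear_vec_of
  by (auto intro!: borel_measurable_continuous_onI linear_continuous_on)

lemma prod_Basis_cart: "(\<Prod>b\<in>Basis. x \<bullet> b) = (\<Prod>i\<in>UNIV. (x :: real^'n) $ i)"
proof -
  have 1: "(Basis :: (real^'n) set) = range (\<lambda>i. axis i 1)"
    by (auto simp: Basis_vec_def)
  have 2: "inj (\<lambda>i::'n. axis i (1::real))"
    by (auto simp: inj_on_def axis_eq_axis)
  show ?thesis unfolding 1 by (subst prod.reindex[OF 2]) (simp add: inner_axis)
qed

lemma distr_vec_of: "distr lborel borel vec_of = (lborel :: (real^'n::finite) measure)"
proof (rule lborel_eqI[symmetric])
  fix l u :: "real^'n"
  assume lu: "\<And>b. b \<in> Basis \<Longrightarrow> l \<bullet> b \<le> u \<bullet> b"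
  have lu': "l $ i \<le> u $ i" for i
    using lu[of "axis i 1"] by (simp add: inner_axis axis_in_Basis_iff)
  have lu2: "vec_to l \<bullet> b \<le> vec_to u \<bullet> b" if "b \<in> Basis" for b
    using that lu' by (auto simp: Basis_vec_def inner_axis vec_to_def)
  have "vec_of -` box l u = box (vec_to l) (vec_to u)"
  proof -
    have "(\<forall>i. l $ i < x $ to_ordered i \<and> x $ to_ordered i < u $ i) \<longleftrightarrow>
      (\<forall>j. l $ of_ordered j < x $ j \<and> x $ j < u $ of_ordered j)" for x :: "real^'n ordered_index"
      by (metis of_ordered_inverse to_ordered_inverse UNIV_I)
    then show ?thesis by (auto simp: mem_box_cart vec_of_def vec_to_def)
  qed
  then have "emeasure (distr lborel borel vec_of) (box l u) = emeasure lborel (box (vec_to l) (vec_to u))"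
    by (subst emeasure_distr) (auto simp: vec_of_measurable)
  also have "\<dots> = (\<Prod>b\<in>Basis. (vec_to u - vec_to l) \<bullet> b)"
    using lu2 by simp
  also have "\<dots> = (\<Prod>j\<in>UNIV. (u - l) $ of_ordered j)"
    unfolding prod_Basis_cart by (simp add: vec_to_def)
  also have "\<dots> = (\<Prod>i\<in>UNIV. (u - l) $ i)"
    using prod.reindex_bij_betw[OF bij_of_ordered, of "\<lambda>i. (u - l) $ i"] by simp
  finally show "emeasure (distr lborel borel vec_of) (box l u) = (\<Prod>b\<in>Basis. (u - l) \<bullet> b)"
    unfolding prod_Basis_cart .
qed simp

lemma nn_integral_vec_of:
  "h \<in> borel_measurable borel \<Longrightarrow> (\<integral>\<^sup>+x. h x \<partial>lborel) = (\<integral>\<^sup>+z. h (vec_of z) \<partial>lborel)"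
  by (subst distr_vec_of[symmetric], subst nn_integral_distr) (auto simp: vec_of_measurable)

lemma det_reindex:
  fixes A :: "real^'n::finite^'n"
  shows "det (\<chi> i j. A $ of_ordered i $ of_ordered j) = det A"
proof -
  let ?f = "map_permutation (UNIV :: 'n ordered_index set) of_ordered"
  have bij: "bij_betw ?f {p. p permutes UNIV} {p. p permutes UNIV}"
  proof -
    have "?f = (\<lambda>\<pi> x. if x \<in> UNIV then of_ordered (\<pi> (inv_into UNIV of_ordered x)) else x)"
      using bij_is_surj[OF bij_of_ordered] by (auto simp: map_permutation_def fun_eq_iff restrict_id_def)
    then show ?thesis using bij_betw_permutations[OF bij_of_ordered] by simp
  qed
  have app: "?f p (of_ordered i) = of_ordered (p i)" for p i
    by (rule map_permutation_apply) (use bij_of_ordered in \<open>auto simp: bij_def\<close>)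
  have "det A = (\<Sum>p\<in>{p. p permutes (UNIV::'n set)}. of_int (sign p) * (\<Prod>i\<in>UNIV. A $ i $ p i))"
    by (simp add: det_def)
  also have "\<dots> = (\<Sum>p\<in>{p. p permutes (UNIV::'n ordered_index set)}. of_int (sign (?f p)) * (\<Prod>i\<in>UNIV. A $ i $ ?f p i))"
    by (rule sum.reindex_bij_betw[OF bij, symmetric])
  also have "\<dots> = (\<Sum>p\<in>{p. p permutes (UNIV::'n ordered_index set)}. of_int (sign p) * (\<Prod>i\<in>UNIV. A $ of_ordered i $ of_ordered (p i)))"
  proof (intro sum.cong refl arg_cong2[where f="(*)"])
    fix p assume "p \<in> {p. p permutes (UNIV::'n ordered_index set)}"
    then show "of_int (sign (?f p)) = (of_int (sign p) :: real)"
      using sign_map_permutation[OF bij_is_inj[OF bij_of_ordered], of p] by simp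
    show "(\<Prod>i\<in>UNIV. A $ i $ ?f p i) = (\<Prod>i\<in>UNIV. A $ of_ordered i $ of_ordered (p i))"
      using prod.reindex_bij_betw[OF bij_of_ordered, of "\<lambda>i. A $ i $ ?f p i"] by (simp add: app)
  qed
  finally show ?thesis by (simp add: det_def)
qed

theorem nn_integral_image:
  fixes \<phi> :: "real^'n::finite \<Rightarrow> real^'n"
  assumes B: "B \<in> sets borel"
    and der: "\<And>y. y \<in> B \<Longrightarrow> (\<phi> has_derivative \<phi>' y) (at y)" and inj: "inj_on \<phi> B"
    and q: "\<And>x. x \<in> \<phi> ` B \<Longrightarrow> q x \<ge> 0"
    and meas: "(\<lambda>y. \<bar>det (matrix (\<phi>' y))\<bar> * q (\<phi> y) * indicator B y) \<in> borel_measurable borel"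
    and meas': "(\<lambda>x. q x * indicator (\<phi> ` B) x) \<in> borel_measurable borel"
  shows "(\<integral>\<^sup>+x. ennreal (q x * indicator (\<phi> ` B) x) \<partial>lborel)
      = (\<integral>\<^sup>+y. ennreal (\<bar>det (matrix (\<phi>' y))\<bar> * q (\<phi> y) * indicator B y) \<partial>lborel)"
proof -
  define \<psi> where "\<psi> z = vec_to (\<phi> (vec_of z))" for z
  define \<psi>' where "\<psi>' z v = vec_to (\<phi>' (vec_of z) (vec_of v))" for z v
  let ?B = "vec_of -` B"
  have img: "\<psi> ` ?B = vec_of -` (\<phi> ` B)"
  proof (intro equalityI subsetI)
    fix x assume "x \<in> vec_of -` (\<phi> ` B)"
    then obtain y where "y \<in> B" "vec_of x = \<phi> y" by auto
    then have "x = \<psi> (vec_to y)" "vec_to y \<in> ?B"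
      by (auto simp: \<psi>_def) (metis vec_of_to(2))
    then show "x \<in> \<psi> ` ?B" by blast
  qed (auto simp: \<psi>_def)
  have det: "det (matrix (\<psi>' z)) = det (matrix (\<phi>' (vec_of z)))" for z
  proof -
    have ax: "vec_of (axis j 1) = axis (of_ordered j) 1" for j
      by (auto simp: vec_of_def axis_def vec_eq_iff to_ordered_inverse of_ordered_inverse)
    have "matrix (\<psi>' z) = (\<chi> i j. matrix (\<phi>' (vec_of z)) $ of_ordered i $ of_ordered j)"
      by (simp add: matrix_def \<psi>'_def ax vec_to_def)
    then show ?thesis by (simp add: det_reindex)
  qed
  have "(\<integral>\<^sup>+x. ennreal (q x * indicator (\<phi> ` B) x) \<partial>lborel) = (\<integral>\<^sup>+z. ennreal (q (vec_of z) * indicator (\<psi> ` ?B) z) \<partial>lborel)"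
    by (subst nn_integral_vec_of) (use meas' img in \<open>auto simp: indicator_def\<close>)
  also have "\<dots> = (\<integral>\<^sup>+z. ennreal (\<bar>det (matrix (\<psi>' z))\<bar> * q (vec_of (\<psi> z)) * indicator ?B z) \<partial>lborel)"
  proof (rule nn_integral_image_wellorder[of ?B \<psi> \<psi>' "\<lambda>z. q (vec_of z)"])
    show "?B \<in> sets borel" using measurable_sets[OF vec_of_measurable B] by simp
    show "(\<psi> has_derivative \<psi>' z) (at z)" if "z \<in> ?B" for z
    proof -
      have "((\<lambda>z. \<phi> (vec_of z)) has_derivative (\<lambda>v. \<phi>' (vec_of z) (vec_of v))) (at z)"
        using diff_chain_at[OF bounded_linear_imp_has_derivative[OF bounded_linear_vec_of] der[of "vec_of z"]] that
        by (simp add: comp_def)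
      from bounded_linear.has_derivative[OF bounded_linear_vec_to this]
      show ?thesis by (simp add: \<psi>_def[abs_def] \<psi>'_def[abs_def])
    qed
    show "inj_on \<psi> ?B"
    proof (rule inj_onI)
      fix x y assume "x \<in> ?B" "y \<in> ?B" "\<psi> x = \<psi> y"
      then have "vec_of x = vec_of y"
        using inj unfolding \<psi>_def inj_on_def by (metis vec_of_to(1) vimageE)
      then show "x = y" by (metis vec_of_to(2))
    qed
    show "q (vec_of x) \<ge> 0" if "x \<in> \<psi> ` ?B" for x using that img q by auto
    have "(\<lambda>z. (\<lambda>y. \<bar>det (matrix (\<phi>' y))\<bar> * q (\<phi> y) * indicator B y) (vec_of z)) \<in> borel_measurable borel"
      by (rule measurable_compose[OF vec_of_measurable meas])
    then show "(\<lambda>y. \<bar>det (matrix (\<psi>' y))\<bar> * q (vec_of (\<psi> y)) * indicator ?B y) \<in> borel_measurable borel"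
      unfolding det by (simp add: \<psi>_def indicator_def)
    have "(\<lambda>z. (\<lambda>x. q x * indicator (\<phi> ` B) x) (vec_of z)) \<in> borel_measurable borel"
      by (rule measurable_compose[OF vec_of_measurable meas'])
    then show "(\<lambda>x. q (vec_of x) * indicator (\<psi> ` ?B) x) \<in> borel_measurable borel"
      unfolding img by (simp add: indicator_def)
  qed
  also have "\<dots> = (\<integral>\<^sup>+y. ennreal (\<bar>det (matrix (\<phi>' y))\<bar> * q (\<phi> y) * indicator B y) \<partial>lborel)"
    by (subst nn_integral_vec_of) (use meas in \<open>auto simp: indicator_def \<psi>_def det\<close>)
  finally show ?thesis .
qed

section \<open>Charts of a closed Riemannian manifold\<close>

locale closed_riemannian =
  fixes M :: "'a topology" and A :: "('a, 'n::finite) chart set"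
    and g :: "('a, 'n) chart \<Rightarrow> real ^ 'n \<Rightarrow> real ^ 'n ^ 'n"
  assumes crm: "closed_riemannian_manifold M A g"
begin

lemma atlas: "smooth_atlas M A" and haus: "Hausdorff_space M" and comp: "compact_space M"
  and metric: "riemannian_metric A g"
  using crm by (auto simp: closed_riemannian_manifold_def closed_manifold_def)

lemma is_chart: "c \<in> A \<Longrightarrow> is_chart M c"
  using atlas by (simp add: smooth_atlas_def)

lemma cover: "p \<in> topspace M \<Longrightarrow> \<exists>c\<in>A. p \<in> fst c"
  using atlas by (auto simp: smooth_atlas_def)

lemma open_dom: "c \<in> A \<Longrightarrow> openin M (fst c)"
  and open_image: "c \<in> A \<Longrightarrow> open (chart_image c)"
  and homeo: "c \<in> A \<Longrightarrow> homeomorphic_map (subtopology M (fst c)) (top_of_set (chart_image c)) (snd c)"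
  using is_chart by (auto simp: is_chart_def)

lemma dom_sub: "c \<in> A \<Longrightarrow> fst c \<subseteq> topspace M"
  using open_dom openin_subset by blast

lemma inj_chart: "c \<in> A \<Longrightarrow> inj_on (snd c) (fst c)"
  using homeomorphic_imp_injective_map[OF homeo, of c] dom_sub[of c] by (simp add: Int_absorb1)

lemma inv_left: "c \<in> A \<Longrightarrow> p \<in> fst c \<Longrightarrow> chart_inv c (snd c p) = p"
  unfolding chart_inv_def by (rule inv_into_f_f[OF inj_chart])

lemma in_image: "p \<in> fst c \<Longrightarrow> snd c p \<in> chart_image c"
  by (simp add: chart_image_def)

lemma inv_right: "y \<in> chart_image c \<Longrightarrow> snd c (chart_inv c y) = y"
  unfolding chart_inv_def chart_image_def by (rule f_inv_into_f)

lemma inv_in: "y \<in> chart_image c \<Longrightarrow> chart_inv c y \<in> fst c"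
  unfolding chart_inv_def chart_image_def by (rule inv_into_into)

lemma inv_in_top: "c \<in> A \<Longrightarrow> y \<in> chart_image c \<Longrightarrow> chart_inv c y \<in> topspace M"
  using inv_in dom_sub by blast

text \<open>Images under a chart are handled as preimages under its inverse, for which openness and measurability
are available.\<close>
lemma image_eq_vimage: "c \<in> A \<Longrightarrow> B \<subseteq> fst c \<Longrightarrow> snd c ` B = {y \<in> chart_image c. chart_inv c y \<in> B}"
proof (intro equalityI subsetI)
  fix y assume c: "c \<in> A" and B: "B \<subseteq> fst c"
  show "y \<in> {y \<in> chart_image c. chart_inv c y \<in> B}" if "y \<in> snd c ` B"
    using that B inv_left[OF c] in_image[of _ c] by auto
  show "y \<in> snd c ` B" if "y \<in> {y \<in> chart_image c. chart_inv c y \<in> B}"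
    using that inv_right[of y c] by (intro image_eqI[of _ _ "chart_inv c y"]) auto
qed

lemma open_chart_image:
  assumes c: "c \<in> A" and W: "openin M W" "W \<subseteq> fst c"
  shows "open (snd c ` W)"
proof -
  have "openin (subtopology M (fst c)) W" using W open_dom[OF c] by (simp add: openin_open_subtopology)
  then have "openin (top_of_set (chart_image c)) (snd c ` W)"
    using homeomorphic_imp_open_map[OF homeo[OF c]] by (simp add: open_map_def)
  then show ?thesis using open_image[OF c] openin_open_trans by blast
qed

lemma open_chart_inv:
  assumes c: "c \<in> A" and Q: "open Q" "Q \<subseteq> chart_image c"
  shows "openin M (chart_inv c ` Q)"
proof -
  have "continuous_map (subtopology M (fst c)) (top_of_set (chart_image c)) (snd c)"
    using homeomorphic_imp_continuous_map[OF homeo[OF c]] .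
  then have "openin (subtopology M (fst c)) {p \<in> topspace (subtopology M (fst c)). snd c p \<in> Q}"
    by (rule openin_continuous_map_preimage) (use Q open_image[OF c] openin_open_eq in blast)
  moreover have "{p \<in> topspace (subtopology M (fst c)). snd c p \<in> Q} = chart_inv c ` Q"
  proof (intro equalityI subsetI)
    fix p assume "p \<in> {p \<in> topspace (subtopology M (fst c)). snd c p \<in> Q}"
    then show "p \<in> chart_inv c ` Q"
      using inv_left[OF c, of p] by (intro image_eqI[of _ _ "snd c p"]) auto
  next
    fix p assume "p \<in> chart_inv c ` Q"
    then obtain y where y: "y \<in> Q" "p = chart_inv c y" by blast
    then have "y \<in> chart_image c" using Q(2) by blast
    then show "p \<in> {p \<in> topspace (subtopology M (fst c)). snd c p \<in> Q}"
      using y inv_right[of y c] inv_in[of y c] inv_in_top[OF c] by simp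
  qed
  ultimately show ?thesis using open_dom[OF c] by (simp add: openin_open_subtopology)
qed

lemma local_metric_chart: "c \<in> A \<Longrightarrow> local_metric (chart_image c) (g c)"
  using metric open_image unfolding riemannian_metric_def local_metric_def by blast

lemma local_metric_subset: "local_metric S G \<Longrightarrow> open T \<Longrightarrow> T \<subseteq> S \<Longrightarrow> local_metric T G"
  unfolding local_metric_def by (meson smooth_on_subset subsetD)

definition overlap :: "('a,'n) chart \<Rightarrow> ('a,'n) chart \<Rightarrow> (real^'n) set" where
  "overlap c d = snd c ` (fst c \<inter> fst d)"

lemma open_overlap: "c \<in> A \<Longrightarrow> d \<in> A \<Longrightarrow> open (overlap c d)"
  unfolding overlap_def by (rule open_chart_image) (auto intro: openin_Int open_dom)

lemma overlap_sub: "overlap c d \<subseteq> chart_image c"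
  by (auto simp: overlap_def chart_image_def)

lemma overlap_iff: "c \<in> A \<Longrightarrow> y \<in> overlap c d \<longleftrightarrow> y \<in> chart_image c \<and> chart_inv c y \<in> fst d"
  unfolding overlap_def by (subst image_eq_vimage) (auto simp: inv_in)

lemma transition_inv: "c \<in> A \<Longrightarrow> d \<in> A \<Longrightarrow> y \<in> overlap c d \<Longrightarrow> chart_inv d (transition c d y) = chart_inv c y"
  by (simp add: transition_def overlap_iff inv_left)

lemma chart_change_transition:
  assumes c: "c \<in> A" and d: "d \<in> A"
  shows "chart_change (overlap c d) (chart_image d) (g c) (g d) (transition c d)"
proof (intro chart_change.intro chart_change_axioms.intro)
  show "local_metric (overlap c d) (g c)"
    by (rule local_metric_subset[OF local_metric_chart[OF c] open_overlap[OF c d] overlap_sub])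
  show "local_metric (chart_image d) (g d)" by (rule local_metric_chart[OF d])
  show "smooth_on (overlap c d) (transition c d)"
    using atlas c d by (simp add: smooth_atlas_def overlap_def)
  show "transition c d y \<in> chart_image d" if "y \<in> overlap c d" for y
    using that c by (simp add: transition_def overlap_iff in_image)
  show "g c y = transpose (jac (transition c d) y) ** g d (transition c d y) ** jac (transition c d) y"
    if "y \<in> overlap c d" for y
    using metric c d that unfolding riemannian_metric_def overlap_def jac_def Let_def by blast
qed

definition rho :: "('a,'n) chart \<Rightarrow> real^'n \<Rightarrow> real" where "rho c y = sqrt (det (g c y))"

lemma rho_local: "c \<in> A \<Longrightarrow> local_metric.\<rho> (g c) = rho c"
  using local_metric.\<rho>_def[OF local_metric_chart, of c] by (simp add: rho_def fun_eq_iff)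

lemma rho_pos: "c \<in> A \<Longrightarrow> y \<in> chart_image c \<Longrightarrow> rho c y > 0"
  using local_metric.rho_pos[OF local_metric_chart] rho_local by metis

lemma rho_continuous: "c \<in> A \<Longrightarrow> continuous_on (chart_image c) (rho c)"
  using smooth_on_continuous[OF local_metric.smooth_rho[OF local_metric_chart]] rho_local by metis

section \<open>The Riemannian volume measure\<close>

definition borel_M :: "'a measure" where "borel_M = sigma (topspace M) {U. openin M U}"

lemma opens_Pow: "{U. openin M U} \<subseteq> Pow (topspace M)"
  using openin_subset by blast

lemma sets_borel_M: "sets borel_M = sigma_sets (topspace M) {U. openin M U}"
  unfolding borel_M_def by (rule sets_measure_of[OF opens_Pow])

lemma space_borel_M: "space borel_M = topspace M"
  unfolding borel_M_def by (rule space_measure_of[OF opens_Pow])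

lemma open_sets_borel_M: "openin M U \<Longrightarrow> U \<in> sets borel_M"
  unfolding sets_borel_M by (simp add: sigma_sets.Basic)

lemma chart_inv_measurable:
  assumes c: "c \<in> A"
  shows "chart_inv c \<in> measurable (restrict_space borel (chart_image c)) borel_M"
  unfolding borel_M_def
proof (rule measurable_measure_of[OF opens_Pow])
  have sp: "space (restrict_space borel (chart_image c)) = chart_image c" by (simp add: space_restrict_space)
  show "chart_inv c \<in> space (restrict_space borel (chart_image c)) \<rightarrow> topspace M"
    using inv_in_top[OF c] by (auto simp: sp)
  fix W assume "W \<in> {U. openin M U}"
  then have "open (snd c ` (W \<inter> fst c))"
    by (intro open_chart_image[OF c]) (auto intro: openin_Int open_dom[OF c])
  moreover have "snd c ` (W \<inter> fst c) = chart_inv c -` W \<inter> chart_image c"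
    by (subst image_eq_vimage[OF c]) (auto simp: inv_in)
  ultimately have "open (chart_inv c -` W \<inter> chart_image c)" by simp
  then show "chart_inv c -` W \<inter> space (restrict_space borel (chart_image c)) \<in> sets (restrict_space borel (chart_image c))"
    unfolding sp using open_image[OF c] by (subst sets_restrict_space_iff) auto
qed

lemma image_borel:
  assumes c: "c \<in> A" and B: "B \<in> sets borel_M" "B \<subseteq> fst c"
  shows "snd c ` B \<in> sets borel"
proof -
  have sp: "space (restrict_space borel (chart_image c)) = chart_image c" by (simp add: space_restrict_space)
  have "chart_inv c -` B \<inter> chart_image c \<in> sets (restrict_space borel (chart_image c))"
    using measurable_sets[OF chart_inv_measurable[OF c] B(1)] sp by simp
  then have "chart_inv c -` B \<inter> chart_image c \<in> sets borel"
    using open_image[OF c] by (subst (asm) sets_restrict_space_iff) auto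
  moreover have "snd c ` B = chart_inv c -` B \<inter> chart_image c"
    by (subst image_eq_vimage[OF c B(2)]) auto
  ultimately show ?thesis by simp
qed

definition vol_chart :: "('a,'n) chart \<Rightarrow> 'a set \<Rightarrow> ennreal" where
  "vol_chart c B = (\<integral>\<^sup>+ y. ennreal (sqrt (det (g c y))) * indicator (snd c ` B) y \<partial>lborel)"

text \<open>By \<open>rho_pullback\<close> the densities in two charts differ by the Jacobian determinant of the transition
map, as the substitution formula requires.\<close>
lemma vol_chart_consistent:
  assumes c: "c \<in> A" and d: "d \<in> A" and B: "B \<in> sets borel_M" "B \<subseteq> fst c" "B \<subseteq> fst d"
  shows "vol_chart c B = vol_chart d B"
proof -
  interpret T: chart_change "overlap c d" "chart_image d" "g c" "g d" "transition c d"
    by (rule chart_change_transition[OF c d])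
  let ?B = "snd c ` B" and ?\<phi> = "transition c d"
  have sub: "?B \<subseteq> overlap c d" using B by (auto simp: overlap_def)
  have img: "?\<phi> ` ?B = snd d ` B"
    using B(2) inv_left[OF c] by (force simp: transition_def image_iff)
  have eq: "\<bar>det (matrix (frechet_derivative ?\<phi> (at y)))\<bar> * rho d (?\<phi> y) = rho c y" if "y \<in> ?B" for y
    using T.rho_pullback[of y] that sub by (auto simp: rho_local c d jac_def mult.commute)
  have bc: "(\<lambda>y. indicator ?B y *\<^sub>R rho c y) \<in> borel_measurable borel"
    by (intro borel_measurable_continuous_on_indicator image_borel c B continuous_on_subset[OF rho_continuous[OF c]])
       (use sub overlap_sub in blast)
  have bd: "(\<lambda>y. indicator (snd d ` B) y *\<^sub>R rho d y) \<in> borel_measurable borel"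
    by (intro borel_measurable_continuous_on_indicator image_borel d B continuous_on_subset[OF rho_continuous[OF d]])
       (use B in \<open>auto simp: chart_image_def\<close>)
  have P: "\<bar>det (matrix (frechet_derivative ?\<phi> (at y)))\<bar> * rho d (?\<phi> y) * indicator ?B y = indicator ?B y *\<^sub>R rho c y" for y
    using eq[of y] by (cases "y \<in> ?B") auto
  have "(\<integral>\<^sup>+x. ennreal (rho d x * indicator (?\<phi> ` ?B) x) \<partial>lborel)
      = (\<integral>\<^sup>+y. ennreal (\<bar>det (matrix (frechet_derivative ?\<phi> (at y)))\<bar> * rho d (?\<phi> y) * indicator ?B y) \<partial>lborel)"
  proof (rule nn_integral_image)
    show "?B \<in> sets borel" by (rule image_borel[OF c B(1,2)])
    show "(?\<phi> has_derivative frechet_derivative ?\<phi> (at y)) (at y)" if "y \<in> ?B" for y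
      using that sub by (intro has_derivative_frechet smooth_on_differentiable[OF T.smooth_\<phi>]) auto
    show "inj_on ?\<phi> ?B"
    proof (rule inj_onI)
      fix x y assume xy: "x \<in> ?B" "y \<in> ?B" "?\<phi> x = ?\<phi> y"
      then have "chart_inv c x = chart_inv c y" using transition_inv[OF c d] sub by (metis subsetD)
      then show "x = y" using xy sub overlap_sub[of c d] by (metis inv_right subsetD)
    qed
    show "rho d x \<ge> 0" if "x \<in> ?\<phi> ` ?B" for x
      using that rho_pos[OF d] B(3) unfolding img chart_image_def by (force intro: less_imp_le)
    show "(\<lambda>y. \<bar>det (matrix (frechet_derivative ?\<phi> (at y)))\<bar> * rho d (?\<phi> y) * indicator ?B y) \<in> borel_measurable borel"
      unfolding P by (rule bc)
    show "(\<lambda>x. rho d x * indicator (?\<phi> ` ?B) x) \<in> borel_measurable borel"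
      using bd unfolding img by (simp add: mult.commute)
  qed
  then have "(\<integral>\<^sup>+x. ennreal (rho d x * indicator (snd d ` B) x) \<partial>lborel) = (\<integral>\<^sup>+y. ennreal (indicator ?B y * rho c y) \<partial>lborel)"
    unfolding P img by simp
  moreover have "ennreal (rho d x * indicator (snd d ` B) x) = ennreal (sqrt (det (g d x))) * indicator (snd d ` B) x" for x
    by (simp add: rho_def indicator_def)
  moreover have "ennreal (indicator ?B y * rho c y) = ennreal (sqrt (det (g c y))) * indicator ?B y" for y
    by (simp add: rho_def indicator_def)
  ultimately show ?thesis by (simp add: vol_chart_def)
qed

text \<open>The volume measure on the domain of a chart, transported from coordinates.  It is countably
additive as the image of a measure, and \<open>ex1_volume\<close> builds the global measure from it.\<close>
definition chart_measure :: "('a,'n) chart \<Rightarrow> 'a measure" where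
  "chart_measure c = distr (density (restrict_space lborel (chart_image c)) (\<lambda>y. ennreal (rho c y))) borel_M (chart_inv c)"

lemma rho_measurable: "c \<in> A \<Longrightarrow> rho c \<in> borel_measurable (restrict_space lborel (chart_image c))"
  using borel_measurable_continuous_on_restrict[OF rho_continuous]
  by (metis measurable_cong_sets sets_lborel sets_restrict_space_cong)

lemma chart_inv_measurable':
  "c \<in> A \<Longrightarrow> chart_inv c \<in> measurable (restrict_space lborel (chart_image c)) borel_M"
  using chart_inv_measurable by (metis measurable_cong_sets sets_lborel sets_restrict_space_cong)

lemma emeasure_chart_measure:
  assumes c: "c \<in> A" and B: "B \<in> sets borel_M"
  shows "emeasure (chart_measure c) B = vol_chart c (B \<inter> fst c)"
proof -
  let ?R = "restrict_space lborel (chart_image c)"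
  have sp: "space ?R = chart_image c" by (simp add: space_restrict_space)
  have m: "chart_inv c -` B \<inter> chart_image c \<in> sets ?R"
    using measurable_sets[OF chart_inv_measurable'[OF c] B] sp by simp
  have i: "snd c ` (B \<inter> fst c) = chart_inv c -` B \<inter> chart_image c"
    by (subst image_eq_vimage[OF c]) (auto simp: inv_in)
  have "emeasure (chart_measure c) B = emeasure (density ?R (\<lambda>y. ennreal (rho c y))) (chart_inv c -` B \<inter> chart_image c)"
    unfolding chart_measure_def using chart_inv_measurable'[OF c] B by (subst emeasure_distr) (auto simp: sp)
  also have "\<dots> = (\<integral>\<^sup>+ y. ennreal (rho c y) * indicator (chart_inv c -` B \<inter> chart_image c) y \<partial>?R)"
    using m rho_measurable[OF c] by (intro emeasure_density) auto
  also have "\<dots> = (\<integral>\<^sup>+ y. ennreal (rho c y) * indicator (chart_inv c -` B \<inter> chart_image c) y * indicator (chart_image c) y \<partial>lborel)"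
    using open_image[OF c] by (intro nn_integral_restrict_space) auto
  also have "\<dots> = vol_chart c (B \<inter> fst c)"
    unfolding vol_chart_def i by (intro nn_integral_cong) (auto simp: indicator_def rho_def)
  finally show ?thesis .
qed

text \<open>Compactness in the form in which it is used: finitely many coordinate balls whose closures still lie
in the chart images.  It yields bounds for continuous functions and the partition into cutoffs.\<close>
lemma chart_ball_cover:
  obtains F where "finite F" "\<And>c y r. (c, y, r) \<in> F \<Longrightarrow> c \<in> A \<and> r > 0 \<and> cball y r \<subseteq> chart_image c"
    "\<And>p. p \<in> topspace M \<Longrightarrow> \<exists>(c, y, r)\<in>F. p \<in> chart_inv c ` ball y r"
proof -
  let ?B = "\<lambda>(c, y, r). chart_inv c ` ball y r"
  let ?T = "{(c, y, r). c \<in> A \<and> r > 0 \<and> cball y r \<subseteq> chart_image c}"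
  have op: "openin M (?B t)" if "t \<in> ?T" for t
  proof -
    obtain c y r where t: "t = (c, y, r)" by (cases t)
    then have "c \<in> A" "ball y r \<subseteq> chart_image c" using that ball_subset_cball[of y r] by auto
    then show ?thesis using open_chart_inv[of c "ball y r"] t by simp
  qed
  have cov: "topspace M \<subseteq> \<Union>(?B ` ?T)"
  proof
    fix p assume "p \<in> topspace M"
    then obtain c where c: "c \<in> A" "p \<in> fst c" using cover by blast
    then obtain r where r: "r > 0" "cball (snd c p) r \<subseteq> chart_image c"
      using open_image[OF c(1)] in_image open_contains_cball by metis
    have "p \<in> ?B (c, snd c p, r)" using inv_left[OF c] r(1) by (auto simp: image_iff intro!: bexI[of _ "snd c p"])
    then show "p \<in> \<Union>(?B ` ?T)" using c r by blast
  qed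
  have "compactin M (topspace M)" using comp by (simp add: compact_space_def)
  then obtain \<F> where \<F>: "finite \<F>" "\<F> \<subseteq> ?B ` ?T" "topspace M \<subseteq> \<Union>\<F>"
  proof -
    have "\<forall>U\<in>?B ` ?T. openin M U" using op by blast
    then show ?thesis
      using \<open>compactin M (topspace M)\<close>[unfolded compactin_def, THEN conjunct2, rule_format, of "?B ` ?T"] cov that by blast
  qed
  obtain F where F: "finite F" "F \<subseteq> ?T" "\<F> = ?B ` F" using finite_subset_image[OF \<F>(1,2)] by blast
  show ?thesis
  proof (rule that[OF F(1)])
    show "c \<in> A \<and> r > 0 \<and> cball y r \<subseteq> chart_image c" if "(c, y, r) \<in> F" for c y r
      using F(2) that by auto
    fix p assume "p \<in> topspace M"
    then obtain t where t: "t \<in> F" "p \<in> ?B t" using \<F>(3) F(3) by blast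
    then show "\<exists>(c, y, r)\<in>F. p \<in> chart_inv c ` ball y r"
      by (intro bexI[OF _ t(1)]) (simp add: case_prod_unfold)
  qed
qed

lemma finite_chart_cover:
  obtains cs :: "('a,'n) chart list" where "set cs \<subseteq> A" "topspace M = (\<Union>c\<in>set cs. fst c)"
proof -
  obtain F where F: "finite F" "\<And>c y r. (c, y, r) \<in> F \<Longrightarrow> c \<in> A \<and> r > 0 \<and> cball y r \<subseteq> chart_image c"
    "\<And>p. p \<in> topspace M \<Longrightarrow> \<exists>(c, y, r)\<in>F. p \<in> chart_inv c ` ball y r"
    using chart_ball_cover by metis
  obtain cs where cs: "set cs = fst ` F" using finite_list[of "fst ` F"] F(1) by blast
  have "topspace M \<subseteq> (\<Union>c\<in>set cs. fst c)"
  proof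
    fix p assume "p \<in> topspace M"
    then obtain c y r where "(c, y, r) \<in> F" "p \<in> chart_inv c ` ball y r" using F(3) by fast
    then have "p \<in> fst c" "c \<in> set cs"
      using F(2)[of c y r] inv_in[of _ c] ball_subset_cball[of y r] unfolding cs by force+
    then show "p \<in> (\<Union>c\<in>set cs. fst c)" by blast
  qed
  moreover have "set cs \<subseteq> A" using F(2) cs by auto
  ultimately show ?thesis using that dom_sub by blast
qed

definition is_volume :: "'a measure \<Rightarrow> bool" where
  "is_volume \<mu> \<longleftrightarrow> space \<mu> = topspace M \<and> sets \<mu> = sigma_sets (topspace M) {U. openin M U} \<and>
     (\<forall>c\<in>A. \<forall>B\<in>sets \<mu>. B \<subseteq> fst c \<longrightarrow>
        emeasure \<mu> B = (\<integral>\<^sup>+ y. ennreal (sqrt (det (g c y))) * indicator (snd c ` B) y \<partial>lborel))"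

text \<open>Finitely many chart domains cover the manifold; removing from each the previous ones gives a finite
Borel partition \<open>D\<close>.  On each part the measure is prescribed by a chart, which shows
uniqueness, and the sum of the prescribed measures has the required values in every chart because the
prescriptions agree on overlaps.\<close>
lemma ex1_volume: "\<exists>!\<mu>. is_volume \<mu>"
proof -
  obtain cs where cs: "set cs \<subseteq> A" "topspace M = (\<Union>c\<in>set cs. fst c)" by (rule finite_chart_cover)
  define N where "N = length cs"
  define D where "D i = fst (cs ! i) - (\<Union>j<i. fst (cs ! j))" for i
  have csA: "cs ! i \<in> A" if "i < N" for i using that cs(1) by (auto simp: N_def)
  have D_sub: "D i \<subseteq> fst (cs ! i)" for i by (auto simp: D_def)
  have D_sets: "D i \<in> sets borel_M" if "i < N" for i
    unfolding D_def using that by (intro sets.Diff sets.finite_UN open_sets_borel_M open_dom csA) auto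
  have D_disj: "disjoint_family_on (\<lambda>i. B \<inter> D i) {..<N}" for B
    unfolding disjoint_family_on_def
  proof (intro ballI impI)
    fix i j assume "i \<in> {..<N}" "j \<in> {..<N}" "i \<noteq> j"
    then show "B \<inter> D i \<inter> (B \<inter> D j) = {}" by (cases "i < j") (auto simp: D_def)
  qed
  have D_un: "B = (\<Union>i<N. B \<inter> D i)" if "B \<in> sets borel_M" for B
  proof
    show "B \<subseteq> (\<Union>i<N. B \<inter> D i)"
    proof
      fix p assume p: "p \<in> B"
      then have "p \<in> topspace M" using that sets.sets_into_space space_borel_M by blast
      then have ex: "\<exists>i. i < N \<and> p \<in> fst (cs ! i)" unfolding cs(2) N_def by (metis UN_E in_set_conv_nth)
      define i where "i = (LEAST i. i < N \<and> p \<in> fst (cs ! i))"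
      have i: "i < N \<and> p \<in> fst (cs ! i)" unfolding i_def by (rule LeastI_ex[OF ex])
      have "p \<notin> fst (cs ! j)" if "j < i" for j
        using not_less_Least[of j "\<lambda>i. i < N \<and> p \<in> fst (cs ! i)"] that i unfolding i_def by auto
      then have "p \<in> D i" using i by (auto simp: D_def)
      then show "p \<in> (\<Union>i<N. B \<inter> D i)" using i p by blast
    qed
  qed auto
  have split: "emeasure \<mu> B = (\<Sum>i<N. emeasure \<mu> (B \<inter> D i))" if "sets \<mu> = sets borel_M" "B \<in> sets borel_M" for \<mu> B
  proof -
    have "(\<Sum>i<N. emeasure \<mu> (B \<inter> D i)) = emeasure \<mu> (\<Union>i<N. B \<inter> D i)"
      by (rule sum_emeasure[OF _ D_disj]) (use that D_sets in auto)
    then show ?thesis using D_un[OF that(2)] by simp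
  qed
  have vol: "is_volume \<mu> \<longleftrightarrow> space \<mu> = topspace M \<and> sets \<mu> = sets borel_M \<and>
      (\<forall>c\<in>A. \<forall>B\<in>sets borel_M. B \<subseteq> fst c \<longrightarrow> emeasure \<mu> B = vol_chart c B)" for \<mu>
    unfolding is_volume_def sets_borel_M[symmetric] vol_chart_def by auto
  define m where "m B = (\<Sum>i<N. emeasure (chart_measure (cs ! i)) (B \<inter> D i))" for B
  define \<mu> where "\<mu> = measure_of (topspace M) (sets borel_M) m"
  have cm_sets: "sets (chart_measure c) = sets borel_M" for c by (simp add: chart_measure_def)
  have sets_mu: "sets \<mu> = sets borel_M" and space_mu: "space \<mu> = topspace M"
    unfolding \<mu>_def using sets.space_closed[of borel_M] sets.sigma_sets_eq[of borel_M] space_borel_M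
    by (simp_all add: sets_measure_of space_measure_of)
  have em: "emeasure \<mu> B = m B" if "B \<in> sets borel_M" for B
    unfolding \<mu>_def
  proof (rule emeasure_measure_of_sigma[OF _ _ _ that])
    show "sigma_algebra (topspace M) (sets borel_M)"
      using sets.sigma_algebra_axioms[of borel_M] space_borel_M by simp
    show "positive (sets borel_M) m" by (simp add: positive_def m_def)
    show "countably_additive (sets borel_M) m"
    proof (rule countably_additiveI)
      fix B :: "nat \<Rightarrow> 'a set"
      assume B: "range B \<subseteq> sets borel_M" "disjoint_family B" "(\<Union>i. B i) \<in> sets borel_M"
      have "(\<Sum>n. m (B n)) = (\<Sum>i<N. \<Sum>n. emeasure (chart_measure (cs ! i)) (B n \<inter> D i))"
        unfolding m_def by (rule suminf_sum) auto
      also have "\<dots> = (\<Sum>i<N. emeasure (chart_measure (cs ! i)) ((\<Union>n. B n) \<inter> D i))"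
      proof (intro sum.cong refl)
        fix i assume i: "i \<in> {..<N}"
        have "(\<Sum>n. emeasure (chart_measure (cs ! i)) (B n \<inter> D i)) = emeasure (chart_measure (cs ! i)) (\<Union>n. B n \<inter> D i)"
          by (rule suminf_emeasure) (use B D_sets i cm_sets in \<open>auto simp: disjoint_family_on_def\<close>)
        then show "(\<Sum>n. emeasure (chart_measure (cs ! i)) (B n \<inter> D i)) = emeasure (chart_measure (cs ! i)) ((\<Union>n. B n) \<inter> D i)"
          by simp
      qed
      finally show "(\<Sum>n. m (B n)) = m (\<Union>n. B n)" by (simp add: m_def)
    qed
  qed
  have "is_volume \<mu>"
    unfolding vol
  proof (intro conjI space_mu sets_mu ballI impI)
    fix c B assume c: "c \<in> A" and B: "B \<in> sets borel_M" "B \<subseteq> fst c"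
    have BD: "B \<inter> D i \<in> sets borel_M" if "i < N" for i using B D_sets that by auto
    have "emeasure \<mu> B = (\<Sum>i<N. emeasure (chart_measure (cs ! i)) (B \<inter> D i))"
      using em[OF B(1)] by (simp add: m_def)
    also have "\<dots> = (\<Sum>i<N. emeasure (chart_measure c) (B \<inter> D i))"
    proof (intro sum.cong refl)
      fix i assume "i \<in> {..<N}"
      then have i: "i < N" by simp
      have "B \<inter> D i \<inter> fst (cs ! i) = B \<inter> D i" "B \<inter> D i \<inter> fst c = B \<inter> D i"
        using D_sub B by auto
      then show "emeasure (chart_measure (cs ! i)) (B \<inter> D i) = emeasure (chart_measure c) (B \<inter> D i)"
        using emeasure_chart_measure[OF csA[OF i] BD[OF i]] emeasure_chart_measure[OF c BD[OF i]]
          vol_chart_consistent[OF csA[OF i] c BD[OF i]] D_sub B by auto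
    qed
    also have "\<dots> = emeasure (chart_measure c) B" using split[OF cm_sets B(1)] by simp
    also have "\<dots> = vol_chart c B" using emeasure_chart_measure[OF c B(1)] B(2) by (simp add: Int_absorb2)
    finally show "emeasure \<mu> B = vol_chart c B" .
  qed
  moreover have "\<mu>' = \<mu>''" if m': "is_volume \<mu>'" and m'': "is_volume \<mu>''" for \<mu>' \<mu>''
  proof (rule measure_eqI)
    show "sets \<mu>' = sets \<mu>''" using m' m'' by (simp add: vol)
    fix B assume "B \<in> sets \<mu>'"
    then have B: "B \<in> sets borel_M" using m' by (simp add: vol)
    have "emeasure \<mu>' (B \<inter> D i) = emeasure \<mu>'' (B \<inter> D i)" if "i < N" for i
    proof -
      have "B \<inter> D i \<in> sets borel_M" "B \<inter> D i \<subseteq> fst (cs ! i)" using B D_sets that D_sub by auto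
      then show ?thesis using m' m'' csA[OF that] unfolding vol by auto
    qed
    then show "emeasure \<mu>' B = emeasure \<mu>'' B"
      using split[of \<mu>' B] split[of \<mu>'' B] m' m'' B by (simp add: vol)
  qed
  ultimately show ?thesis by blast
qed

definition vol :: "'a measure" where "vol = riemannian_volume M A g"

lemma is_volume_vol: "is_volume vol"
  unfolding vol_def riemannian_volume_def is_volume_def[symmetric] by (rule theI'[OF ex1_volume])

lemma space_vol: "space vol = topspace M" and sets_vol: "sets vol = sets borel_M"
  and emeasure_vol: "c \<in> A \<Longrightarrow> B \<in> sets borel_M \<Longrightarrow> B \<subseteq> fst c \<Longrightarrow> emeasure vol B = vol_chart c B"
  using is_volume_vol unfolding is_volume_def sets_borel_M vol_chart_def by auto

text \<open>This equation of measures reduces integrals over the manifold, of functions supported in one chart,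
to Lebesgue integrals.\<close>
lemma density_vol:
  assumes c: "c \<in> A"
  shows "density vol (\<lambda>p. ennreal (indicator (fst c) p)) = chart_measure c"
proof (rule measure_eqI)
  show "sets (density vol (\<lambda>p. ennreal (indicator (fst c) p))) = sets (chart_measure c)"
    by (simp add: sets_vol chart_measure_def)
  fix B assume "B \<in> sets (density vol (\<lambda>p. ennreal (indicator (fst c) p)))"
  then have B: "B \<in> sets borel_M" by (simp add: sets_vol)
  have U: "fst c \<in> sets vol" using open_sets_borel_M[OF open_dom[OF c]] sets_vol by simp
  have "emeasure (density vol (\<lambda>p. ennreal (indicator (fst c) p))) B = (\<integral>\<^sup>+ p. ennreal (indicator (fst c) p) * indicator B p \<partial>vol)"
    by (rule emeasure_density) (use U B sets_vol in auto)
  also have "\<dots> = (\<integral>\<^sup>+ p. indicator (B \<inter> fst c) p \<partial>vol)"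
    by (intro nn_integral_cong) (auto simp: indicator_def)
  also have "\<dots> = emeasure vol (B \<inter> fst c)" using U B sets_vol by simp
  also have "\<dots> = emeasure (chart_measure c) B"
    using emeasure_vol[OF c, of "B \<inter> fst c"] emeasure_chart_measure[OF c B] U B sets_vol by auto
  finally show "emeasure (density vol (\<lambda>p. ennreal (indicator (fst c) p))) B = emeasure (chart_measure c) B" .
qed

lemma integral_in_chart:
  assumes c: "c \<in> A" and w: "w \<in> borel_measurable vol" and supp: "\<And>p. p \<in> topspace M \<Longrightarrow> p \<notin> fst c \<Longrightarrow> w p = 0"
  shows "(\<integral>p. w p \<partial>vol) = (\<integral>y. indicator (chart_image c) y * (rho c y * w (chart_inv c y)) \<partial>lborel)"
proof -
  let ?R = "restrict_space lborel (chart_image c)"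
  have U: "fst c \<in> sets vol" using open_sets_borel_M[OF open_dom[OF c]] sets_vol by simp
  have wB: "w \<in> borel_measurable borel_M" using w measurable_cong_sets[OF sets_vol refl] by blast
  have wi: "(\<lambda>y. w (chart_inv c y)) \<in> borel_measurable ?R"
    by (rule measurable_compose[OF chart_inv_measurable'[OF c] wB])
  have sp: "space ?R = chart_image c" by (simp add: space_restrict_space)
  have "(\<integral>p. w p \<partial>vol) = (\<integral>p. indicator (fst c) p *\<^sub>R w p \<partial>vol)"
    by (rule Bochner_Integration.integral_cong) (use supp in \<open>auto simp: space_vol indicator_def\<close>)
  also have "\<dots> = (\<integral>p. w p \<partial>density vol (\<lambda>p. ennreal (indicator (fst c) p)))"
    by (rule integral_density[symmetric]) (use w U in auto)
  also have "\<dots> = (\<integral>p. w p \<partial>chart_measure c)" unfolding density_vol[OF c] ..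
  also have "\<dots> = (\<integral>y. w (chart_inv c y) \<partial>density ?R (\<lambda>y. ennreal (rho c y)))"
    unfolding chart_measure_def by (rule integral_distr) (use chart_inv_measurable'[OF c] wB in auto)
  also have "\<dots> = (\<integral>y. rho c y *\<^sub>R w (chart_inv c y) \<partial>?R)"
    by (rule integral_density[OF wi rho_measurable[OF c]])
       (use rho_pos[OF c] sp in \<open>auto intro!: AE_I2 less_imp_le\<close>)
  also have "\<dots> = (\<integral>y. indicator (chart_image c) y *\<^sub>R (rho c y *\<^sub>R w (chart_inv c y)) \<partial>lborel)"
    using open_image[OF c] by (intro integral_restrict_space) auto
  finally show ?thesis by simp
qed

end

section \<open>Cutoff functions in Euclidean space\<close>

lemma Ck_on_divide:
  fixes f h :: "'a::real_normed_vector \<Rightarrow> real"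
  assumes "open S" "Ck_on k S f" "Ck_on k S h" "\<And>x. x \<in> S \<Longrightarrow> h x \<noteq> 0"
  shows "Ck_on k S (\<lambda>x. f x / h x)"
proof -
  have "Ck_on k S (\<lambda>x. inverse (h x))"
    by (rule Ck_on_compose[where T="-{0}"]) (use assms Ck_on_inverse in auto)
  then show ?thesis using Ck_on_mult[OF assms(1,2)] by (simp add: divide_inverse)
qed

lemma Ck_on_square_pos: "Ck_on 1 UNIV (\<lambda>x::real. (max 0 x)\<^sup>2)"
proof -
  have d: "((\<lambda>x. (max 0 x)\<^sup>2) has_real_derivative 2 * max 0 x) (at x)" for x :: real
  proof (cases x "0::real" rule: linorder_cases)
    case less
    have "((\<lambda>x::real. 0) has_real_derivative 0) (at x)" by simp
    then have "((\<lambda>x. (max 0 x)\<^sup>2) has_real_derivative 0) (at x)"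
      by (rule has_field_derivative_transform_within_open[of _ _ _ "{..<0}"]) (use less in auto)
    then show ?thesis using less by simp
  next
    case equal
    have "((\<lambda>h. max 0 h) \<longlongrightarrow> max 0 0) (at (0::real))" by (intro tendsto_intros)
    moreover have "eventually (\<lambda>h. max 0 h = ((max 0 h)\<^sup>2 - (max 0 0)\<^sup>2) / (h - 0)) (at (0::real))"
      by (auto simp: eventually_at_filter max_def power2_eq_square)
    ultimately have "((\<lambda>h. ((max 0 h)\<^sup>2 - (max 0 0)\<^sup>2) / (h - 0)) \<longlongrightarrow> 0) (at (0::real))"
      by (auto elim: Lim_transform_eventually)
    then show ?thesis using equal by (simp add: has_field_derivative_iff)
  next
    case greater
    have "((\<lambda>x::real. x\<^sup>2) has_real_derivative 2 * x) (at x)" by (auto intro!: derivative_eq_intros)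
    then have "((\<lambda>x. (max 0 x)\<^sup>2) has_real_derivative 2 * x) (at x)"
      by (rule has_field_derivative_transform_within_open[of _ _ _ "{0<..}"]) (use greater in auto)
    then show ?thesis using greater by simp
  qed
  have fd: "frechet_derivative (\<lambda>x. (max 0 x)\<^sup>2) (at x) = (\<lambda>v. 2 * max 0 x * v)" for x :: real
    using d[of x] unfolding has_field_derivative_def by (rule frechet_derivative_eqI)
  have "(\<lambda>x. (max 0 x)\<^sup>2) differentiable (at x)" for x :: real
    using d[of x] unfolding has_field_derivative_def differentiable_def by blast
  moreover have "continuous_on UNIV (\<lambda>x. 2 * max 0 x * v)" for v :: real
    by (intro continuous_intros)
  ultimately show ?thesis by (simp add: fd)
qed

text \<open>A cutoff of class C^1.  Only one derivative of the cutoffs enters the divergence theorem, so the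
square of a positive part serves instead of a smooth bump function.\<close>
definition bump :: "real^'n \<Rightarrow> real \<Rightarrow> real^'n \<Rightarrow> real" where
  "bump y0 r z = (max 0 (r\<^sup>2 - (norm (z - y0))\<^sup>2))\<^sup>2"

lemma Ck_on_bump:
  fixes y0 :: "real^'n"
  shows "Ck_on 1 UNIV (bump y0 r)"
proof -
  have 1: "Ck_on 1 UNIV (\<lambda>z::real^'n. r\<^sup>2 + (-1) * (\<Sum>i\<in>UNIV. (z $ i + (- y0 $ i)) * (z $ i + (- y0 $ i))))"
    by (intro Ck_on_add Ck_on_mult Ck_on_sum Ck_on_const open_UNIV Ck_on_bounded_linear bounded_linear_vec_nth)
  have 2: "(norm (z - y0))\<^sup>2 = (\<Sum>i\<in>UNIV. (z $ i + (- y0 $ i)) * (z $ i + (- y0 $ i)))" for z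
    unfolding power2_norm_eq_inner by (simp add: inner_vec_def)
  show ?thesis
    unfolding bump_def[abs_def] 2
    by (rule Ck_on_compose[OF _ _ _ Ck_on_square_pos]) (use 1 in simp_all)
qed

lemma bump_nonneg: "bump y0 r z \<ge> 0" by (simp add: bump_def)
lemma bump_pos: "z \<in> ball y0 r \<Longrightarrow> bump y0 r z > 0"
  using power_strict_mono[of "norm (y0 - z)" r 2] by (simp add: bump_def dist_norm norm_minus_commute)
lemma bump_outside: "z \<notin> cball y0 r \<Longrightarrow> r > 0 \<Longrightarrow> bump y0 r z = 0"
  by (simp add: bump_def dist_norm norm_minus_commute power_mono)

lemma (in local_metric) loc_grad_ip_sum_left:
  assumes "y \<in> S" "\<And>j. j \<in> J \<Longrightarrow> a j differentiable (at y)"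
  shows "loc_grad_ip G (\<lambda>z. \<Sum>j\<in>J. a j z) b y = (\<Sum>j\<in>J. loc_grad_ip G (a j) b y)"
proof -
  have "loc_grad_ip G a b y = (\<Sum>i\<in>UNIV. loc_gradient G b y $ i * partial i a y)" for a
    by (subst loc_grad_ip_sym[OF assms(1)]) (simp add: loc_grad_ip_def inner_vec_def differential_def)
  moreover have "partial i (\<lambda>z. \<Sum>j\<in>J. a j z) y = (\<Sum>j\<in>J. partial i (a j) y)" for i
    by (rule partial_sum) (rule assms(2))
  ultimately show ?thesis by (simp add: sum_distrib_left) (rule sum.swap)
qed

section \<open>Functions on the manifold\<close>

context closed_riemannian
begin

definition Ck_fun :: "nat \<Rightarrow> ('a \<Rightarrow> real) \<Rightarrow> bool" where
  "Ck_fun k h \<longleftrightarrow> (\<forall>c\<in>A. Ck_on k (chart_image c) (h \<circ> chart_inv c))"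

definition smooth_fun :: "('a \<Rightarrow> real) \<Rightarrow> bool" where
  "smooth_fun h \<longleftrightarrow> (\<forall>c\<in>A. smooth_on (chart_image c) (h \<circ> chart_inv c))"

lemma smooth_fun_Ck_fun: "smooth_fun h \<Longrightarrow> Ck_fun k h"
  by (simp add: smooth_fun_def Ck_fun_def smooth_on_def)

lemma Ck_fun_le: "Ck_fun m h \<Longrightarrow> k \<le> m \<Longrightarrow> Ck_fun k h"
  unfolding Ck_fun_def using Ck_on_le by blast

lemma Ck_fun_diff: "Ck_fun 1 h \<Longrightarrow> c \<in> A \<Longrightarrow> y \<in> chart_image c \<Longrightarrow> (h \<circ> chart_inv c) differentiable (at y)"
  by (simp add: Ck_fun_def)

lemma Ck_fun_const: "Ck_fun k (\<lambda>p. r)"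
  by (simp add: Ck_fun_def comp_def Ck_on_const)
lemma Ck_fun_add: "Ck_fun k a \<Longrightarrow> Ck_fun k b \<Longrightarrow> Ck_fun k (\<lambda>p. a p + b p)"
  by (simp add: Ck_fun_def comp_def Ck_on_add open_image)
lemma Ck_fun_mult: "Ck_fun k a \<Longrightarrow> Ck_fun k b \<Longrightarrow> Ck_fun k (\<lambda>p. a p * b p)"
  by (simp add: Ck_fun_def comp_def Ck_on_mult open_image)
lemma Ck_fun_sum: "(\<And>i. i \<in> J \<Longrightarrow> Ck_fun k (a i)) \<Longrightarrow> Ck_fun k (\<lambda>p. \<Sum>i\<in>J. a i p)"
  by (simp add: Ck_fun_def comp_def Ck_on_sum open_image)
lemma Ck_fun_divide: "Ck_fun k a \<Longrightarrow> Ck_fun k b \<Longrightarrow> (\<And>p. p \<in> topspace M \<Longrightarrow> b p \<noteq> 0) \<Longrightarrow> Ck_fun k (\<lambda>p. a p / b p)"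
  by (simp add: Ck_fun_def comp_def Ck_on_divide open_image inv_in_top)
lemma Ck_fun_cong:
  assumes "\<And>p. p \<in> topspace M \<Longrightarrow> a p = b p" "Ck_fun k a" shows "Ck_fun k b"
  unfolding Ck_fun_def
proof
  fix c assume c: "c \<in> A"
  show "Ck_on k (chart_image c) (b \<circ> chart_inv c)"
    by (rule Ck_on_cong[OF open_image[OF c], of "a \<circ> chart_inv c"])
       (use assms c inv_in_top[OF c] in \<open>simp_all add: Ck_fun_def\<close>)
qed

lemma smooth_fun_const: "smooth_fun (\<lambda>p. r)"
  by (simp add: smooth_fun_def comp_def smooth_on_const)
lemma smooth_fun_add: "smooth_fun a \<Longrightarrow> smooth_fun b \<Longrightarrow> smooth_fun (\<lambda>p. a p + b p)"
  by (simp add: smooth_fun_def comp_def smooth_on_add open_image)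
lemma smooth_fun_mult: "smooth_fun a \<Longrightarrow> smooth_fun b \<Longrightarrow> smooth_fun (\<lambda>p. a p * b p)"
  by (simp add: smooth_fun_def comp_def smooth_on_mult open_image)

lemma Ck_fun_measurable:
  assumes "Ck_fun 0 h" shows "h \<in> borel_measurable vol"
proof (rule borel_measurableI)
  fix Q :: "real set" assume Q: "open Q"
  have o: "openin M (chart_inv c ` ((h \<circ> chart_inv c) -` Q \<inter> chart_image c))" if "c \<in> A" for c
  proof -
    have "continuous_on (chart_image c) (h \<circ> chart_inv c)" using assms that by (simp add: Ck_fun_def)
    then have "open ((h \<circ> chart_inv c) -` Q \<inter> chart_image c)"
      using continuous_on_open_vimage[OF open_image[OF that]] Q by blast
    then show ?thesis by (intro open_chart_inv that) auto
  qed
  have "h -` Q \<inter> topspace M = (\<Union>c\<in>A. chart_inv c ` ((h \<circ> chart_inv c) -` Q \<inter> chart_image c))"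
  proof (intro equalityI subsetI)
    fix p assume p: "p \<in> h -` Q \<inter> topspace M"
    then obtain c where c: "c \<in> A" "p \<in> fst c" using cover by blast
    then have "p = chart_inv c (snd c p)" "snd c p \<in> (h \<circ> chart_inv c) -` Q \<inter> chart_image c"
      using inv_left[OF c] in_image[OF c(2)] p by auto
    then show "p \<in> (\<Union>c\<in>A. chart_inv c ` ((h \<circ> chart_inv c) -` Q \<inter> chart_image c))" using c(1) by blast
  qed (auto simp: inv_in_top)
  moreover have "openin M (\<Union>c\<in>A. chart_inv c ` ((h \<circ> chart_inv c) -` Q \<inter> chart_image c))"
    using o by blast
  ultimately show "h -` Q \<inter> space vol \<in> sets vol"
    using open_sets_borel_M sets_vol space_vol by simp
qed

text \<open>The continuity is only known in charts, so the bound is taken over the finitely many compact products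
of the time interval with the closed balls of \<open>chart_ball_cover\<close>.\<close>
lemma bounded_on_compact_time:
  fixes \<Phi> :: "real \<Rightarrow> 'a \<Rightarrow> real"
  assumes J: "compact J" and cont: "\<And>c. c \<in> A \<Longrightarrow> continuous_on (J \<times> chart_image c) (\<lambda>(t, y). \<Phi> t (chart_inv c y))"
  obtains B where "\<And>t p. t \<in> J \<Longrightarrow> p \<in> topspace M \<Longrightarrow> \<bar>\<Phi> t p\<bar> \<le> B"
proof -
  obtain F where F: "finite F" "\<And>c y r. (c, y, r) \<in> F \<Longrightarrow> c \<in> A \<and> r > 0 \<and> cball y r \<subseteq> chart_image c"
    "\<And>p. p \<in> topspace M \<Longrightarrow> \<exists>(c, y, r)\<in>F. p \<in> chart_inv c ` ball y r"
    using chart_ball_cover by metis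
  have "\<exists>B. \<forall>t\<in>J. \<forall>z\<in>cball y r. \<bar>\<Phi> t (chart_inv c z)\<bar> \<le> B" if "(c, y, r) \<in> F" for c y r
  proof -
    have "compact ((\<lambda>(t, y). \<Phi> t (chart_inv c y)) ` (J \<times> cball y r))"
      using F(2)[OF that] J
      by (intro compact_continuous_image compact_Times compact_cball continuous_on_subset[OF cont]) auto
    then have "bounded ((\<lambda>(t, y). \<Phi> t (chart_inv c y)) ` (J \<times> cball y r))" by (rule compact_imp_bounded)
    then show ?thesis unfolding bounded_iff by force
  qed
  then have "\<forall>x\<in>F. \<exists>B. \<forall>t\<in>J. \<forall>z\<in>cball (fst (snd x)) (snd (snd x)). \<bar>\<Phi> t (chart_inv (fst x) z)\<bar> \<le> B"
    by auto
  then obtain b where b: "\<And>x t z. x \<in> F \<Longrightarrow> t \<in> J \<Longrightarrow> z \<in> cball (fst (snd x)) (snd (snd x)) \<Longrightarrow>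
      \<bar>\<Phi> t (chart_inv (fst x) z)\<bar> \<le> b x"
    by metis
  show ?thesis
  proof (rule that[of "\<Sum>x\<in>F. \<bar>b x\<bar>"])
    fix t p assume t: "t \<in> J" and p: "p \<in> topspace M"
    obtain x where x: "x \<in> F" "p \<in> chart_inv (fst x) ` ball (fst (snd x)) (snd (snd x))"
      using F(3)[OF p] by (auto simp: case_prod_unfold)
    then obtain z where z: "p = chart_inv (fst x) z" "z \<in> cball (fst (snd x)) (snd (snd x))"
      using ball_subset_cball by blast
    have "\<bar>\<Phi> t p\<bar> \<le> b x" using b[OF x(1) t z(2)] z(1) by simp
    also have "\<dots> \<le> \<bar>b x\<bar>" by simp
    also have "\<dots> \<le> (\<Sum>x\<in>F. \<bar>b x\<bar>)" using F(1) x(1) by (intro member_le_sum) auto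
    finally show "\<bar>\<Phi> t p\<bar> \<le> (\<Sum>x\<in>F. \<bar>b x\<bar>)" .
  qed
qed

lemma finite_vol: "finite_measure vol"
proof (rule finite_measureI)
  obtain F where F: "finite F" "\<And>c y r. (c, y, r) \<in> F \<Longrightarrow> c \<in> A \<and> r > 0 \<and> cball y r \<subseteq> chart_image c"
    "\<And>p. p \<in> topspace M \<Longrightarrow> \<exists>(c, y, r)\<in>F. p \<in> chart_inv c ` ball y r"
    using chart_ball_cover by metis
  let ?B = "\<lambda>x. chart_inv (fst x) ` ball (fst (snd x)) (snd (snd x))"
  have Fx: "fst x \<in> A" "ball (fst (snd x)) (snd (snd x)) \<subseteq> chart_image (fst x)"
     "cball (fst (snd x)) (snd (snd x)) \<subseteq> chart_image (fst x)" if "x \<in> F" for x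
    using F(2)[of "fst x" "fst (snd x)" "snd (snd x)"] that ball_subset_cball[of "fst (snd x)" "snd (snd x)"] by auto
  have Bs: "?B x \<in> sets vol" if "x \<in> F" for x
    using open_sets_borel_M[OF open_chart_inv[OF Fx(1)[OF that] open_ball Fx(2)[OF that]]] sets_vol by simp
  have fin: "emeasure vol (?B x) < \<infinity>" if x: "x \<in> F" for x
  proof -
    obtain c y r where xx: "x = (c, y, r)" by (cases x)
    have c: "c \<in> A" "ball y r \<subseteq> chart_image c" "cball y r \<subseteq> chart_image c" using Fx[OF x] xx by auto
    have sub: "?B x \<subseteq> fst c" using xx c(2) inv_in[of _ c] by auto
    have img: "snd c ` ?B x = ball y r" using xx c(2) inv_right[of _ c] by (auto simp: image_iff subset_iff)
    have "bounded (rho c ` cball y r)"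
      by (intro compact_imp_bounded compact_continuous_image compact_cball continuous_on_subset[OF rho_continuous[OF c(1)] c(3)])
    then obtain b where "\<forall>x\<in>rho c ` cball y r. norm x \<le> b" unfolding bounded_iff by blast
    then have b: "\<bar>rho c z\<bar> \<le> b" if "z \<in> cball y r" for z using that by simp
    have "emeasure vol (?B x) = vol_chart c (?B x)"
      using emeasure_vol[OF c(1) _ sub] Bs[OF x] sets_vol by simp
    also have "\<dots> \<le> (\<integral>\<^sup>+ z. ennreal b * indicator (cball y r) z \<partial>lborel)"
      unfolding vol_chart_def img
    proof (rule nn_integral_mono)
      fix z show "ennreal (sqrt (det (g c z))) * indicator (ball y r) z \<le> ennreal b * indicator (cball y r) z"
        using b[of z] by (auto simp: indicator_def rho_def intro!: ennreal_leI)
    qed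
    also have "\<dots> = ennreal b * emeasure lborel (cball y r)" by (simp add: nn_integral_cmult_indicator)
    also have "\<dots> < \<infinity>" using emeasure_lborel_cball_finite[of y r] by (simp add: ennreal_mult_less_top)
    finally show ?thesis .
  qed
  have "space vol \<subseteq> (\<Union>x\<in>F. ?B x)"
  proof
    fix p assume "p \<in> space vol"
    then obtain x where "x \<in> F" "p \<in> ?B x" using F(3)[of p] by (auto simp: case_prod_unfold space_vol)
    then show "p \<in> (\<Union>x\<in>F. ?B x)" by blast
  qed
  then have "emeasure vol (space vol) \<le> emeasure vol (\<Union>x\<in>F. ?B x)"
    by (rule emeasure_mono) (use Bs F(1) in auto)
  also have "\<dots> \<le> (\<Sum>x\<in>F. emeasure vol (?B x))"
    by (rule emeasure_subadditive_finite) (use Bs F(1) in auto)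
  also have "\<dots> < \<infinity>" using fin F(1) by (simp add: less_top)
  finally show "emeasure vol (space vol) \<noteq> \<infinity>" by simp
qed

lemma Ck_fun_bounded:
  assumes "Ck_fun 0 h" obtains B where "\<And>p. p \<in> topspace M \<Longrightarrow> \<bar>h p\<bar> \<le> B"
proof -
  have "continuous_on ({0} \<times> chart_image c) (\<lambda>(t::real, y). h (chart_inv c y))" if "c \<in> A" for c
  proof -
    have "continuous_on (chart_image c) (\<lambda>y. h (chart_inv c y))" using assms that by (simp add: Ck_fun_def comp_def)
    then show ?thesis
      unfolding case_prod_unfold by (rule continuous_on_compose2) (auto intro: continuous_intros)
  qed
  from bounded_on_compact_time[of "{0}" "\<lambda>t. h", OF compact_sing this]
  obtain B where "\<And>t p. t \<in> {0::real} \<Longrightarrow> p \<in> topspace M \<Longrightarrow> \<bar>h p\<bar> \<le> B" by blast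
  then show ?thesis using that[of B] by simp
qed

lemma Ck_fun_integrable:
  assumes "Ck_fun 0 h" shows "integrable vol h"
proof -
  obtain B where B: "\<And>p. p \<in> topspace M \<Longrightarrow> \<bar>h p\<bar> \<le> B" using Ck_fun_bounded[OF assms] by blast
  show ?thesis
    by (rule finite_measure.integrable_const_bound[OF finite_vol, of h B])
       (auto intro!: AE_I2 B Ck_fun_measurable[OF assms] simp: space_vol)
qed

section \<open>Differential operators on the manifold\<close>

lemma some_chart:
  assumes "p \<in> topspace M"
  defines "c \<equiv> SOME c. c \<in> A \<and> p \<in> fst c"
  shows "c \<in> A" "p \<in> fst c"
proof -
  have "\<exists>c. c \<in> A \<and> p \<in> fst c" using cover[OF assms(1)] by blast
  from someI_ex[OF this] show "c \<in> A" "p \<in> fst c" unfolding c_def by auto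
qed

text \<open>An operator whose chart expressions are related by the transition maps may be computed in any
chart around the point, instead of the one selected by the choice operator.\<close>
lemma in_chart_eq:
  assumes ind: "\<And>c d y. c \<in> A \<Longrightarrow> d \<in> A \<Longrightarrow> y \<in> overlap c d \<Longrightarrow>
      D (g c) (h \<circ> chart_inv c) y = D (g d) (h \<circ> chart_inv d) (transition c d y)"
    and c: "c \<in> A" "p \<in> fst c"
  shows "in_chart A g D h p = D (g c) (h \<circ> chart_inv c) (snd c p)"
proof -
  have p: "p \<in> topspace M" using c dom_sub by blast
  define d where "d = (SOME c. c \<in> A \<and> p \<in> fst c)"
  have d: "d \<in> A" "p \<in> fst d" using some_chart[OF p] by (auto simp: d_def)
  have "snd d p \<in> overlap d c" using c d by (auto simp: overlap_def)
  moreover have "transition d c (snd d p) = snd c p" using inv_left[OF d] by (simp add: transition_def)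
  ultimately show ?thesis using ind[OF d(1) c(1)] by (simp add: in_chart_def d_def[symmetric])
qed

text \<open>The inner product of the gradients on the manifold, in the same chart as the one that \<open>in_chart\<close>
selects.\<close>
definition grad_ip :: "('a \<Rightarrow> real) \<Rightarrow> ('a \<Rightarrow> real) \<Rightarrow> 'a \<Rightarrow> real" where
  "grad_ip a b p = (let c = (SOME c. c \<in> A \<and> p \<in> fst c) in
     loc_grad_ip (g c) (a \<circ> chart_inv c) (b \<circ> chart_inv c) (snd c p))"

lemma loc_grad_ip_transition:
  assumes c: "c \<in> A" and d: "d \<in> A" and y: "y \<in> overlap c d" and a: "Ck_fun 1 a" and b: "Ck_fun 1 b"
  shows "loc_grad_ip (g c) (a \<circ> chart_inv c) (b \<circ> chart_inv c) y
       = loc_grad_ip (g d) (a \<circ> chart_inv d) (b \<circ> chart_inv d) (transition c d y)"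
proof -
  interpret T: chart_change "overlap c d" "chart_image d" "g c" "g d" "transition c d"
    by (rule chart_change_transition[OF c d])
  have "loc_grad_ip (g c) (a \<circ> chart_inv c) (b \<circ> chart_inv c) y
      = loc_grad_ip (g c) (\<lambda>z. (a \<circ> chart_inv d) (transition c d z)) (\<lambda>z. (b \<circ> chart_inv d) (transition c d z)) y"
    by (rule T.dom.loc_grad_ip_cong[OF y]) (simp_all add: transition_inv[OF c d])
  also have "\<dots> = loc_grad_ip (g d) (a \<circ> chart_inv d) (b \<circ> chart_inv d) (transition c d y)"
    by (intro T.ip_invariant y Ck_fun_diff a b d T.maps)
  finally show ?thesis .
qed

lemma laplacian_transition:
  assumes c: "c \<in> A" and d: "d \<in> A" and y: "y \<in> overlap c d" and a: "smooth_fun a"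
  shows "loc_laplacian (g c) (a \<circ> chart_inv c) y = loc_laplacian (g d) (a \<circ> chart_inv d) (transition c d y)"
proof -
  interpret T: chart_change "overlap c d" "chart_image d" "g c" "g d" "transition c d"
    by (rule chart_change_transition[OF c d])
  have "loc_laplacian (g c) (a \<circ> chart_inv c) y
      = loc_laplacian (g c) (\<lambda>z. (a \<circ> chart_inv d) (transition c d z)) y"
    by (rule T.dom.laplacian_cong[OF y]) (simp add: transition_inv[OF c d])
  also have "\<dots> = loc_laplacian (g d) (a \<circ> chart_inv d) (transition c d y)"
    by (rule T.laplacian_invariant[OF y]) (use a d in \<open>simp add: smooth_fun_def comp_def\<close>)
  finally show ?thesis .
qed

lemma laplacian_eq:
  "smooth_fun a \<Longrightarrow> c \<in> A \<Longrightarrow> p \<in> fst c \<Longrightarrow> laplacian A g a p = loc_laplacian (g c) (a \<circ> chart_inv c) (snd c p)"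
  unfolding laplacian_def by (rule in_chart_eq) (rule laplacian_transition)

lemma grad_ip_eq:
  assumes "Ck_fun 1 a" "Ck_fun 1 b" and c: "c \<in> A" "p \<in> fst c"
  shows "grad_ip a b p = loc_grad_ip (g c) (a \<circ> chart_inv c) (b \<circ> chart_inv c) (snd c p)"
proof -
  have p: "p \<in> topspace M" using c dom_sub by blast
  define d where "d = (SOME c. c \<in> A \<and> p \<in> fst c)"
  have d: "d \<in> A" "p \<in> fst d" using some_chart[OF p] by (auto simp: d_def)
  have "snd d p \<in> overlap d c" using c d by (auto simp: overlap_def)
  moreover have "transition d c (snd d p) = snd c p" using inv_left[OF d] by (simp add: transition_def)
  ultimately show ?thesis
    using loc_grad_ip_transition[OF d(1) c(1) _ assms(1,2)] by (simp add: grad_ip_def d_def[symmetric])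
qed

lemma grad_ip_local:
  assumes "Ck_fun 1 a" "Ck_fun 1 b" "c \<in> A" "y \<in> chart_image c"
  shows "(grad_ip a b \<circ> chart_inv c) y = loc_grad_ip (g c) (a \<circ> chart_inv c) (b \<circ> chart_inv c) y"
  using grad_ip_eq[OF assms(1-3) inv_in[OF assms(4)]] inv_right[OF assms(4)] by simp

lemma laplacian_local:
  assumes "smooth_fun a" "c \<in> A" "y \<in> chart_image c"
  shows "(laplacian A g a \<circ> chart_inv c) y = loc_laplacian (g c) (a \<circ> chart_inv c) y"
  using laplacian_eq[OF assms(1,2) inv_in[OF assms(3)]] inv_right[OF assms(3)] by simp

lemma smooth_fun_grad_ip:
  assumes a: "smooth_fun a" and b: "smooth_fun b" shows "smooth_fun (grad_ip a b)"
  unfolding smooth_fun_def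
proof
  fix c assume c: "c \<in> A"
  have "smooth_on (chart_image c) (loc_grad_ip (g c) (a \<circ> chart_inv c) (b \<circ> chart_inv c))"
    using a b c by (intro local_metric.smooth_ip[OF local_metric_chart[OF c]]) (simp_all add: smooth_fun_def)
  then show "smooth_on (chart_image c) (grad_ip a b \<circ> chart_inv c)"
    by (rule smooth_on_cong[OF open_image[OF c], rotated])
       (simp add: grad_ip_local[OF smooth_fun_Ck_fun[OF a] smooth_fun_Ck_fun[OF b] c, simplified])
qed

lemma smooth_fun_laplacian: "smooth_fun a \<Longrightarrow> smooth_fun (laplacian A g a)"
proof (subst smooth_fun_def, rule ballI)
  fix c assume a: "smooth_fun a" and c: "c \<in> A"
  then have "smooth_on (chart_image c) (loc_laplacian (g c) (a \<circ> chart_inv c))"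
    by (intro local_metric.smooth_laplacian[OF local_metric_chart[OF c]]) (simp add: smooth_fun_def)
  then show "smooth_on (chart_image c) (laplacian A g a \<circ> chart_inv c)"
    by (rule smooth_on_cong[OF open_image[OF c], rotated]) (simp add: laplacian_local[OF a c, simplified])
qed

lemma Ck_fun_grad_ip: "Ck_fun 1 a \<Longrightarrow> smooth_fun b \<Longrightarrow> Ck_fun 0 (grad_ip a b)"
proof (subst Ck_fun_def, rule ballI)
  fix c assume a: "Ck_fun 1 a" and b: "smooth_fun b" and c: "c \<in> A"
  then have "continuous_on (chart_image c) (loc_grad_ip (g c) (a \<circ> chart_inv c) (b \<circ> chart_inv c))"
    by (intro local_metric.Ck_on_loc_grad_ip[OF local_metric_chart[OF c]]) (simp_all add: Ck_fun_def smooth_fun_def)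
  then have "continuous_on (chart_image c) (grad_ip a b \<circ> chart_inv c)"
    by (rule continuous_on_eq) (simp add: grad_ip_local[OF a smooth_fun_Ck_fun[OF b] c, simplified])
  then show "Ck_on 0 (chart_image c) (grad_ip a b \<circ> chart_inv c)" by simp
qed

section \<open>The divergence theorem\<close>

text \<open>The closed coordinate ball is compact, and compact sets are closed since the manifold is Hausdorff.
Therefore a cutoff extended by \<open>0\<close> vanishes on an open set around every point outside its chart.\<close>
lemma closed_chart_ball:
  assumes c: "c \<in> A" and sub: "cball y r \<subseteq> chart_image c"
  shows "closedin M (chart_inv c ` cball y r)"
proof -
  have "continuous_map (top_of_set (chart_image c)) M (chart_inv c)"
    unfolding continuous_map_def
  proof (intro conjI allI impI)
    show "chart_inv c \<in> topspace (top_of_set (chart_image c)) \<rightarrow> topspace M"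
      using inv_in_top[OF c] by auto
    fix W assume W: "openin M W"
    have "snd c ` (W \<inter> fst c) = {y \<in> topspace (top_of_set (chart_image c)). chart_inv c y \<in> W}"
      by (subst image_eq_vimage[OF c]) (use inv_in[of _ c] in auto)
    moreover have "open (snd c ` (W \<inter> fst c))"
      by (intro open_chart_image[OF c]) (auto intro: openin_Int open_dom[OF c] W)
    ultimately show "openin (top_of_set (chart_image c)) {y \<in> topspace (top_of_set (chart_image c)). chart_inv c y \<in> W}"
      by (auto simp: openin_open_eq[OF open_image[OF c]])
  qed
  moreover have "compactin (top_of_set (chart_image c)) (cball y r)"
    using sub by (simp add: compactin_subtopology)
  ultimately have "compactin M (chart_inv c ` cball y r)" by (rule image_compactin[rotated])
  then show ?thesis using haus compactin_imp_closedin by blast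
qed

definition cutoff :: "('a,'n) chart \<Rightarrow> real^'n \<Rightarrow> real \<Rightarrow> 'a \<Rightarrow> real" where
  "cutoff c y r p = (if p \<in> fst c then bump y r (snd c p) else 0)"

lemma cutoff_outside:
  assumes c: "c \<in> A" and "r > 0" "p \<notin> chart_inv c ` cball y r"
  shows "cutoff c y r p = 0"
proof (cases "p \<in> fst c")
  case True
  then have "snd c p \<notin> cball y r" using assms(3) inv_left[OF c True] by (metis image_eqI)
  then show ?thesis using bump_outside[of "snd c p" y r] assms(2) by (simp add: cutoff_def)
qed (simp add: cutoff_def)

lemma open_avoid:
  assumes c: "c \<in> A" and sub: "cball y r \<subseteq> chart_image c" and d: "d \<in> A"
  shows "open {z \<in> chart_image d. chart_inv d z \<notin> chart_inv c ` cball y r}"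
proof -
  have "openin M (fst d - chart_inv c ` cball y r)"
    using closed_chart_ball[OF c sub] open_dom[OF d] by (simp add: openin_diff)
  then have "open (snd d ` (fst d - chart_inv c ` cball y r))" by (intro open_chart_image[OF d]) auto
  also have "snd d ` (fst d - chart_inv c ` cball y r) = {z \<in> chart_image d. chart_inv d z \<notin> chart_inv c ` cball y r}"
    by (subst image_eq_vimage[OF d]) (use inv_in[of _ d] in auto)
  finally show ?thesis .
qed

text \<open>The image of any chart \<open>d\<close> is the union of the overlap with \<open>c\<close>, where the cutoff is a bump function
composed with the transition map, and an open set on which the cutoff vanishes.\<close>
lemma Ck_fun_cutoff:
  assumes c: "c \<in> A" and r: "r > 0" and sub: "cball y r \<subseteq> chart_image c"
  shows "Ck_fun 1 (cutoff c y r)"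
  unfolding Ck_fun_def
proof
  fix d assume d: "d \<in> A"
  let ?W = "{z \<in> chart_image d. chart_inv d z \<notin> chart_inv c ` cball y r}"
  interpret T: chart_change "overlap d c" "chart_image c" "g d" "g c" "transition d c"
    by (rule chart_change_transition[OF d c])
  have "Ck_on 1 (overlap d c) (\<lambda>z. bump y r (transition d c z))"
    by (rule Ck_on_compose[OF T.dom.open_S open_UNIV _ Ck_on_bump smooth_on_imp_Ck[OF T.smooth_\<phi>]]) simp
  then have "Ck_on 1 (overlap d c) (cutoff c y r \<circ> chart_inv d)"
    by (rule Ck_on_cong[OF T.dom.open_S, rotated]) (simp add: cutoff_def overlap_iff[OF d] transition_def)
  moreover have "Ck_on 1 ?W (cutoff c y r \<circ> chart_inv d)"
    by (rule Ck_on_cong[OF open_avoid[OF c sub d] _ Ck_on_const[of _ _ 0]]) (simp add: cutoff_outside[OF c r])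
  ultimately have "Ck_on 1 (overlap d c \<union> ?W) (cutoff c y r \<circ> chart_inv d)"
    by (intro Ck_on_union T.dom.open_S open_avoid[OF c sub d])
  moreover have "overlap d c \<union> ?W = chart_image d"
  proof (intro equalityI subsetI)
    fix z assume z: "z \<in> chart_image d"
    show "z \<in> overlap d c \<union> ?W"
    proof (cases "chart_inv d z \<in> chart_inv c ` cball y r")
      case True
      then have "chart_inv d z \<in> fst c" using sub inv_in[of _ c] by auto
      then show ?thesis using z by (simp add: overlap_iff[OF d])
    qed (use z in simp)
  qed (use overlap_sub[of d c] in auto)
  ultimately show "Ck_on 1 (chart_image d) (cutoff c y r \<circ> chart_inv d)" by simp
qed

lemma grad_ip_outside:
  assumes c: "c \<in> A" and sub: "cball y r \<subseteq> chart_image c" and a: "Ck_fun 1 a" and b: "Ck_fun 1 b"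
    and z: "\<And>p. p \<in> topspace M \<Longrightarrow> p \<notin> chart_inv c ` cball y r \<Longrightarrow> a p = 0"
    and p: "p \<in> topspace M" "p \<notin> chart_inv c ` cball y r"
  shows "grad_ip a b p = 0"
proof -
  obtain d where d: "d \<in> A" "p \<in> fst d" using cover[OF p(1)] by blast
  let ?W = "{z \<in> chart_image d. chart_inv d z \<notin> chart_inv c ` cball y r}"
  interpret W: local_metric ?W "g d"
    by (rule local_metric_subset[OF local_metric_chart[OF d(1)] open_avoid[OF c sub d(1)]]) auto
  have pW: "snd d p \<in> ?W" using d p inv_left[OF d] in_image[of p d] by simp
  have "loc_grad_ip (g d) (a \<circ> chart_inv d) (b \<circ> chart_inv d) (snd d p) = loc_grad_ip (g d) (\<lambda>_. 0) (b \<circ> chart_inv d) (snd d p)"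
    by (rule W.loc_grad_ip_cong[OF pW]) (use z inv_in_top[OF d(1)] in auto)
  also have "\<dots> = 0" by (simp add: loc_grad_ip_def loc_gradient_def partial_const inner_vec_def)
  finally show ?thesis using grad_ip_eq[OF a b d] by simp
qed

lemma grad_ip_sum_left:
  assumes F: "\<And>j. j \<in> J \<Longrightarrow> Ck_fun 1 (a j)" and b: "Ck_fun 1 b" and p: "p \<in> topspace M"
  shows "grad_ip (\<lambda>p. \<Sum>j\<in>J. a j p) b p = (\<Sum>j\<in>J. grad_ip (a j) b p)"
proof -
  obtain c where c: "c \<in> A" "p \<in> fst c" using cover[OF p] by blast
  interpret c: local_metric "chart_image c" "g c" by (rule local_metric_chart[OF c(1)])
  have m: "Ck_fun 1 (\<lambda>p. \<Sum>j\<in>J. a j p)" by (rule Ck_fun_sum[OF F])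
  have "loc_grad_ip (g c) (\<lambda>z. \<Sum>j\<in>J. (a j \<circ> chart_inv c) z) (b \<circ> chart_inv c) (snd c p)
      = (\<Sum>j\<in>J. loc_grad_ip (g c) (a j \<circ> chart_inv c) (b \<circ> chart_inv c) (snd c p))"
    by (rule c.loc_grad_ip_sum_left[OF in_image[OF c(2)]]) (rule Ck_fun_diff[OF F c(1) in_image[OF c(2)]])
  then show ?thesis
    using grad_ip_eq[OF m b c] grad_ip_eq[OF F b c] by (simp add: comp_def)
qed

lemma grad_ip_cong:
  assumes "Ck_fun 1 a" "Ck_fun 1 b" "\<And>p. p \<in> topspace M \<Longrightarrow> a p = a' p" "\<And>p. p \<in> topspace M \<Longrightarrow> b p = b' p" "p \<in> topspace M"
  shows "grad_ip a b p = grad_ip a' b' p"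
proof -
  obtain c where c: "c \<in> A" "p \<in> fst c" using cover[OF assms(5)] by blast
  have "Ck_fun 1 a'" "Ck_fun 1 b'" using Ck_fun_cong assms(1-4) by blast+
  then show ?thesis
    using grad_ip_eq[OF assms(1,2) c] grad_ip_eq[of a' b', OF _ _ c]
      local_metric.loc_grad_ip_cong[OF local_metric_chart[OF c(1)] in_image[OF c(2)], of "a \<circ> chart_inv c" "a' \<circ> chart_inv c" "b \<circ> chart_inv c" "b' \<circ> chart_inv c"]
      assms(3,4) inv_in_top[OF c(1)] by simp
qed

text \<open>Normalized by their sum, the cutoffs of a finite cover by coordinate balls split \<open>\<phi>\<close> into pieces
supported in one chart each, to which \<open>divergence_theorem_local\<close> applies.\<close>
theorem divergence_theorem:
  assumes \<phi>: "Ck_fun 1 \<phi>" and \<psi>: "smooth_fun \<psi>"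
  shows "(\<integral>p. \<phi> p * laplacian A g \<psi> p + grad_ip \<phi> \<psi> p \<partial>vol) = 0"
proof -
  obtain F where F: "finite F" "\<And>c y r. (c, y, r) \<in> F \<Longrightarrow> c \<in> A \<and> r > 0 \<and> cball y r \<subseteq> chart_image c"
    "\<And>p. p \<in> topspace M \<Longrightarrow> \<exists>(c, y, r)\<in>F. p \<in> chart_inv c ` ball y r"
    using chart_ball_cover by metis
  define X where "X x = cutoff (fst x) (fst (snd x)) (snd (snd x))" for x :: "('a,'n) chart \<times> (real^'n) \<times> real"
  define s where "s p = (\<Sum>x\<in>F. X x p)" for p
  have Fx: "fst x \<in> A" "snd (snd x) > 0" "cball (fst (snd x)) (snd (snd x)) \<subseteq> chart_image (fst x)" if "x \<in> F" for x
    using F(2)[of "fst x" "fst (snd x)" "snd (snd x)"] that by auto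
  have CX: "Ck_fun 1 (X x)" if "x \<in> F" for x
    unfolding X_def by (intro Ck_fun_cutoff Fx that)
  have X0: "X x p \<ge> 0" for x p by (simp add: X_def cutoff_def bump_nonneg)
  have spos: "s p > 0" if pM: "p \<in> topspace M" for p
  proof -
    obtain x where x: "x \<in> F" "p \<in> chart_inv (fst x) ` ball (fst (snd x)) (snd (snd x))"
      using F(3)[OF pM] by (auto simp: case_prod_unfold)
    then obtain z where z: "z \<in> ball (fst (snd x)) (snd (snd x))" "p = chart_inv (fst x) z" by blast
    then have zi: "z \<in> chart_image (fst x)" using Fx(3)[OF x(1)] ball_subset_cball by blast
    then have "p \<in> fst (fst x)" "snd (fst x) p = z" using z inv_in[OF zi] inv_right[OF zi] by simp_all
    then have "X x p > 0" using bump_pos[OF z(1)] by (simp add: X_def cutoff_def)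
    then show ?thesis unfolding s_def using F(1) x(1) X0 by (intro sum_pos2[of _ x]) auto
  qed
  have Cs: "Ck_fun 1 s" unfolding s_def by (intro Ck_fun_sum CX)
  define \<theta> where "\<theta> x p = X x p * \<phi> p / s p" for x p
  have C\<theta>: "Ck_fun 1 (\<theta> x)" if "x \<in> F" for x
    unfolding \<theta>_def using spos by (intro Ck_fun_divide Ck_fun_mult CX that \<phi> Cs) (auto simp: less_imp_neq[symmetric])
  have sum\<theta>: "(\<Sum>x\<in>F. \<theta> x p) = \<phi> p" if "p \<in> topspace M" for p
    using spos[OF that] by (simp add: \<theta>_def sum_divide_distrib[symmetric] sum_distrib_right[symmetric] s_def[symmetric])
  have m\<psi>: "Ck_fun k \<psi>" for k by (rule smooth_fun_Ck_fun[OF \<psi>])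
  define w where "w x p = \<theta> x p * laplacian A g \<psi> p + grad_ip (\<theta> x) \<psi> p" for x p
  have Cw: "Ck_fun 0 (w x)" if "x \<in> F" for x
    unfolding w_def
    by (intro Ck_fun_add Ck_fun_mult Ck_fun_grad_ip C\<theta> that \<psi> Ck_fun_le[OF C\<theta>[OF that]] smooth_fun_Ck_fun smooth_fun_laplacian) simp
  have zero: "(\<integral>p. w x p \<partial>vol) = 0" if x: "x \<in> F" for x
  proof -
    obtain c y r where xx: "x = (c, y, r)" by (cases x)
    have c: "c \<in> A" "r > 0" "cball y r \<subseteq> chart_image c" using Fx[OF x] xx by auto
    have out: "\<theta> x p = 0" if "p \<notin> chart_inv c ` cball y r" for p
      using cutoff_outside[OF c(1,2) that] by (simp add: \<theta>_def X_def xx)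
    have "(\<integral>p. w x p \<partial>vol) = (\<integral>z. indicator (chart_image c) z * (rho c z * w x (chart_inv c z)) \<partial>lborel)"
    proof (rule integral_in_chart[OF c(1) Ck_fun_measurable[OF Cw[OF x]]])
      fix p assume p: "p \<in> topspace M" "p \<notin> fst c"
      then have "p \<notin> chart_inv c ` cball y r" using c(3) inv_in[of _ c] by blast
      then show "w x p = 0"
        using out grad_ip_outside[OF c(1,3) C\<theta>[OF x] m\<psi> _ p(1)] by (simp add: w_def)
    qed
    also have "\<dots> = (\<integral>z. indicator (chart_image c) z * (rho c z * ((\<theta> x \<circ> chart_inv c) z * loc_laplacian (g c) (\<psi> \<circ> chart_inv c) z
        + loc_grad_ip (g c) (\<theta> x \<circ> chart_inv c) (\<psi> \<circ> chart_inv c) z)) \<partial>lborel)"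
    proof (intro Bochner_Integration.integral_cong refl)
      fix z
      show "indicator (chart_image c) z * (rho c z * w x (chart_inv c z)) =
        indicator (chart_image c) z * (rho c z * ((\<theta> x \<circ> chart_inv c) z * loc_laplacian (g c) (\<psi> \<circ> chart_inv c) z
        + loc_grad_ip (g c) (\<theta> x \<circ> chart_inv c) (\<psi> \<circ> chart_inv c) z))"
        using grad_ip_local[OF C\<theta>[OF x] m\<psi> c(1), of z] laplacian_local[OF \<psi> c(1), of z]
        by (cases "z \<in> chart_image c") (simp_all add: w_def)
    qed
    also have "\<dots> = 0"
    proof -
      interpret c: local_metric "chart_image c" "g c" by (rule local_metric_chart[OF c(1)])
      show ?thesis
        unfolding rho_local[OF c(1), symmetric]
      proof (rule c.divergence_theorem_local[of "cball y r"])
        show "Ck_on 1 (chart_image c) (\<theta> x \<circ> chart_inv c)" using C\<theta>[OF x] c(1) by (simp add: Ck_fun_def)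
        show "smooth_on (chart_image c) (\<psi> \<circ> chart_inv c)" using \<psi> c(1) by (simp add: smooth_fun_def)
        show "(\<theta> x \<circ> chart_inv c) z = 0" if "z \<in> chart_image c" "z \<notin> cball y r" for z
        proof -
          have "chart_inv c z \<notin> chart_inv c ` cball y r"
            using that c(3) inv_right[of _ c] by (metis (no_types, lifting) imageE subsetD)
          then show ?thesis using out by simp
        qed
      qed (use c(3) in auto)
    qed
    finally show ?thesis .
  qed
  have "(\<integral>p. \<phi> p * laplacian A g \<psi> p + grad_ip \<phi> \<psi> p \<partial>vol) = (\<integral>p. (\<Sum>x\<in>F. w x p) \<partial>vol)"
  proof (rule Bochner_Integration.integral_cong[OF refl])
    fix p assume "p \<in> space vol"
    then have p: "p \<in> topspace M" by (simp add: space_vol)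
    have "grad_ip \<phi> \<psi> p = grad_ip (\<lambda>p. \<Sum>x\<in>F. \<theta> x p) \<psi> p"
      by (rule grad_ip_cong[OF \<phi> m\<psi> _ _ p]) (simp_all add: sum\<theta>)
    also have "\<dots> = (\<Sum>x\<in>F. grad_ip (\<theta> x) \<psi> p)" by (rule grad_ip_sum_left[OF C\<theta> m\<psi> p])
    finally show "\<phi> p * laplacian A g \<psi> p + grad_ip \<phi> \<psi> p = (\<Sum>x\<in>F. w x p)"
      using sum\<theta>[OF p] by (simp add: w_def sum.distrib sum_distrib_right[symmetric])
  qed
  also have "\<dots> = (\<Sum>x\<in>F. \<integral>p. w x p \<partial>vol)"
    by (rule Bochner_Integration.integral_sum) (rule Ck_fun_integrable[OF Cw])
  finally show ?thesis using zero by simp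
qed

end

section \<open>The norm of a 2-tensor is nonnegative\<close>

text \<open>The trace of a product of two positive semidefinite matrices is nonnegative.  The induction removes
one index \<open>s\<close> at a time from the support of \<open>Q\<close>, as in the Cholesky decomposition: subtracting
the rank-one matrix \<open>v v\<^sup>T / Q\<^sub>s\<^sub>s\<close> of the \<open>s\<close>-th column leaves a positive semidefinite matrix.\<close>
lemma sum_psd_mult_nonneg:
  fixes Q N :: "real^'n::finite^'n"
  assumes "finite S" "transpose Q = Q" "\<And>v. 0 \<le> v \<bullet> (Q *v v)" "\<And>v. 0 \<le> v \<bullet> (N *v v)"
    "\<And>i j. i \<notin> S \<Longrightarrow> Q $ i $ j = 0"
  shows "0 \<le> (\<Sum>i\<in>UNIV. \<Sum>k\<in>UNIV. Q $ i $ k * N $ i $ k)"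
  using assms(1,2,3,5)
proof (induction S arbitrary: Q rule: finite_induct)
  case empty
  then show ?case by simp
next
  case (insert s S)
  have sym: "Q $ i $ j = Q $ j $ i" for i j
    using arg_cong[OF insert.prems(1), of "\<lambda>A. A $ j $ i"] by (simp add: transpose_def)
  have Qe: "(Q *v axis s 1) $ i = Q $ i $ s" for i by (simp add: matrix_vector_mult_basis column_def)
  have eQ: "axis s 1 \<bullet> (Q *v v) = (Q *v v) $ s" for v by (simp add: inner_axis')
  have vQe: "v \<bullet> (Q *v axis s 1) = (Q *v v) $ s" for v
  proof -
    have "v \<bullet> (Q *v axis s 1) = (\<Sum>i\<in>UNIV. v $ i * Q $ i $ s)" by (simp add: inner_vec_def Qe)
    also have "\<dots> = (\<Sum>i\<in>UNIV. Q $ s $ i * v $ i)"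
    proof (intro sum.cong refl)
      fix i show "v $ i * Q $ i $ s = Q $ s $ i * v $ i" using sym[of i s] by simp
    qed
    finally show ?thesis by (simp add: matrix_vector_mult_def)
  qed
  have exp: "(v + x *\<^sub>R axis s 1) \<bullet> (Q *v (v + x *\<^sub>R axis s 1)) = v \<bullet> (Q *v v) + 2 * x * (Q *v v) $ s + x\<^sup>2 * Q $ s $ s" for v x
    by (simp add: matrix_vector_right_distrib matrix_vector_mult_scaleR inner_add_left inner_add_right eQ vQe Qe power2_eq_square distrib_left)
  show ?case
  proof (cases "Q $ s $ s = 0")
    case True
    have "Q $ s $ j = 0" for j
    proof (rule ccontr)
      assume nz: "Q $ s $ j \<noteq> 0"
      \<comment> \<open>The quadratic form at \<open>e\<^sub>j + x e\<^sub>s\<close> is affine in \<open>x\<close>; this \<open>x\<close> makes it equal to \<open>-1\<close>.\<close>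
      define x where "x = - (Q $ j $ j + 1) / (2 * Q $ s $ j)"
      have "(axis j 1 :: real^'n) \<bullet> (Q *v axis j 1) = Q $ j $ j"
        by (simp add: inner_axis' matrix_vector_mult_basis column_def)
      moreover have "(Q *v axis j 1) $ s = Q $ s $ j" by (simp add: matrix_vector_mult_basis column_def)
      ultimately have "0 \<le> Q $ j $ j + 2 * x * Q $ s $ j"
        using insert.prems(2)[of "axis j 1 + x *\<^sub>R axis s 1"] exp[of "axis j 1" x] True by simp
      also have "2 * x * Q $ s $ j = - (Q $ j $ j + 1)" using nz by (simp add: x_def)
      finally show False by simp
    qed
    then have "Q $ i $ j = 0" if "i \<notin> S" for i j
      using that insert.prems(3)[of i j] by (cases "i = s") auto
    then show ?thesis using insert.IH insert.prems by blast
  next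
    case False
    have "0 \<le> (axis s 1 :: real^'n) \<bullet> (Q *v axis s 1)" by (rule insert.prems(2))
    then have pos: "Q $ s $ s > 0" using False by (simp add: inner_axis' Qe)
    define Q' where "Q' = (\<chi> i j. Q $ i $ j - Q $ i $ s * Q $ j $ s / Q $ s $ s)"
    define v where "v = (\<chi> i. Q $ i $ s)"
    have quad: "(\<Sum>i\<in>UNIV. \<Sum>k\<in>UNIV. v $ i * v $ k * B $ i $ k) = v \<bullet> (B *v v)" for B :: "real^'n^'n"
      by (simp add: inner_vec_def matrix_vector_mult_def sum_distrib_left mult_ac)
    have "0 \<le> (\<Sum>i\<in>UNIV. \<Sum>k\<in>UNIV. Q' $ i $ k * N $ i $ k)"
    proof (rule insert.IH)
      show "transpose Q' = Q'" unfolding vec_eq_iff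
      proof (intro allI)
        fix i j show "transpose Q' $ i $ j = Q' $ i $ j" using sym[of i j] by (simp add: transpose_def Q'_def)
      qed
      show "0 \<le> w \<bullet> (Q' *v w)" for w
      proof -
        have "Q' *v w = Q *v w - ((Q *v w) $ s / Q $ s $ s) *\<^sub>R (Q *v axis s 1)"
        proof -
          have "(\<Sum>j\<in>UNIV. Q $ i $ s * Q $ j $ s / Q $ s $ s * w $ j) = (Q *v w) $ s / Q $ s $ s * Q $ i $ s" for i
          proof -
            have "(Q *v w) $ s / Q $ s $ s * Q $ i $ s = (\<Sum>j\<in>UNIV. Q $ s $ j * w $ j / Q $ s $ s * Q $ i $ s)"
              by (simp add: matrix_vector_mult_def sum_distrib_right sum_divide_distrib)
            also have "\<dots> = (\<Sum>j\<in>UNIV. Q $ i $ s * Q $ j $ s / Q $ s $ s * w $ j)"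
            proof (intro sum.cong refl)
              fix j show "Q $ s $ j * w $ j / Q $ s $ s * Q $ i $ s = Q $ i $ s * Q $ j $ s / Q $ s $ s * w $ j"
                using sym[of s j] by simp
            qed
            finally show ?thesis by simp
          qed
          then show ?thesis
            by (simp add: vec_eq_iff Qe) (simp add: matrix_vector_mult_def Q'_def left_diff_distrib sum_subtractf)
        qed
        then have "w \<bullet> (Q' *v w) = w \<bullet> (Q *v w) - ((Q *v w) $ s)\<^sup>2 / Q $ s $ s"
          by (simp add: inner_diff_right vQe power2_eq_square)
        \<comment> \<open>The minimum of the quadratic form of \<open>Q\<close> on the line through \<open>w\<close> in the direction \<open>e\<^sub>s\<close>.\<close>
        also have "\<dots> = (w + (- (Q *v w) $ s / Q $ s $ s) *\<^sub>R axis s 1) \<bullet> (Q *v (w + (- (Q *v w) $ s / Q $ s $ s) *\<^sub>R axis s 1))"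
          unfolding exp using pos by (simp add: power2_eq_square field_simps)
        finally show ?thesis using insert.prems(2) by simp
      qed
      show "Q' $ i $ j = 0" if "i \<notin> S" for i j
        using that insert.prems(3)[of i] pos sym[of j s] by (cases "i = s") (auto simp: Q'_def)
    qed
    moreover have "(\<Sum>i\<in>UNIV. \<Sum>k\<in>UNIV. Q $ i $ k * N $ i $ k) =
      (\<Sum>i\<in>UNIV. \<Sum>k\<in>UNIV. Q' $ i $ k * N $ i $ k) + (v \<bullet> (N *v v)) / Q $ s $ s"
      unfolding quad[symmetric] sum_divide_distrib sum.distrib[symmetric]
      by (intro sum.cong refl) (simp add: Q'_def v_def field_simps)
    ultimately show ?thesis using assms(4)[of v] pos by simp
  qed
qed

context local_metric
begin

lemma inv_psd: "y \<in> S \<Longrightarrow> 0 \<le> v \<bullet> (matrix_inv (G y) *v v)"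
proof -
  assume y: "y \<in> S"
  define w where "w = matrix_inv (G y) *v v"
  have "v = G y *v w" by (simp add: w_def matrix_vector_mul_assoc inv_mult[OF y])
  then have "v \<bullet> (matrix_inv (G y) *v v) = w \<bullet> (G y *v w)"
    using w_def by (metis inner_commute)
  then show ?thesis using posG[OF y, of w] by (cases "w = 0") auto
qed

text \<open>The norm is the contraction of the inverse metric with another positive semidefinite matrix \<open>N\<close>,
whose quadratic form is that of the inverse metric at the vector \<open>w\<close>.\<close>
lemma tensor_norm2_nonneg:
  assumes y: "y \<in> S" shows "0 \<le> tensor_norm2 (G y) T"
proof -
  let ?Q = "matrix_inv (G y)"
  define N where "N = (\<chi> i k. \<Sum>j\<in>UNIV. \<Sum>l\<in>UNIV. ?Q $ j $ l * T $ i $ j * T $ k $ l)"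
  have "tensor_norm2 (G y) T = (\<Sum>i\<in>UNIV. \<Sum>k\<in>UNIV. ?Q $ i $ k * N $ i $ k)"
  proof -
    have "tensor_norm2 (G y) T = (\<Sum>i\<in>UNIV. \<Sum>k\<in>UNIV. \<Sum>j\<in>UNIV. \<Sum>l\<in>UNIV. ?Q $ i $ k * ?Q $ j $ l * T $ i $ j * T $ k $ l)"
      unfolding tensor_norm2_def by (intro sum.cong refl sum.swap)
    then show ?thesis by (simp add: N_def sum_distrib_left mult.assoc)
  qed
  moreover have "0 \<le> v \<bullet> (N *v v)" for v
  proof -
    define w where "w = (\<chi> j. \<Sum>i\<in>UNIV. T $ i $ j * v $ i)"
    have "v \<bullet> (N *v v) = (\<Sum>i\<in>UNIV. \<Sum>k\<in>UNIV. \<Sum>j\<in>UNIV. \<Sum>l\<in>UNIV. v $ i * (?Q $ j $ l * (T $ i $ j * (T $ k $ l * v $ k))))"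
      by (simp add: inner_vec_def matrix_vector_mult_def N_def sum_distrib_left sum_distrib_right mult.assoc)
    also have "\<dots> = (\<Sum>j\<in>UNIV. \<Sum>l\<in>UNIV. \<Sum>i\<in>UNIV. \<Sum>k\<in>UNIV. v $ i * (?Q $ j $ l * (T $ i $ j * (T $ k $ l * v $ k))))"
      by (rule sum_swap_pairs)
    also have "\<dots> = (\<Sum>j\<in>UNIV. \<Sum>l\<in>UNIV. (w $ j * w $ l) * ?Q $ j $ l)"
    proof (intro sum.cong refl)
      fix j l
      show "(\<Sum>i\<in>UNIV. \<Sum>k\<in>UNIV. v $ i * (?Q $ j $ l * (T $ i $ j * (T $ k $ l * v $ k)))) = (w $ j * w $ l) * ?Q $ j $ l"
        by (simp only: w_def vec_lambda_beta sum_product) (simp add: sum_distrib_left sum_distrib_right mult_ac)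
    qed
    also have "\<dots> = w \<bullet> (?Q *v w)"
      by (simp add: inner_vec_def matrix_vector_mult_def sum_distrib_left mult_ac)
    finally show ?thesis using inv_psd[OF y, of w] by simp
  qed
  ultimately show ?thesis
    using sum_psd_mult_nonneg[of UNIV ?Q N] sym_inv[OF y] inv_psd[OF y] by simp
qed

section \<open>Exponentials and time derivatives in a chart\<close>

lemma differential_exp:
  assumes y: "y \<in> S" and f: "smooth_on S f" and u: "\<And>z. z \<in> S \<Longrightarrow> u z = k * exp (- f z)"
  shows "differential u y = - u y *\<^sub>R differential f y"
proof -
  have "((\<lambda>z. k * exp (- f z)) has_derivative (\<lambda>v. k * (exp (- f y) * - frechet_derivative f (at y) v))) (at y)"
    using has_derivative_frechet[OF smooth_on_differentiable[OF f y]]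
    by (auto intro!: derivative_eq_intros)
  from partial_eqI[OF this] have "partial i (\<lambda>z. k * exp (- f z)) y = - u y * partial i f y" for i
    by (simp add: partial_def u[OF y])
  moreover have "partial i u y = partial i (\<lambda>z. k * exp (- f z)) y" for i
    by (rule partial_cong_open[OF open_S y u])
  ultimately show ?thesis by (simp add: differential_def vec_eq_iff)
qed

lemma gradient_exp:
  assumes y: "y \<in> S" and f: "smooth_on S f" and u: "\<And>z. z \<in> S \<Longrightarrow> u z = k * exp (- f z)"
  shows "loc_gradient G u y = - u y *\<^sub>R loc_gradient G f y"
proof -
  have d: "differential u y = - u y *\<^sub>R differential f y" by (rule differential_exp[OF y f u])
  show ?thesis unfolding loc_gradient_matrix d by (simp only: matrix_vector_mult_scaleR)
qed

lemma ip_exp: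
  assumes y: "y \<in> S" and f: "smooth_on S f" and u: "\<And>z. z \<in> S \<Longrightarrow> u z = k * exp (- f z)"
  shows "loc_grad_ip G u h y = - u y * loc_grad_ip G f h y"
proof -
  have d: "loc_gradient G u y = - u y *\<^sub>R loc_gradient G f y" by (rule gradient_exp[OF y f u])
  show ?thesis unfolding loc_grad_ip_def d by simp
qed

lemma laplacian_exp:
  assumes y: "y \<in> S" and f: "smooth_on S f" and us: "smooth_on S u" and u: "\<And>z. z \<in> S \<Longrightarrow> u z = k * exp (- f z)"
  shows "loc_laplacian G u y = u y * (loc_grad_ip G f f y - loc_laplacian G f y)"
proof -
  have d: "(\<lambda>z. - u z) differentiable (at y)"
    using smooth_on_differentiable[OF smooth_on_minus[OF open_S us] y] .
  have "partial i (\<lambda>z. - u z) y = - partial i u y" for i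
    using partial_eqI[OF has_derivative_minus[OF has_derivative_frechet[OF smooth_on_differentiable[OF us y]]]] by (simp add: partial_def)
  then have dv: "differential (\<lambda>z. - u z) y = u y *\<^sub>R differential f y"
    using differential_exp[of y f u k, OF y f u] by (simp add: differential_def vec_eq_iff)
  have "loc_laplacian G u y = loc_divergence G (\<lambda>z. (- u z) *\<^sub>R loc_gradient G f z) y"
    unfolding loc_laplacian_def by (rule loc_divergence_cong[OF y gradient_exp[of _ f u k, OF _ f u]])
  also have "\<dots> = - u y * loc_divergence G (loc_gradient G f) y + loc_gradient G f y \<bullet> differential (\<lambda>z. - u z) y"
    by (rule loc_divergence_scale[OF d smooth_on_differentiable[OF smooth_gradient[OF f] y]])
  finally show ?thesis unfolding dv by (simp add: loc_laplacian_def loc_grad_ip_def algebra_simps)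
qed

lemma loc_grad_ip_expand: "loc_grad_ip G a b y = (\<Sum>i\<in>UNIV. \<Sum>j\<in>UNIV. matrix_inv (G y) $ i $ j * partial j a y * partial i b y)"
  by (simp add: loc_grad_ip_def loc_gradient_def inner_vec_def differential_def sum_distrib_right)

lemma loc_grad_ip_time_derivative:
  assumes y: "y \<in> S" and d: "\<And>j. ((\<lambda>s. partial j (a s) y) has_real_derivative partial j e y) (at t)"
  shows "((\<lambda>s. loc_grad_ip G (a s) (a s) y) has_real_derivative 2 * loc_grad_ip G (a t) e y) (at t)"
proof -
  have "((\<lambda>s. loc_grad_ip G (a s) (a s) y) has_real_derivative
     (\<Sum>i\<in>UNIV. \<Sum>j\<in>UNIV. (matrix_inv (G y) $ i $ j * partial j e y) * partial i (a t) y
        + partial i e y * (matrix_inv (G y) $ i $ j * partial j (a t) y))) (at t)"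
    unfolding loc_grad_ip_expand by (intro DERIV_sum DERIV_mult DERIV_cmult d)
  also have "(\<Sum>i\<in>UNIV. \<Sum>j\<in>UNIV. (matrix_inv (G y) $ i $ j * partial j e y) * partial i (a t) y
        + partial i e y * (matrix_inv (G y) $ i $ j * partial j (a t) y)) = loc_grad_ip G e (a t) y + loc_grad_ip G (a t) e y"
    unfolding loc_grad_ip_expand sum.distrib[symmetric] by (intro sum.cong refl) (simp add: mult_ac)
  finally show ?thesis using loc_grad_ip_sym[OF y, of e] by simp
qed

end

lemma Ck_on_affine: "bounded_linear L \<Longrightarrow> open S \<Longrightarrow> Ck_on k S (\<lambda>y. a + L y)"
  by (intro Ck_on_add Ck_on_const Ck_on_bounded_linear)

lemma smooth_on_slice:
  fixes H :: "real \<times> (real^'n::finite) \<Rightarrow> real"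
  assumes "open I" "open V" "smooth_on (I \<times> V) H" "t \<in> I"
  shows "smooth_on V (\<lambda>y. H (t, y))"
proof (rule smooth_on_compose[OF assms(2) _ _ assms(3)])
  have "Ck_on k V (\<lambda>y. (t, 0) + (0, y))" for k
    by (rule Ck_on_affine[OF _ assms(2)]) (intro bounded_linear_Pair bounded_linear_zero bounded_linear_ident)
  then show "smooth_on V (Pair t)" by (simp add: smooth_on_def)
qed (use assms in \<open>auto intro: open_Times\<close>)

lemma smooth_on_fst:
  fixes h :: "real \<Rightarrow> real"
  assumes "open I" "open V" "smooth_on I h"
  shows "smooth_on (I \<times> (V :: (real^'n::finite) set)) (\<lambda>x. h (fst x))"
  by (rule smooth_on_compose[OF _ assms(1) _ assms(3)])
     (use assms in \<open>auto intro!: open_Times simp: smooth_on_def Ck_on_bounded_linear bounded_linear_fst\<close>)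

lemma smooth_on_snd:
  fixes h :: "real^'n::finite \<Rightarrow> real"
  assumes "open I" "open V" "smooth_on V h"
  shows "smooth_on ((I :: real set) \<times> V) (\<lambda>x. h (snd x))"
  by (rule smooth_on_compose[OF _ assms(2) _ assms(3)])
     (use assms in \<open>auto intro!: open_Times simp: smooth_on_def Ck_on_bounded_linear bounded_linear_snd\<close>)

lemma partial_slice:
  fixes H :: "real \<times> (real^'n::finite) \<Rightarrow> real"
  assumes "H differentiable (at (t, y))"
  shows "partial j (\<lambda>z. H (t, z)) y = frechet_derivative H (at (t, y)) (0, axis j 1)"
proof -
  have "((\<lambda>z. (t, z)) has_derivative (\<lambda>v. (0, v))) (at y)"
    by (auto intro!: derivative_eq_intros)
  from partial_eqI[OF diff_chain_at[OF this has_derivative_frechet[OF assms], unfolded comp_def]]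
  show ?thesis .
qed

lemma time_derivative_slice:
  fixes H :: "real \<times> (real^'n::finite) \<Rightarrow> real"
  assumes "H differentiable (at (t, y))"
  shows "((\<lambda>s. H (s, y)) has_real_derivative frechet_derivative H (at (t, y)) (1, 0)) (at t)"
  using has_real_derivative_along_line[of H "(0, y)" t "(1, 0)"] assms by simp

text \<open>Partial derivatives in time and space commute.  The spatial derivatives appear as derivatives of the
joint function in the directions \<open>(0, e)\<close>.\<close>
lemma time_derivative_partial:
  fixes H :: "real \<times> (real^'n::finite) \<Rightarrow> real"
  assumes I: "open I" and V: "open V" and H: "smooth_on (I \<times> V) H" and t: "t \<in> I" and y: "y \<in> V"
    and E: "\<And>z. z \<in> V \<Longrightarrow> ((\<lambda>s. H (s, z)) has_real_derivative E z) (at t)"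
  shows "((\<lambda>s. partial j (\<lambda>z. H (s, z)) y) has_real_derivative partial j E y) (at t)"
proof -
  have op: "open (I \<times> V)" using I V by (rule open_Times)
  have ty: "(t, y) \<in> I \<times> V" using t y by simp
  let ?D = "\<lambda>w x. frechet_derivative H (at x) w"
  have sD: "smooth_on (I \<times> V) (?D w)" for w by (rule smooth_on_frechet[OF H])
  have dH: "H differentiable (at (s, z))" if "s \<in> I" "z \<in> V" for s z
    using smooth_on_differentiable[OF H] that by simp
  have "((\<lambda>s. ?D (0, axis j 1) (s, y)) has_real_derivative
      frechet_derivative (?D (0, axis j 1)) (at (t, y)) (1, 0)) (at t)"
    by (rule time_derivative_slice[OF smooth_on_differentiable[OF sD ty]])
  also have "frechet_derivative (?D (0, axis j 1)) (at (t, y)) (1, 0)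
      = frechet_derivative (?D (1, 0)) (at (t, y)) (0, axis j 1)"
    by (rule frechet_derivative_symmetric[OF op smooth_on_imp_Ck[OF H] ty])
  also have "\<dots> = partial j (\<lambda>z. ?D (1, 0) (t, z)) y"
    by (rule partial_slice[OF smooth_on_differentiable[OF sD ty], symmetric])
  also have "\<dots> = partial j E y"
    by (rule partial_cong_open[OF V y]) (rule DERIV_unique[OF time_derivative_slice[OF dH[OF t]] E])
  finally have "((\<lambda>s. ?D (0, axis j 1) (s, y)) has_real_derivative partial j E y) (at t)" .
  then show ?thesis
    by (rule has_field_derivative_transform_within_open[OF _ I t]) (rule partial_slice[OF dH[OF _ y], symmetric])
qed

section \<open>Time-dependent functions on the manifold\<close>

context closed_riemannian
begin

lemma spacetime_slice:
  assumes "open I" "smooth_in_spacetime A I h" "t \<in> I" shows "smooth_fun (h t)"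
  unfolding smooth_fun_def
proof
  fix c assume c: "c \<in> A"
  have "smooth_on (I \<times> chart_image c) (\<lambda>(t, y). h t (chart_inv c y))"
    using assms(2) c by (simp add: smooth_in_spacetime_def)
  from smooth_on_slice[OF assms(1) open_image[OF c] this assms(3)]
  show "smooth_on (chart_image c) (h t \<circ> chart_inv c)" by (simp add: comp_def)
qed

lemma spacetime_mult: "open I \<Longrightarrow> smooth_in_spacetime A I a \<Longrightarrow> smooth_in_spacetime A I b \<Longrightarrow> smooth_in_spacetime A I (\<lambda>t p. a t p * b t p)"
  using smooth_on_mult[OF open_Times[OF _ open_image]]
  unfolding smooth_in_spacetime_def case_prod_unfold by blast

lemma spacetime_add: "open I \<Longrightarrow> smooth_in_spacetime A I a \<Longrightarrow> smooth_in_spacetime A I b \<Longrightarrow> smooth_in_spacetime A I (\<lambda>t p. a t p + b t p)"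
  using smooth_on_add[OF open_Times[OF _ open_image]]
  unfolding smooth_in_spacetime_def case_prod_unfold by blast

lemma spacetime_time: "open I \<Longrightarrow> smooth_on I r \<Longrightarrow> smooth_in_spacetime A I (\<lambda>t p. r t)"
  using smooth_on_fst[OF _ open_image]
  unfolding smooth_in_spacetime_def case_prod_unfold by blast

lemma spacetime_grad_ip:
  assumes I: "open I" and a: "smooth_in_spacetime A I a" and b: "smooth_in_spacetime A I b"
  shows "smooth_in_spacetime A I (\<lambda>t. grad_ip (a t) (b t))"
  unfolding smooth_in_spacetime_def
proof
  fix c assume c: "c \<in> A"
  let ?V = "chart_image c"
  interpret c: local_metric ?V "g c" by (rule local_metric_chart[OF c])
  define F where "F = (\<lambda>(t, y). a t (chart_inv c y))"
  define H where "H = (\<lambda>(t, y). b t (chart_inv c y))"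
  have F: "smooth_on (I \<times> ?V) F" and H: "smooth_on (I \<times> ?V) H"
    using a b c by (simp_all add: smooth_in_spacetime_def F_def H_def)
  have op: "open (I \<times> ?V)" by (rule open_Times[OF I open_image[OF c]])
  have "smooth_on (I \<times> ?V) (\<lambda>x. \<Sum>i\<in>UNIV. \<Sum>j\<in>UNIV. matrix_inv (g c (snd x)) $ i $ j
      * frechet_derivative F (at x) (0, axis j 1) * frechet_derivative H (at x) (0, axis i 1))"
    by (intro smooth_on_sum smooth_on_mult op smooth_on_frechet F H smooth_on_snd I open_image c c.smooth_inv)
  then show "smooth_on (I \<times> ?V) (\<lambda>(t, y). grad_ip (a t) (b t) (chart_inv c y))"
  proof (rule smooth_on_cong[OF op, rotated])
    fix x assume "x \<in> I \<times> ?V"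
    then obtain t y where x: "x = (t, y)" "t \<in> I" "y \<in> ?V" by auto
    have at: "Ck_fun 1 (a t)" and bt: "Ck_fun 1 (b t)"
      using spacetime_slice[OF I a x(2)] spacetime_slice[OF I b x(2)] smooth_fun_Ck_fun by auto
    have pF: "partial j (a t \<circ> chart_inv c) y = frechet_derivative F (at x) (0, axis j 1)" for j
      using partial_slice[OF smooth_on_differentiable[OF F, of "(t, y)"], of j] x by (simp add: F_def comp_def)
    have pH: "partial j (b t \<circ> chart_inv c) y = frechet_derivative H (at x) (0, axis j 1)" for j
      using partial_slice[OF smooth_on_differentiable[OF H, of "(t, y)"], of j] x by (simp add: H_def comp_def)
    show "(\<Sum>i\<in>UNIV. \<Sum>j\<in>UNIV. matrix_inv (g c (snd x)) $ i $ j
      * frechet_derivative F (at x) (0, axis j 1) * frechet_derivative H (at x) (0, axis i 1)) =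
      (case x of (t, y) \<Rightarrow> grad_ip (a t) (b t) (chart_inv c y))"
      using grad_ip_local[OF at bt c x(3)] by (simp add: x(1) c.loc_grad_ip_expand pF pH)
  qed
qed

text \<open>Joint continuity of the time derivative is automatic for a function that is smooth in space and
time, even when the derivative is given by another expression \<open>h'\<close>.\<close>
lemma spacetime_time_derivative_cont:
  assumes I: "open I" and h: "smooth_in_spacetime A I h" and c: "c \<in> A"
    and der: "\<And>t p. t \<in> I \<Longrightarrow> p \<in> topspace M \<Longrightarrow> ((\<lambda>s. h s p) has_real_derivative h' t p) (at t)"
  shows "continuous_on (I \<times> chart_image c) (\<lambda>(t, y). h' t (chart_inv c y))"
proof -
  define H where "H = (\<lambda>(t, y). h t (chart_inv c y))"
  have H: "smooth_on (I \<times> chart_image c) H" using h c by (simp add: smooth_in_spacetime_def H_def)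
  have "continuous_on (I \<times> chart_image c) (\<lambda>x. frechet_derivative H (at x) (1, 0))"
    by (rule smooth_on_continuous[OF smooth_on_frechet[OF H]])
  then show ?thesis
  proof (rule continuous_on_eq)
    fix x assume "x \<in> I \<times> chart_image c"
    then obtain t y where x: "x = (t, y)" "t \<in> I" "y \<in> chart_image c" by auto
    have "((\<lambda>s. h s (chart_inv c y)) has_real_derivative frechet_derivative H (at (t, y)) (1, 0)) (at t)"
      using time_derivative_slice[OF smooth_on_differentiable[OF H, of "(t, y)"]] x by (simp add: H_def)
    then show "frechet_derivative H (at x) (1, 0) = (case x of (t, y) \<Rightarrow> h' t (chart_inv c y))"
      using der[OF x(2) inv_in_top[OF c x(3)]] DERIV_unique x(1) by auto
  qed
qed

lemma integral_time_derivative: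
  assumes I: "open I" and h: "smooth_in_spacetime A I h" and t: "t \<in> I"
    and der: "\<And>t p. t \<in> I \<Longrightarrow> p \<in> topspace M \<Longrightarrow> ((\<lambda>s. h s p) has_real_derivative h' t p) (at t)"
  shows "((\<lambda>s. \<integral>p. h s p \<partial>vol) has_real_derivative (\<integral>p. h' t p \<partial>vol)) (at t)" and "Ck_fun 0 (h' t)"
proof -
  note cont = spacetime_time_derivative_cont[OF I h _ der]
  show m: "Ck_fun 0 (h' t)"
    unfolding Ck_fun_def
  proof
    fix c assume c: "c \<in> A"
    have "continuous_on (chart_image c) (\<lambda>y. (\<lambda>(t, y). h' t (chart_inv c y)) (t, y))"
      by (rule continuous_on_compose2[OF cont[OF c]]) (use t in \<open>auto intro: continuous_intros\<close>)
    then show "Ck_on 0 (chart_image c) (h' t \<circ> chart_inv c)" by (simp add: comp_def)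
  qed
  obtain e where e: "e > 0" "cball t e \<subseteq> I" using I t open_contains_cball by blast
  obtain B where B: "\<And>s p. s \<in> cball t e \<Longrightarrow> p \<in> topspace M \<Longrightarrow> \<bar>h' s p\<bar> \<le> B"
    by (rule bounded_on_compact_time[of "cball t e" h'])
       (use e(2) in \<open>auto intro!: continuous_on_subset[OF cont]\<close>)
  have sub: "ball t e \<subseteq> I" "ball t e \<subseteq> cball t e" using e(2) ball_subset_cball[of t e] by auto
  show "((\<lambda>s. \<integral>p. h s p \<partial>vol) has_real_derivative (\<integral>p. h' t p \<partial>vol)) (at t)"
  proof (rule has_real_derivative_integral[of "ball t e" t vol h h' "\<lambda>_. B"])
    show "integrable vol (h s)" if "s \<in> ball t e" for s
      using that sub by (intro Ck_fun_integrable smooth_fun_Ck_fun spacetime_slice[OF I h]) auto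
    show "integrable vol (\<lambda>_. B)" using finite_measure.integrable_const[OF finite_vol] .
    show "h' t \<in> borel_measurable vol" by (rule Ck_fun_measurable[OF m])
  qed (use e(1) sub der B space_vol in auto)
qed

section \<open>The entropy formula\<close>

text \<open>The shifted Hessian norm and the Ricci term are computed in the same chart, where the Bochner formula
trades their sum for operators that are independent of the chart.\<close>
lemma bochner_manifold:
  assumes F: "smooth_fun F" and p: "p \<in> topspace M"
  shows "hess_shift_norm2 A g s F p + ricci_grad A g F p =
    laplacian A g (grad_ip F F) p / 2 - grad_ip F (laplacian A g F) p - 2 * s * laplacian A g F p + s\<^sup>2 * real CARD('n)"
proof -
  define c where "c = (SOME c. c \<in> A \<and> p \<in> fst c)"
  have c: "c \<in> A" "p \<in> fst c" using some_chart[OF p] by (auto simp: c_def)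
  interpret c: local_metric "chart_image c" "g c" by (rule local_metric_chart[OF c(1)])
  let ?F = "F \<circ> chart_inv c" and ?y = "snd c p"
  have y: "?y \<in> chart_image c" by (rule in_image[OF c(2)])
  have sF: "smooth_on (chart_image c) ?F" using F c(1) by (simp add: smooth_fun_def)
  have mF: "Ck_fun 1 F" by (rule smooth_fun_Ck_fun[OF F])
  have 1: "laplacian A g (grad_ip F F) p = loc_laplacian (g c) (loc_grad_ip (g c) ?F ?F) ?y"
    unfolding laplacian_eq[OF smooth_fun_grad_ip[OF F F] c] by (rule c.laplacian_cong[OF y grad_ip_local[OF mF mF c(1)]])
  have 2: "grad_ip F (laplacian A g F) p = loc_grad_ip (g c) ?F (loc_laplacian (g c) ?F) ?y"
    unfolding grad_ip_eq[OF mF smooth_fun_Ck_fun[OF smooth_fun_laplacian[OF F]] c]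
    by (rule c.loc_grad_ip_cong[OF y refl laplacian_local[OF F c(1)]])
  have 3: "laplacian A g F p = loc_laplacian (g c) ?F ?y" by (rule laplacian_eq[OF F c])
  have 4: "hess_shift_norm2 A g s F p = tensor_norm2 (g c ?y) (loc_hessian (g c) ?F ?y - s *\<^sub>R g c ?y)"
    "ricci_grad A g F p = loc_gradient (g c) ?F ?y \<bullet> (loc_ricci (g c) ?y *v loc_gradient (g c) ?F ?y)"
    by (simp_all add: hess_shift_norm2_def ricci_grad_def in_chart_def c_def[symmetric])
  show ?thesis
    unfolding 1 2 3 4 c.tensor_norm2_shift[OF y sF] c.bochner[OF y sF] by simp
qed

lemma grad_norm2_eq: "p \<in> topspace M \<Longrightarrow> grad_norm2 A g F p = grad_ip F F p"
  using some_chart[of p] local_metric.vec_norm2_gradient[OF local_metric_chart in_image]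
  unfolding grad_norm2_def in_chart_def grad_ip_def Let_def by blast

lemma hess_ricci_nonneg:
  assumes "nonneg_ricci A g" and p: "p \<in> topspace M"
  shows "0 \<le> hess_shift_norm2 A g s F p + ricci_grad A g F p"
proof -
  define c where "c = (SOME c. c \<in> A \<and> p \<in> fst c)"
  have c: "c \<in> A" "p \<in> fst c" using some_chart[OF p] by (auto simp: c_def)
  interpret c: local_metric "chart_image c" "g c" by (rule local_metric_chart[OF c(1)])
  have "0 \<le> hess_shift_norm2 A g s F p"
    using c.tensor_norm2_nonneg[OF in_image[OF c(2)]]
    by (simp add: hess_shift_norm2_def in_chart_def c_def[symmetric])
  moreover have "0 \<le> ricci_grad A g F p"
    using assms(1) c(1) in_image[OF c(2)]
    by (simp add: ricci_grad_def in_chart_def c_def[symmetric] nonneg_ricci_def)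
  ultimately show ?thesis by simp
qed

lemma grad_ip_sym: "p \<in> topspace M \<Longrightarrow> grad_ip a b p = grad_ip b a p"
  using some_chart[of p] local_metric.loc_grad_ip_sym[OF local_metric_chart in_image]
  unfolding grad_ip_def Let_def by blast

lemma grad_ip_const: "grad_ip (\<lambda>_. r) b p = 0"
  by (simp add: grad_ip_def Let_def comp_def loc_grad_ip_def loc_gradient_def partial_const inner_vec_def)

context
  fixes u f :: "'a \<Rightarrow> real" and k :: real
  assumes f: "smooth_fun f" and u: "smooth_fun u" and uf: "\<And>p. p \<in> topspace M \<Longrightarrow> u p = k * exp (- f p)"
begin

lemma grad_ip_exp:
  assumes h: "smooth_fun h" and p: "p \<in> topspace M"
  shows "grad_ip u h p = - u p * grad_ip f h p"
proof -
  obtain c where c: "c \<in> A" "p \<in> fst c" using cover[OF p] by blast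
  interpret c: local_metric "chart_image c" "g c" by (rule local_metric_chart[OF c(1)])
  have "loc_grad_ip (g c) (u \<circ> chart_inv c) (h \<circ> chart_inv c) (snd c p)
     = - (u \<circ> chart_inv c) (snd c p) * loc_grad_ip (g c) (f \<circ> chart_inv c) (h \<circ> chart_inv c) (snd c p)"
    by (rule c.ip_exp[where k=k]) (use f c uf inv_in_top[OF c(1)] in_image[OF c(2)] in \<open>auto simp: smooth_fun_def\<close>)
  then show ?thesis
    using grad_ip_eq[OF smooth_fun_Ck_fun[OF u] smooth_fun_Ck_fun[OF h] c] grad_ip_eq[OF smooth_fun_Ck_fun[OF f] smooth_fun_Ck_fun[OF h] c] inv_left[OF c]
    by simp
qed

lemma laplacian_exp_manifold:
  assumes p: "p \<in> topspace M"
  shows "laplacian A g u p = u p * (grad_ip f f p - laplacian A g f p)"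
proof -
  obtain c where c: "c \<in> A" "p \<in> fst c" using cover[OF p] by blast
  interpret c: local_metric "chart_image c" "g c" by (rule local_metric_chart[OF c(1)])
  have "loc_laplacian (g c) (u \<circ> chart_inv c) (snd c p) = (u \<circ> chart_inv c) (snd c p) *
      (loc_grad_ip (g c) (f \<circ> chart_inv c) (f \<circ> chart_inv c) (snd c p) - loc_laplacian (g c) (f \<circ> chart_inv c) (snd c p))"
    by (rule c.laplacian_exp[where k=k]) (use f u c uf inv_in_top[OF c(1)] in_image[OF c(2)] in \<open>auto simp: smooth_fun_def\<close>)
  then show ?thesis
    using laplacian_eq[OF u c] laplacian_eq[OF f c] grad_ip_eq[OF smooth_fun_Ck_fun[OF f] smooth_fun_Ck_fun[OF f] c] inv_left[OF c]
    by simp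
qed

end

lemma grad_ip_time_derivative:
  assumes I: "open I" and f: "smooth_in_spacetime A I f" and t: "t \<in> I" and E: "smooth_fun E"
    and der: "\<And>p. p \<in> topspace M \<Longrightarrow> ((\<lambda>s. f s p) has_real_derivative E p) (at t)" and p: "p \<in> topspace M"
  shows "((\<lambda>s. grad_ip (f s) (f s) p) has_real_derivative 2 * grad_ip (f t) E p) (at t)"
proof -
  obtain c where c: "c \<in> A" "p \<in> fst c" using cover[OF p] by blast
  interpret c: local_metric "chart_image c" "g c" by (rule local_metric_chart[OF c(1)])
  have y: "snd c p \<in> chart_image c" by (rule in_image[OF c(2)])
  have sl: "Ck_fun 1 (f s)" if "s \<in> I" for s by (rule smooth_fun_Ck_fun[OF spacetime_slice[OF I f that]])
  have "smooth_on (I \<times> chart_image c) (\<lambda>(t, y). f t (chart_inv c y))"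
    using f c(1) by (simp add: smooth_in_spacetime_def)
  from time_derivative_partial[OF I open_image[OF c(1)] this t y, of "E \<circ> chart_inv c"]
  have "((\<lambda>s. partial j (f s \<circ> chart_inv c) (snd c p)) has_real_derivative partial j (E \<circ> chart_inv c) (snd c p)) (at t)" for j
    using der inv_in_top[OF c(1)] by (simp add: comp_def)
  from c.loc_grad_ip_time_derivative[OF y this]
  have "((\<lambda>s. loc_grad_ip (g c) (f s \<circ> chart_inv c) (f s \<circ> chart_inv c) (snd c p)) has_real_derivative 2 * grad_ip (f t) E p) (at t)"
    unfolding grad_ip_eq[OF sl[OF t] smooth_fun_Ck_fun[OF E] c] .
  then show ?thesis
    by (rule has_field_derivative_transform_within_open[OF _ I t]) (simp add: grad_ip_eq[OF sl sl c])
qed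

lemma grad_ip_right_combination:
  assumes a: "smooth_fun a" and b: "smooth_fun b" and h: "smooth_fun h" and p: "p \<in> topspace M"
  shows "grad_ip h (\<lambda>p. a p - b p - r) p = grad_ip h a p - grad_ip h b p"
proof -
  obtain c where c: "c \<in> A" "p \<in> fst c" using cover[OF p] by blast
  have d: "(a \<circ> chart_inv c) differentiable (at (snd c p))" "(b \<circ> chart_inv c) differentiable (at (snd c p))"
    using Ck_fun_diff[OF smooth_fun_Ck_fun c(1) in_image[OF c(2)]] a b by blast+
  have m: "Ck_fun 1 (\<lambda>p. a p - b p - r)"
  proof -
    have "Ck_fun 1 (\<lambda>p. a p + (-1) * b p + (- r))"
      by (intro Ck_fun_add Ck_fun_mult Ck_fun_const smooth_fun_Ck_fun a b)
    then show ?thesis by simp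
  qed
  have "partial i ((\<lambda>p. a p - b p - r) \<circ> chart_inv c) (snd c p)
      = partial i (a \<circ> chart_inv c) (snd c p) - partial i (b \<circ> chart_inv c) (snd c p)" for i
  proof -
    have "partial i (\<lambda>z. ((a \<circ> chart_inv c) z - (b \<circ> chart_inv c) z) - r) (snd c p)
      = partial i (a \<circ> chart_inv c) (snd c p) - partial i (b \<circ> chart_inv c) (snd c p) - 0"
      unfolding partial_diff[OF differentiable_diff[OF d] differentiable_const] partial_diff[OF d] partial_const ..
    then show ?thesis by (simp add: comp_def)
  qed
  then have "differential ((\<lambda>p. a p - b p - r) \<circ> chart_inv c) (snd c p) = differential (a \<circ> chart_inv c) (snd c p) - differential (b \<circ> chart_inv c) (snd c p)"
    by (simp add: differential_def vec_eq_iff)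
  then show ?thesis
    using grad_ip_eq[OF smooth_fun_Ck_fun[OF h] m c] grad_ip_eq[OF smooth_fun_Ck_fun[OF h] smooth_fun_Ck_fun[OF a] c] grad_ip_eq[OF smooth_fun_Ck_fun[OF h] smooth_fun_Ck_fun[OF b] c]
    by (simp add: loc_grad_ip_def inner_diff_right)
qed

lemma smooth_fun_diff:
  assumes "smooth_fun a" "smooth_fun b" shows "smooth_fun (\<lambda>p. a p - b p)"
  using smooth_fun_add[OF assms(1) smooth_fun_mult[OF smooth_fun_const[of "-1"] assms(2)]] by simp

text \<open>The argument described at the beginning.  In the proof \<open>R\<close> is the combination of the terms \<open>L\<close>, which has
integral \<open>0\<close>, and \<open>key\<close> is the pointwise identity.\<close>
theorem entropy_derivative:
  fixes u f :: "real \<Rightarrow> 'a \<Rightarrow> real" and \<tau> :: "real \<Rightarrow> real"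
  assumes I: "open I" and heat: "heat_solution M A g I u"
    and upos: "\<And>t p. t \<in> I \<Longrightarrow> p \<in> topspace M \<Longrightarrow> u t p > 0"
    and \<tau>pos: "\<And>t. t \<in> I \<Longrightarrow> \<tau> t > 0"
    and \<tau>: "\<And>t. t \<in> I \<Longrightarrow> (\<tau> has_real_derivative 1) (at t)"
    and uf: "\<And>t p. t \<in> I \<Longrightarrow> p \<in> topspace M \<Longrightarrow>
           u t p = exp (- f t p) / (4 * pi * \<tau> t) powr (real CARD('n) / 2)"
    and t: "t \<in> I"
  shows "((\<lambda>s. entropy_W M A g (f s) (\<tau> s)) has_real_derivative
     - (\<integral>p. 2 * \<tau> t * (hess_shift_norm2 A g (1 / (2 * \<tau> t)) (f t) p + ricci_grad A g (f t) p)
          * u t p \<partial>vol)) (at t)"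
proof -
  define n where "n = real CARD('n)"
  have us: "smooth_in_spacetime A I u"
    and ut: "\<And>t p. t \<in> I \<Longrightarrow> p \<in> topspace M \<Longrightarrow> ((\<lambda>s. u s p) has_real_derivative laplacian A g (u t) p) (at t)"
    using heat by (auto simp: heat_solution_def)
  have \<tau>s: "smooth_on I \<tau>"
  proof -
    have d: "(\<tau> has_derivative (\<lambda>v. v)) (at s)" if "s \<in> I" for s
      using \<tau>[OF that] unfolding has_field_derivative_def by (rule has_derivative_eq_rhs) (simp add: fun_eq_iff)
    have "Ck_on k I \<tau>" for k
    proof (cases k)
      case 0
      then show ?thesis using d by (auto intro!: continuous_at_imp_continuous_on has_derivative_continuous)
    next
      case (Suc m)
      have "Ck_on m I (\<lambda>s. frechet_derivative \<tau> (at s) v)" for v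
        by (rule Ck_on_cong[OF I _ Ck_on_const[of _ _ v]]) (simp add: frechet_derivative_eqI[OF d])
      then show ?thesis using d Suc by (auto simp: differentiable_def)
    qed
    then show ?thesis by (simp add: smooth_on_def)
  qed
  have fu: "f s p = - ln (u s p) - n / 2 * ln (4 * pi * \<tau> s)" if "s \<in> I" "p \<in> topspace M" for s p
    using uf[OF that] \<tau>pos[OF that(1)] by (simp add: n_def ln_div ln_powr)
  have fs: "smooth_in_spacetime A I f"
    unfolding smooth_in_spacetime_def
  proof
    fix c assume c: "c \<in> A"
    let ?V = "chart_image c"
    have op: "open (I \<times> ?V)" by (rule open_Times[OF I open_image[OF c]])
    have "smooth_on (I \<times> ?V) (\<lambda>x. u (fst x) (chart_inv c (snd x)))"
      using us c by (simp add: smooth_in_spacetime_def case_prod_unfold)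
    then have "smooth_on (I \<times> ?V) (\<lambda>x. - ln (u (fst x) (chart_inv c (snd x))) - n / 2 * ln (4 * pi * \<tau> (fst x)))"
      using upos inv_in_top[OF c] \<tau>pos
      by (intro smooth_on_diff smooth_on_minus smooth_on_mult smooth_on_ln smooth_on_const op
           smooth_on_fst[OF I open_image[OF c] \<tau>s]) auto
    then show "smooth_on (I \<times> ?V) (\<lambda>(t, y). f t (chart_inv c y))"
      by (rule smooth_on_cong[OF op, rotated]) (use fu inv_in_top[OF c] in auto)
  qed
  have fm: "smooth_fun (f s)" and um: "smooth_fun (u s)" if "s \<in> I" for s
    using spacetime_slice[OF I fs that] spacetime_slice[OF I us that] .
  define h where "h s = grad_ip (f s) (f s)" for s
  have hm: "smooth_fun (h s)" if "s \<in> I" for s unfolding h_def by (intro smooth_fun_grad_ip fm that)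
  have uk: "u s p = (1 / (4 * pi * \<tau> s) powr (n / 2)) * exp (- f s p)" if "s \<in> I" "p \<in> topspace M" for s p
    using uf[OF that] by (simp add: n_def)
  have lap_u: "laplacian A g (u s) p = u s p * (h s p - laplacian A g (f s) p)" if "s \<in> I" "p \<in> topspace M" for s p
    unfolding h_def by (rule laplacian_exp_manifold[OF fm um uk]) (use that in auto)
  have grad_ip_u: "grad_ip (u s) w p = - u s p * grad_ip (f s) w p" if "s \<in> I" "p \<in> topspace M" "smooth_fun w" for s p w
    by (rule grad_ip_exp[OF fm um uk]) (use that in auto)
  define E where "E s p = laplacian A g (f s) p - h s p - n / (2 * \<tau> s)" for s p
  have Em: "smooth_fun (E s)" if "s \<in> I" for s
    unfolding E_def by (intro smooth_fun_diff smooth_fun_laplacian smooth_fun_const fm hm that)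
  have ft: "((\<lambda>r. f r p) has_real_derivative E s p) (at s)" if s: "s \<in> I" and p: "p \<in> topspace M" for s p
  proof -
    have "((\<lambda>r. - ln (u r p) - n / 2 * ln (4 * pi * \<tau> r)) has_real_derivative E s p) (at s)"
      using upos[OF s p] \<tau>pos[OF s]
      by (auto intro!: derivative_eq_intros ut[OF s p] \<tau>[OF s] simp: E_def lap_u[OF s p] field_simps)
    then show ?thesis
      by (rule has_field_derivative_transform_within_open[OF _ I s]) (simp add: fu p)
  qed
  define \<Phi> where "\<Phi> s p = (\<tau> s * h s p + f s p - n) * u s p" for s p
  define \<Phi>' where "\<Phi>' s p = (h s p + \<tau> s * (2 * grad_ip (f s) (E s) p) + E s p) * u s p
      + (\<tau> s * h s p + f s p - n) * laplacian A g (u s) p" for s p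
  have \<Phi>s: "smooth_in_spacetime A I \<Phi>"
  proof -
    have "smooth_in_spacetime A I (\<lambda>s p. (\<tau> s * grad_ip (f s) (f s) p + f s p + (- n)) * u s p)"
      by (intro spacetime_mult spacetime_add spacetime_grad_ip spacetime_time[OF I \<tau>s] spacetime_time[OF I smooth_on_const] I fs us)
    then show ?thesis by (simp add: \<Phi>_def[abs_def] h_def)
  qed
  have \<Phi>t: "((\<lambda>r. \<Phi> r p) has_real_derivative \<Phi>' s p) (at s)" if s: "s \<in> I" and p: "p \<in> topspace M" for s p
  proof -
    have ht: "((\<lambda>r. h r p) has_real_derivative 2 * grad_ip (f s) (E s) p) (at s)"
      unfolding h_def by (rule grad_ip_time_derivative[OF I fs s Em[OF s] ft[OF s] p])
    show ?thesis
      unfolding \<Phi>_def \<Phi>'_def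
      by (auto intro!: derivative_eq_intros \<tau>[OF s] ht ft[OF s p] ut[OF s p])
  qed
  have D: "((\<lambda>s. \<integral>p. \<Phi> s p \<partial>vol) has_real_derivative (\<integral>p. \<Phi>' t p \<partial>vol)) (at t)" "Ck_fun 0 (\<Phi>' t)"
    using integral_time_derivative[of I \<Phi> t \<Phi>', OF I \<Phi>s t] \<Phi>t by blast+
  have W: "entropy_W M A g (f s) (\<tau> s) = (\<integral>p. \<Phi> s p \<partial>vol)" if "s \<in> I" for s
    unfolding entropy_W_def vol_def[symmetric]
    by (rule Bochner_Integration.integral_cong[OF refl])
       (simp add: space_vol grad_norm2_eq \<Phi>_def h_def n_def uf[OF that])
  define L where "L a b p = a p * laplacian A g b p + grad_ip a b p" for a b p
  have Lc: "Ck_fun 0 (L a b)" if "smooth_fun a" "smooth_fun b" for a b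
    unfolding L_def by (intro Ck_fun_add Ck_fun_mult smooth_fun_Ck_fun smooth_fun_laplacian smooth_fun_grad_ip that)
  have Li: "integrable vol (L a b)" if "smooth_fun a" "smooth_fun b" for a b
    by (rule Ck_fun_integrable[OF Lc[OF that]])
  have L0: "(\<integral>p. L a b p \<partial>vol) = 0" if "smooth_fun a" "smooth_fun b" for a b
    unfolding L_def by (rule divergence_theorem[OF smooth_fun_Ck_fun[OF that(1)] that(2)])
  let ?f = "f t" and ?u = "u t" and ?h = "h t" and ?\<tau> = "\<tau> t" and ?one = "\<lambda>_::'a. 1::real"
  note sm = fm[OF t] um[OF t] hm[OF t] smooth_fun_const[of 1]
  define R where "R p = ?\<tau> * L ?h ?u p + ?\<tau> * L ?u ?h p + L ?f ?u p - L ?u ?f p - n * L ?one ?u p" for p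
  have Ri: "integrable vol R" "(\<integral>p. R p \<partial>vol) = 0"
    unfolding R_def using Li L0 sm by simp_all
  let ?T = "\<lambda>p. 2 * ?\<tau> * (hess_shift_norm2 A g (1 / (2 * ?\<tau>)) ?f p + ricci_grad A g ?f p) * ?u p"
  have key: "?T p = R p - \<Phi>' t p" if p: "p \<in> topspace M" for p
  proof -
    have b: "hess_shift_norm2 A g (1 / (2 * ?\<tau>)) ?f p + ricci_grad A g ?f p =
       laplacian A g ?h p / 2 - grad_ip ?f (laplacian A g ?f) p - laplacian A g ?f p / ?\<tau> + n / (4 * ?\<tau>\<^sup>2)"
      unfolding bochner_manifold[OF fm[OF t] p] h_def n_def by (simp add: power2_eq_square)
    have e: "grad_ip ?f (E t) p = grad_ip ?f (laplacian A g ?f) p - grad_ip ?f ?h p"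
      unfolding E_def by (rule grad_ip_right_combination[OF smooth_fun_laplacian[OF fm[OF t]] hm[OF t] fm[OF t] p])
    have m1: "grad_ip ?u ?h p = - ?u p * grad_ip ?f ?h p" by (rule grad_ip_u[OF t p hm[OF t]])
    have m2: "grad_ip ?h ?u p = grad_ip ?u ?h p" "grad_ip ?f ?u p = grad_ip ?u ?f p" using grad_ip_sym[OF p] by blast+
    have m3: "grad_ip ?one ?u p = 0" by (rule grad_ip_const)
    have \<tau>0: "?\<tau> \<noteq> 0" using \<tau>pos[OF t] by simp
    have T: "?T p = (?\<tau> * laplacian A g ?h p - 2 * ?\<tau> * grad_ip ?f (laplacian A g ?f) p
        - 2 * laplacian A g ?f p + n / (2 * ?\<tau>)) * ?u p"
      unfolding b using \<tau>0 by (simp add: field_simps power2_eq_square)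
    show ?thesis
      unfolding T R_def L_def m3 m2 m1 \<Phi>'_def e E_def by (simp add: algebra_simps)
  qed
  have "(\<integral>p. ?T p \<partial>vol) = (\<integral>p. R p - \<Phi>' t p \<partial>vol)"
    by (rule Bochner_Integration.integral_cong[OF refl]) (use key in \<open>simp add: space_vol\<close>)
  also have "\<dots> = - (\<integral>p. \<Phi>' t p \<partial>vol)"
    using Ri Ck_fun_integrable[OF D(2)] by simp
  finally have T: "(\<integral>p. \<Phi>' t p \<partial>vol) = - (\<integral>p. ?T p \<partial>vol)" by simp
  show ?thesis
    using D(1) unfolding T by (rule has_field_derivative_transform_within_open[OF _ I t]) (rule W[symmetric])
qed

end

theorem theorem0p1:
  fixes M :: "'a topology"
    and A :: "('a, 'n::finite) chart set"
    and g :: "('a, 'n) chart \<Rightarrow> real ^ 'n \<Rightarrow> real ^ 'n ^ 'n"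
    and I :: "real set"
    and u f :: "real \<Rightarrow> 'a \<Rightarrow> real"
    and \<tau> :: "real \<Rightarrow> real"
  assumes "closed_riemannian_manifold M A g"
    and "open I" and "is_interval I"
    and "heat_solution M A g I u"
    and "\<And>t p. t \<in> I \<Longrightarrow> p \<in> topspace M \<Longrightarrow> u t p > 0"
    and "\<And>t. t \<in> I \<Longrightarrow> (\<integral>p. u t p \<partial>riemannian_volume M A g) = 1"
    and "\<And>t. t \<in> I \<Longrightarrow> \<tau> t > 0"
    and "\<And>t. t \<in> I \<Longrightarrow> (\<tau> has_real_derivative 1) (at t)"
    and "\<And>t p. t \<in> I \<Longrightarrow> p \<in> topspace M \<Longrightarrow>
           u t p = exp (- f t p) / (4 * pi * \<tau> t) powr (real CARD('n) / 2)"
  shows "(\<forall>t\<in>I. ((\<lambda>s. entropy_W M A g (f s) (\<tau> s)) has_real_derivative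
             - (\<integral>p. 2 * \<tau> t * (hess_shift_norm2 A g (1 / (2 * \<tau> t)) (f t) p + ricci_grad A g (f t) p)
                     * u t p \<partial>riemannian_volume M A g)) (at t)) \<and>
         (nonneg_ricci A g \<longrightarrow> antimono_on I (\<lambda>t. entropy_W M A g (f t) (\<tau> t)))"
proof -
  interpret closed_riemannian M A g by unfold_locales (rule assms(1))
  let ?W = "\<lambda>s. entropy_W M A g (f s) (\<tau> s)"
  let ?T = "\<lambda>t. \<integral>p. 2 * \<tau> t * (hess_shift_norm2 A g (1 / (2 * \<tau> t)) (f t) p + ricci_grad A g (f t) p)
                     * u t p \<partial>riemannian_volume M A g"
  have der: "(?W has_real_derivative - ?T t) (at t)" if "t \<in> I" for t
    using entropy_derivative[OF assms(2,4,5,7,8,9) that] by (simp only: vol_def)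
  have "antimono_on I ?W" if ric: "nonneg_ricci A g"
  proof (rule monotone_onI)
    fix r s assume rs: "r \<in> I" "s \<in> I" "r \<le> s"
    have sub: "t \<in> I" if "r \<le> t" "t \<le> s" for t
      using assms(3) rs that unfolding is_interval_1 by blast
    have nonneg: "?T t \<ge> 0" if t: "t \<in> I" for t
      unfolding vol_def[symmetric]
    proof (rule Bochner_Integration.integral_nonneg)
      fix p assume "p \<in> space vol"
      then have p: "p \<in> topspace M" by (simp add: space_vol)
      show "0 \<le> 2 * \<tau> t * (hess_shift_norm2 A g (1 / (2 * \<tau> t)) (f t) p + ricci_grad A g (f t) p) * u t p"
        using hess_ricci_nonneg[OF ric p] assms(5)[OF t p] assms(7)[OF t]
        by (intro mult_nonneg_nonneg) (auto intro: less_imp_le)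
    qed
    show "?W s \<le> ?W r"
    proof (rule DERIV_nonpos_imp_nonincreasing[OF rs(3)])
      fix t assume "r \<le> t" "t \<le> s"
      then have t: "t \<in> I" by (rule sub)
      show "\<exists>y. (?W has_real_derivative y) (at t) \<and> y \<le> 0"
        by (intro exI conjI, rule der[OF t]) (use nonneg[OF t] in simp)
    qed
  qed
  then show ?thesis using der by blast
qed

end
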